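(* Let $n\ge 1$, let $V:\mathbf{T}^n\to\mathbf{R}$ be $C^r$ for some $r>2n+2$, let $|\cdot|^2$ be a flat Riemannian metric on $\mathbf{T}^n=\mathbf{R}^n/\mathbf{Z}^n$, and let $H_\varepsilon:T^*\mathbf{T}^n\to\mathbf{R}$ be the family of mechanical Hamiltonians $$H_\varepsilon(q,p)=\tfrac12|p|^2+\varepsilon V(q).$$ Fix the thermostat mass $M>0$ and the temperature $T>0$, and let $$F_\varepsilon(s,q,p_s,p)=H_\varepsilon(q,p\,s^{-1})+\frac{1}{2M}p_s^2+nkT\ln s$$ be the Nosé-thermostated Hamiltonian associated to $H_\varepsilon$, on $T^*(\mathbf{R}^+\times\mathbf{T}^n)$. Then there is an open neighbourhood of the set of thermostatic equilibria of $F_0$ on which $F_0$ is both Kolmogorov non-degenerate and iso-energetically non-degenerate.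
   Context: Here $\mathbf{R}^+=(0,\infty)$, $k>0$ is Boltzmann's constant, $|p|$ is the norm of a covector with respect to the dual of the metric, $(s,p_s)$ and $(q,p)$ are canonically conjugate pairs, and $T^*(\mathbf{R}^+\times\mathbf{T}^n)$ carries its canonical symplectic structure. The set of thermostatic equilibria of a thermostated Hamiltonian $F$ is the set of points at which, along the Hamiltonian flow of $F$, $\dot s=0=\dot p_s$ (this set is not assumed invariant). For $F_0$ it is $\{p_s=0,\ |p|^2=nkT\,s^2\}$. Non-degeneracy. For a completely integrable Hamiltonian written as a function $h(I)$ of action variables $I=(I_1,\dots,I_m)$, with frequency vector $\omega=[\partial h/\partial I_i]$ and $d\omega=[\partial^2h/\partial I_i\partial I_j]$, $h$ is Kolmogorov non-degenerate at $I=C$ if $\det d\omega|_{I=C}\ne0$, and iso-energetically non-degenerate at $I=C$ if $$\det\begin{bmatrix}d\omega&\omega\\ \omega^{\top}&0\end{bmatrix}_{I=C}\neq0 .$$ A Hamiltonian is non-degenerate (in either sense) on a set of phase space if it is so at the action values of every point of that set. Action variables for $F_0$. $F_0$ does not depend on $q$ (in coordinates where the metric has constant coefficients), and on $\{p\neq0\}$, for each fixed $p$, it is a one-degree-of-freedom Hamiltonian in $(s,p_s)$ with closed level curves surrounding a unique minimum, which is a thermostatic equilibrium. The $m=n+1$ action variables are $p_1,\dots,p_n$ and $A=\frac1{2\pi}\oint p_s\,ds\ge0$ (the integral over the level curve through the point; both non-degeneracy conditions are unaffected by linear changes of the actions). The thermostatic equilibria correspond to $A=0$; there the derivatives of $F_0=h(A,p)$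 are understood as those of its smooth extension up to $A=0$. *)

theory Defs
  imports "HOL-Analysis.Analysis"
begin

section \<open>Differentiability classes\<close>

primrec Ck_on :: "nat \<Rightarrow> 'a::real_normed_vector set \<Rightarrow> ('a \<Rightarrow> 'b::real_normed_vector) \<Rightarrow> bool" where
  "Ck_on 0 S f \<longleftrightarrow> continuous_on S f"
| "Ck_on (Suc k) S f \<longleftrightarrow>
     (\<forall>x\<in>S. f differentiable (at x)) \<and> (\<forall>v. Ck_on k S (\<lambda>x. frechet_derivative f (at x) v))"

definition smooth_on :: "'a::real_normed_vector set \<Rightarrow> ('a \<Rightarrow> 'b::real_normed_vector) \<Rightarrow> bool" where
  "smooth_on S f \<longleftrightarrow> (\<forall>k. Ck_on k S f)"

primrec Holder_deriv :: "real \<Rightarrow> nat \<Rightarrow> ('a::real_normed_vector \<Rightarrow> 'b::real_normed_vector) \<Rightarrow> bool" where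
  "Holder_deriv \<alpha> 0 f \<longleftrightarrow> (\<exists>C. \<forall>x y. dist (f x) (f y) \<le> C * dist x y powr \<alpha>)"
| "Holder_deriv \<alpha> (Suc k) f \<longleftrightarrow> (\<forall>v. Holder_deriv \<alpha> k (\<lambda>x. frechet_derivative f (at x) v))"

text \<open>\<open>C\<^sup>r\<close> for real \<open>r \<ge> 0\<close>: the usual class when \<open>r\<close> is an integer, the Hoelder class
  (derivatives of order \<open>\<lfloor>r\<rfloor>\<close> are Hoelder of exponent \<open>r - \<lfloor>r\<rfloor>\<close>) otherwise.\<close>

definition class_C :: "real \<Rightarrow> ('a::real_normed_vector \<Rightarrow> 'b::real_normed_vector) \<Rightarrow> bool" where
  "class_C r f \<longleftrightarrow> Ck_on (nat \<lfloor>r\<rfloor>) UNIV f \<and> (frac r > 0 \<longrightarrow> Holder_deriv (frac r) (nat \<lfloor>r\<rfloor>) f)"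

section \<open>Flat Riemannian metrics on the torus\<close>

text \<open>Objects on \<open>\<^bold>T\<^sup>n = \<^bold>R\<^sup>n/\<^bold>Z\<^sup>n\<close> are represented by their lifts to \<open>\<^bold>R\<^sup>n\<close>, \<open>n = CARD('n)\<close>.\<close>

definition int_lattice :: "(real^'n::finite) set" where
  "int_lattice = {m. \<forall>i. m $ i \<in> \<int>}"

definition torus_periodic :: "(real^'n::finite \<Rightarrow> 'b) \<Rightarrow> bool" where
  "torus_periodic f \<longleftrightarrow> (\<forall>m\<in>int_lattice. \<forall>q. f (q + m) = f q)"

definition torus_metric :: "(real^'n::finite \<Rightarrow> real^'n^'n) \<Rightarrow> bool" where
  "torus_metric g \<longleftrightarrow> torus_periodic g \<and> smooth_on UNIV g \<and>
     (\<forall>q. transpose (g q) = g q \<and> (\<forall>v. v \<noteq> 0 \<longrightarrow> v \<bullet> (g q *v v) > 0))"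

definition partial_deriv :: "'n::finite \<Rightarrow> (real^'n \<Rightarrow> real) \<Rightarrow> real^'n \<Rightarrow> real" where
  "partial_deriv i f x = frechet_derivative f (at x) (axis i 1)"

definition christoffel :: "(real^'n::finite \<Rightarrow> real^'n^'n) \<Rightarrow> 'n \<Rightarrow> 'n \<Rightarrow> 'n \<Rightarrow> real^'n \<Rightarrow> real" where
  "christoffel g i j k q = (\<Sum>l\<in>UNIV. matrix_inv (g q) $ i $ l *
     (partial_deriv j (\<lambda>x. g x $ l $ k) q + partial_deriv k (\<lambda>x. g x $ l $ j) q
        - partial_deriv l (\<lambda>x. g x $ j $ k) q)) / 2"

text \<open>The components \<open>R\<^sup>i\<^sub>j\<^sub>k\<^sub>l\<close> of the Riemann curvature tensor of the Levi-Civita connection.\<close>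

definition riemann_curvature ::
  "(real^'n::finite \<Rightarrow> real^'n^'n) \<Rightarrow> 'n \<Rightarrow> 'n \<Rightarrow> 'n \<Rightarrow> 'n \<Rightarrow> real^'n \<Rightarrow> real" where
  "riemann_curvature g i j k l q =
     partial_deriv k (christoffel g i l j) q - partial_deriv l (christoffel g i k j) q
     + (\<Sum>m\<in>UNIV. christoffel g i k m q * christoffel g m l j q
                   - christoffel g i l m q * christoffel g m k j q)"

definition flat_metric :: "(real^'n::finite \<Rightarrow> real^'n^'n) \<Rightarrow> bool" where
  "flat_metric g \<longleftrightarrow> (\<forall>i j k l q. riemann_curvature g i j k l q = 0)"

text \<open>\<open>\<phi>\<close> is the lift of a diffeomorphism of the torus, and in the coordinates \<open>Q = \<phi> q\<close> the
  metric has constant coefficients \<open>G\<close>. By a classical theorem every flat metric on the torus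
  admits such coordinates.\<close>

definition flat_coordinates :: "(real^'n::finite \<Rightarrow> real^'n^'n) \<Rightarrow> (real^'n \<Rightarrow> real^'n) \<Rightarrow> bool" where
  "flat_coordinates g \<phi> \<longleftrightarrow>
     bij \<phi> \<and> smooth_on UNIV \<phi> \<and> smooth_on UNIV (inv \<phi>) \<and>
     (\<forall>q q'. q' - q \<in> int_lattice \<longleftrightarrow> \<phi> q' - \<phi> q \<in> int_lattice) \<and>
     (\<exists>G. \<forall>q. g q = transpose (jacobian \<phi> (at q)) ** G ** jacobian \<phi> (at q))"

text \<open>The momenta conjugate to the coordinates \<open>Q = \<phi> q\<close>, determined by \<open>P \<cdot> dQ = p \<cdot> dq\<close>.\<close>

definition conjugate_momentum ::
  "(real^'n::finite \<Rightarrow> real^'n) \<Rightarrow> real^'n \<Rightarrow> real^'n \<Rightarrow> real^'n" where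
  "conjugate_momentum \<phi> q p = matrix_inv (transpose (jacobian \<phi> (at q))) *v p"

section \<open>Nose-thermostated mechanical Hamiltonians\<close>

definition conorm_sq :: "(real^'n::finite \<Rightarrow> real^'n^'n) \<Rightarrow> real^'n \<Rightarrow> real^'n \<Rightarrow> real" where
  "conorm_sq g q p = p \<bullet> (matrix_inv (g q) *v p)"

definition mechanical_hamiltonian ::
  "(real^'n::finite \<Rightarrow> real^'n^'n) \<Rightarrow> (real^'n \<Rightarrow> real) \<Rightarrow> real \<Rightarrow> (real^'n) \<times> (real^'n) \<Rightarrow> real" where
  "mechanical_hamiltonian g V \<epsilon> = (\<lambda>(q, p). conorm_sq g q p / 2 + \<epsilon> * V q)"

text \<open>Points of the lifted phase space are \<open>(s, q, p\<^sub>s, p)\<close>, subject to \<open>s > 0\<close>.\<close>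

type_synonym 'n phase = "real \<times> (real^'n) \<times> real \<times> (real^'n)"

definition nose_thermostat ::
  "real \<Rightarrow> real \<Rightarrow> real \<Rightarrow> ((real^'n::finite) \<times> (real^'n) \<Rightarrow> real) \<Rightarrow> 'n phase \<Rightarrow> real" where
  "nose_thermostat M k T H =
     (\<lambda>(s, q, ps, p). H (q, p /\<^sub>R s) + ps\<^sup>2 / (2 * M) + real CARD('n) * k * T * ln s)"

text \<open>The Hamiltonian vector field for the symplectic form \<open>ds \<and> dp\<^sub>s + \<Sum>\<^sub>i dq\<^sub>i \<and> dp\<^sub>i\<close>.\<close>

definition hamiltonian_vector_field :: "('n::finite phase \<Rightarrow> real) \<Rightarrow> 'n phase \<Rightarrow> 'n phase" where
  "hamiltonian_vector_field F = (\<lambda>(s, q, ps, p).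
     (deriv (\<lambda>x. F (s, q, x, p)) ps,
      (\<chi> i. deriv (\<lambda>x. F (s, q, ps, p + x *\<^sub>R axis i 1)) 0),
      - deriv (\<lambda>x. F (x, q, ps, p)) s,
      (\<chi> i. - deriv (\<lambda>x. F (s, q + x *\<^sub>R axis i 1, ps, p)) 0)))"

definition thermostatic_equilibria :: "('n::finite phase \<Rightarrow> real) \<Rightarrow> 'n phase set" where
  "thermostatic_equilibria F =
     {z. fst z > 0 \<and>
         (case hamiltonian_vector_field F z of (s', q', ps', p') \<Rightarrow> s' = 0 \<and> ps' = 0)}"

section \<open>Action variables\<close>

text \<open>The level curve is traversed once. If it degenerates to a point, the loop is constant.\<close>

definition traverses_once :: "(real \<Rightarrow> real \<times> real) \<Rightarrow> (real \<times> real) set \<Rightarrow> bool" where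
  "traverses_once \<gamma> L \<longleftrightarrow>
     \<gamma> piecewise_C1_differentiable_on {0..1} \<and> pathfinish \<gamma> = pathstart \<gamma> \<and>
     path_image \<gamma> = L \<and> (simple_path \<gamma> \<or> L = {pathstart \<gamma>})"

text \<open>\<open>(1/2\<pi>) \<oint> p\<^sub>s ds\<close> over the level curve of \<open>f\<close> through \<open>w\<close>; the absolute value corresponds to
  the choice of orientation for which the action is nonnegative.\<close>

definition level_curve_action :: "(real \<times> real \<Rightarrow> real) \<Rightarrow> real \<times> real \<Rightarrow> real" where
  "level_curve_action f w =
     (THE A. \<exists>\<gamma>. traverses_once \<gamma> {x. fst x > 0 \<and> f x = f w} \<and>
        A = \<bar>integral {0..1}
               (\<lambda>t. snd (\<gamma> t) * fst (vector_derivative \<gamma> (at t within {0..1})))\<bar> / (2 * pi))"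

text \<open>The \<open>n + 1\<close> action variables: the index \<open>None\<close> carries \<open>A\<close>, the index \<open>Some i\<close> the \<open>i\<close>-th
  momentum in the coordinates \<open>\<phi>\<close>. Fixing \<open>(q, p)\<close> is the same as fixing the point of
  \<open>T\<^sup>*\<^bold>T\<^sup>n\<close> in the coordinates \<open>(Q, P)\<close>.\<close>

definition actions ::
  "('n::finite phase \<Rightarrow> real) \<Rightarrow> (real^'n \<Rightarrow> real^'n) \<Rightarrow> 'n phase \<Rightarrow> real^('n option)" where
  "actions F \<phi> = (\<lambda>(s, q, ps, p). \<chi> i. case i of
       None \<Rightarrow> level_curve_action (\<lambda>(s', ps'). F (s', q, ps', p)) (s, ps)
     | Some j \<Rightarrow> conjugate_momentum \<phi> q p $ j)"

definition action_domain :: "'n::finite phase set" where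
  "action_domain = {(s, q, ps, p). s > 0 \<and> p \<noteq> 0}"

text \<open>\<open>F = h \<circ> actions\<close> on the domain of the actions, where \<open>h\<close> is smooth on an open set containing
  all action values, including those with \<open>A = 0\<close>. The values of \<open>h\<close> at \<open>A < 0\<close> are not determined
  by \<open>F\<close>, but by continuity the derivatives of \<open>h\<close> at points with \<open>A = 0\<close> are.\<close>

definition function_of_actions ::
  "('n::finite phase \<Rightarrow> real) \<Rightarrow> (real^'n \<Rightarrow> real^'n) \<Rightarrow> (real^('n option) \<Rightarrow> real) \<Rightarrow> bool" where
  "function_of_actions F \<phi> h \<longleftrightarrow>
     (\<exists>W. open W \<and> actions F \<phi> ` action_domain \<subseteq> W \<and> smooth_on W h) \<and>
     (\<forall>z\<in>action_domain. F z = h (actions F \<phi> z))"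

section \<open>Non-degeneracy\<close>

definition frequency :: "(real^'m::finite \<Rightarrow> real) \<Rightarrow> real^'m \<Rightarrow> real^'m" where
  "frequency h I = (\<chi> i. partial_deriv i h I)"

definition kolmogorov_nondegenerate :: "(real^'m::finite \<Rightarrow> real) \<Rightarrow> real^'m \<Rightarrow> bool" where
  "kolmogorov_nondegenerate h C \<longleftrightarrow> det (jacobian (frequency h) (at C)) \<noteq> 0"

definition bordered_matrix :: "real^'m::finite^'m \<Rightarrow> real^'m \<Rightarrow> real^('m option)^('m option)" where
  "bordered_matrix D w = (\<chi> a b. case (a, b) of
       (Some i, Some j) \<Rightarrow> D $ i $ j
     | (Some i, None) \<Rightarrow> w $ i
     | (None, Some j) \<Rightarrow> w $ j
     | (None, None) \<Rightarrow> 0)"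

definition isoenergetically_nondegenerate :: "(real^'m::finite \<Rightarrow> real) \<Rightarrow> real^'m \<Rightarrow> bool" where
  "isoenergetically_nondegenerate h C \<longleftrightarrow>
     det (bordered_matrix (jacobian (frequency h) (at C)) (frequency h C)) \<noteq> 0"

end

theory Submission
  imports Defs
begin

text \<open>
  In coordinates in which the metric is constant, \<open>F\<^sub>0\<close> depends on the momentum only through
  \<open>R = |p|\<^sup>2\<close>. For fixed \<open>p \<noteq> 0\<close> a scaling of \<open>s\<close> and \<open>p\<^sub>s\<close> turns it, with \<open>c = n k T\<close>, into
  \<open>c (1/(2 u\<^sup>2) + ln u + y\<^sup>2) + (c/2) (ln R - ln c)\<close>, and multiplies areas by \<open>sqrt (2 M R)\<close>. Let \<open>E\<close> be the
  inverse of the function that assigns to a height above the minimum the action of the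
  normalised oscillator \<open>1/(2 u\<^sup>2) + ln u + y\<^sup>2\<close>. Then
  \<open>h(A, p) = c (1/2 + E(A / sqrt (2 M R))) + (c/2) (ln R - ln c)\<close>.

  At zero action both determinants are computed from the derivatives of \<open>E\<close> at \<open>0\<close>. The
  blocks of the plane spanned by the \<open>A\<close>-axis and the direction of \<open>p\<close> have determinants that are
  nonzero multiples of \<open>E'' + E'\<^sup>2\<close>; in the directions orthogonal to \<open>p\<close> the Hessian is \<open>c/R\<close> times the cometric
  (\<open>kernel_trivial\<close>). The expansion of \<open>E\<close> gives \<open>E' = 2\<close> and \<open>E'' = - 11/3\<close>, hence
  \<open>E'' + E'\<^sup>2 = 1/3\<close> (\<open>energy_of_action\<close>). By continuity non-degeneracy holds on an open set of actions
  that contains all those with \<open>A = 0\<close> (\<open>open_nondegenerate\<close>); its preimage is the desired neighbourhood,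
  because \<open>A = 0\<close> at equilibria.

  Two points need care. The first is that \<open>E\<close> extends smoothly to negative actions. The turning
  points at height \<open>\<xi>\<^sup>2\<close> depend smoothly on \<open>\<xi>\<close>, but the action has to be smooth in \<open>\<xi>\<^sup>2\<close>. In terms of
  \<open>1/u\<^sup>2\<close> the pairs of turning points have the explicit parametrization
  \<open>(\<sigma> / sinh \<sigma>) e\<^sup>\<plusminus>\<^sup>\<sigma>\<close>. The mean of \<open>u\<close> over a pair, and half the difference divided by \<open>\<sigma>\<close>,
  are even in \<open>\<sigma>\<close>, hence smooth functions of \<open>\<sigma>\<^sup>2\<close>;
  and \<open>\<sigma>\<^sup>2\<close> is a smooth increasing function of the height, on both sides of \<open>0\<close>
  (\<open>turning_point_functions\<close>). The second is that the action is defined by an arbitrary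
  piecewise \<open>C\<^sup>1\<close> traversal of the level curve. In the coordinates \<open>(\<xi>, y)\<close> the curve is a circle, and
  lifting the traversal to an angle shows that the integral does not depend on it
  (\<open>level_curve_line_integral\<close>).
\<close>

section \<open>Calculus of differentiability classes\<close>

lemma Ck_on_cong:
  assumes "open S" "\<And>x. x \<in> S \<Longrightarrow> f x = g x" "Ck_on k S f"
  shows "Ck_on k S g"
  using assms(2,3)
proof (induction k arbitrary: f g)
  case 0
  then show ?case by (simp cong: continuous_on_cong)
next
  case (Suc k)
  have der: "(g has_derivative frechet_derivative f (at x)) (at x)" if "x \<in> S" for x
    using that Suc.prems \<open>open S\<close>
    by (intro has_derivative_transform_within_open[of f _ x UNIV S g])
       (auto simp: frechet_derivative_works[symmetric])
  have "frechet_derivative f (at x) = frechet_derivative g (at x)" if "x \<in> S" for x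
    using frechet_derivative_at[OF der[OF that]] .
  then have "Ck_on k S (\<lambda>x. frechet_derivative g (at x) v)" for v
    using Suc.IH[of "\<lambda>x. frechet_derivative f (at x) v" "\<lambda>x. frechet_derivative g (at x) v"]
      Suc.prems by simp
  then show ?case
    using der by (auto simp: differentiable_def)
qed

text \<open>The form in which \<open>Ck_on\<close> is used: any formula for the derivative will do, so that the
  choice made by \<open>frechet_derivative\<close> never has to be computed.\<close>

lemma Ck_on_SucI:
  assumes "open S" "\<And>x. x \<in> S \<Longrightarrow> (f has_derivative f' x) (at x)"
    "\<And>v. Ck_on k S (\<lambda>x. f' x v)"
  shows "Ck_on (Suc k) S f"
proof -
  have "f' x = frechet_derivative f (at x)" if "x \<in> S" for x
    using frechet_derivative_at[OF assms(2)[OF that]] .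
  then have "Ck_on k S (\<lambda>x. frechet_derivative f (at x) v)" for v
    by (intro Ck_on_cong[OF assms(1) _ assms(3)[of v]]) auto
  then show ?thesis
    using assms(2) by (auto simp: differentiable_def)
qed

lemma Ck_on_subset:
  assumes "Ck_on k T f" "S \<subseteq> T"
  shows "Ck_on k S f"
  using assms(1)
proof (induction k arbitrary: f)
  case 0
  then show ?case using assms(2) continuous_on_subset by auto
next
  case (Suc k)
  then show ?case using assms(2) by auto
qed

lemma Ck_on_SucD: "Ck_on (Suc k) S f \<Longrightarrow> Ck_on k S f"
proof (induction k arbitrary: f)
  case 0
  then show ?case
    by (auto intro!: continuous_at_imp_continuous_on differentiable_imp_continuous_within)
next
  case (Suc k)
  then show ?case by (metis Ck_on.simps(2))
qed

lemma Ck_on_imp_continuous_on: "Ck_on k S f \<Longrightarrow> continuous_on S f"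
  by (induction k) (use Ck_on_SucD in \<open>auto simp del: Ck_on.simps(2)\<close>)

lemma Ck_on_const: "open S \<Longrightarrow> Ck_on k S (\<lambda>x. c)"
proof (induction k arbitrary: c)
  case (Suc k)
  show ?case
    by (rule Ck_on_SucI[where f' = "\<lambda>x v. 0"]) (use Suc in \<open>auto intro!: derivative_eq_intros\<close>)
qed auto

lemma Ck_on_bounded_linear:
  assumes "open S" "bounded_linear f"
  shows "Ck_on k S f"
proof (cases k)
  case 0
  then show ?thesis using assms by (auto simp: linear_continuous_on)
next
  case (Suc l)
  show ?thesis unfolding Suc
    by (rule Ck_on_SucI[where f' = "\<lambda>x v. f v"])
       (use assms bounded_linear_imp_has_derivative in \<open>auto intro: Ck_on_const\<close>)
qed

lemma Ck_on_add:
  assumes "open S" "Ck_on k S f" "Ck_on k S g"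
  shows "Ck_on k S (\<lambda>x. f x + g x)"
  using assms(2,3)
proof (induction k arbitrary: f g)
  case 0
  then show ?case by (auto intro: continuous_intros)
next
  case (Suc k)
  show ?case
    by (rule Ck_on_SucI[OF \<open>open S\<close>, where
          f' = "\<lambda>x v. frechet_derivative f (at x) v + frechet_derivative g (at x) v"])
       (use Suc in \<open>auto intro!: has_derivative_add simp: frechet_derivative_works[symmetric]\<close>)
qed

lemma Ck_on_mult:
  fixes f g :: "'a::real_normed_vector \<Rightarrow> real"
  assumes "open S" "Ck_on k S f" "Ck_on k S g"
  shows "Ck_on k S (\<lambda>x. f x * g x)"
  using assms(2,3)
proof (induction k arbitrary: f g)
  case 0
  then show ?case by (auto intro: continuous_intros)
next
  case (Suc k)
  note prev = Suc.prems[THEN Ck_on_SucD]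
  show ?case
    by (rule Ck_on_SucI[OF \<open>open S\<close>, where
          f' = "\<lambda>x v. f x * frechet_derivative g (at x) v + frechet_derivative f (at x) v * g x"])
       (use Suc prev in \<open>auto intro!: has_derivative_mult Ck_on_add[OF \<open>open S\<close>]
          simp: frechet_derivative_works[symmetric]\<close>)
qed

lemma Ck_on_cmult:
  fixes f :: "'a::real_normed_vector \<Rightarrow> real"
  assumes "open S" "Ck_on k S f"
  shows "Ck_on k S (\<lambda>x. c * f x)"
  using Ck_on_mult[OF assms(1) Ck_on_const assms(2)] assms(1) by blast

lemma Ck_on_diff:
  fixes f g :: "'a::real_normed_vector \<Rightarrow> real"
  assumes "open S" "Ck_on k S f" "Ck_on k S g"
  shows "Ck_on k S (\<lambda>x. f x - g x)"
  using Ck_on_add[OF assms(1,2) Ck_on_cmult[OF assms(1,3), of "-1"]] by simp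

text \<open>The derivative of \<open>g \<circ> f\<close> is \<open>(g' \<circ> f) f'\<close>, so the claim for \<open>k + 1\<close> follows from the claim
  for \<open>k\<close> and \<open>g'\<close> together with the product rule; this is why \<open>g\<close> varies in the induction.\<close>

lemma Ck_on_compose_real:
  fixes f :: "'a::real_normed_vector \<Rightarrow> real" and g :: "real \<Rightarrow> real"
  assumes "open S" "f ` S \<subseteq> T" "Ck_on k S f" "Ck_on k T g"
  shows "Ck_on k S (\<lambda>x. g (f x))"
  using assms(3,4)
proof (induction k arbitrary: g)
  case 0
  then show ?case using assms(2) by (auto intro: continuous_on_compose2)
next
  case (Suc k)
  have "((\<lambda>x. g (f x)) has_derivative
      (\<lambda>v. frechet_derivative g (at (f x)) 1 * frechet_derivative f (at x) v)) (at x)"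
    if "x \<in> S" for x
  proof -
    have g: "(g has_derivative frechet_derivative g (at (f x))) (at (f x))"
      using Suc.prems that assms(2) by (auto simp: frechet_derivative_works[symmetric])
    have f: "(f has_derivative frechet_derivative f (at x)) (at x)"
      using Suc.prems that by (auto simp: frechet_derivative_works[symmetric])
    have "frechet_derivative g (at (f x)) w = frechet_derivative g (at (f x)) 1 * w" for w
      using linear_scale[OF has_derivative_linear[OF g], of w 1] by simp
    then have "(\<lambda>v. frechet_derivative g (at (f x)) (frechet_derivative f (at x) v)) =
        (\<lambda>v. frechet_derivative g (at (f x)) 1 * frechet_derivative f (at x) v)"
      by (intro ext)
    then show ?thesis
      using has_derivative_compose[OF f g] by metis
  qed
  moreover have "Ck_on k S (\<lambda>x. frechet_derivative g (at (f x)) 1 * frechet_derivative f (at x) v)" for v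
    using Suc.prems Ck_on_SucD[OF Suc.prems(1)]
    by (intro Ck_on_mult[OF \<open>open S\<close>] Suc.IH[of "\<lambda>y. frechet_derivative g (at y) 1"]) simp_all
  ultimately show ?case
    by (rule Ck_on_SucI[OF \<open>open S\<close>])
qed

lemma Ck_on_Suc_real:
  fixes f :: "real \<Rightarrow> real"
  assumes "open S" "\<And>x. x \<in> S \<Longrightarrow> (f has_real_derivative f' x) (at x)" "Ck_on k S f'"
  shows "Ck_on (Suc k) S f"
  by (rule Ck_on_SucI[OF assms(1), where f' = "\<lambda>x v. f' x * v"])
     (use assms in \<open>auto simp: has_field_derivative_def intro!: Ck_on_mult Ck_on_const\<close>)

lemma frechet_derivative_real:
  "(f has_real_derivative d) (at x) \<Longrightarrow> frechet_derivative f (at x) = (\<lambda>v. d * v)"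
  by (simp add: frechet_derivative_at[symmetric] has_field_derivative_def)

lemma Ck_on_deriv_real:
  fixes f :: "real \<Rightarrow> real"
  assumes "open S" "Ck_on (Suc k) S f" "\<And>x. x \<in> S \<Longrightarrow> (f has_real_derivative f' x) (at x)"
  shows "Ck_on k S f'"
proof -
  have "Ck_on k S (\<lambda>x. frechet_derivative f (at x) 1)" using assms(2) by simp
  then show ?thesis
    by (rule Ck_on_cong[OF assms(1), rotated]) (simp add: frechet_derivative_real[OF assms(3)])
qed

lemma smooth_on_deriv_real:
  fixes f :: "real \<Rightarrow> real"
  assumes "open S" "smooth_on S f"
  obtains f' where "smooth_on S f'" "\<And>x. x \<in> S \<Longrightarrow> (f has_real_derivative f' x) (at x)"
proof -
  have d: "(f has_real_derivative deriv f x) (at x)" if "x \<in> S" for x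
  proof -
    have "Ck_on (Suc 0) S f" using assms(2) unfolding smooth_on_def by blast
    then have "f differentiable (at x)" using that by simp
    then show ?thesis
      by (metis DERIV_deriv_iff_real_differentiable)
  qed
  moreover have "smooth_on S (deriv f)"
    using assms d unfolding smooth_on_def by (metis Ck_on_deriv_real)
  ultimately show ?thesis using that by blast
qed

lemma smooth_on_intros:
  fixes f g :: "'a::real_normed_vector \<Rightarrow> real"
  assumes "open S"
  shows "smooth_on S (\<lambda>x. c)"
    and "smooth_on S f \<Longrightarrow> smooth_on S g \<Longrightarrow> smooth_on S (\<lambda>x. f x + g x)"
    and "smooth_on S f \<Longrightarrow> smooth_on S g \<Longrightarrow> smooth_on S (\<lambda>x. f x - g x)"
    and "smooth_on S f \<Longrightarrow> smooth_on S g \<Longrightarrow> smooth_on S (\<lambda>x. f x * g x)"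
    and "bounded_linear f \<Longrightarrow> smooth_on S f"
  using assms
  by (simp_all add: smooth_on_def Ck_on_const Ck_on_add Ck_on_diff Ck_on_mult Ck_on_bounded_linear)

lemma smooth_on_subset: "smooth_on T f \<Longrightarrow> S \<subseteq> T \<Longrightarrow> smooth_on S f"
  unfolding smooth_on_def using Ck_on_subset by blast

lemma smooth_on_compose_real:
  fixes f :: "'a::real_normed_vector \<Rightarrow> real" and g :: "real \<Rightarrow> real"
  assumes "open S" "smooth_on T g" "smooth_on S f" "f ` S \<subseteq> T"
  shows "smooth_on S (\<lambda>x. g (f x))"
  using assms Ck_on_compose_real unfolding smooth_on_def by blast

lemma smooth_on_imp_continuous_on: "smooth_on S f \<Longrightarrow> continuous_on S f"
  unfolding smooth_on_def using Ck_on_imp_continuous_on by blast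

lemma smooth_on_imp_differentiable: "smooth_on S f \<Longrightarrow> x \<in> S \<Longrightarrow> f differentiable (at x)"
  unfolding smooth_on_def by (metis Ck_on.simps(2))

lemma smooth_on_frechet_derivative:
  "smooth_on S f \<Longrightarrow> smooth_on S (\<lambda>x. frechet_derivative f (at x) v)"
  unfolding smooth_on_def by (metis Ck_on.simps(2))

text \<open>A solution of \<open>g' = F(g)\<close> gains one derivative each time that the equation is read with \<open>g\<close>
  as regular as is known so far. Reciprocals, square roots and inverse functions all solve such
  an equation.\<close>

lemma smooth_on_autonomous:
  fixes g F :: "real \<Rightarrow> real"
  assumes "open T" "smooth_on S F" "g ` T \<subseteq> S"
    "\<And>y. y \<in> T \<Longrightarrow> (g has_real_derivative F (g y)) (at y)"
  shows "smooth_on T g"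
proof -
  have "Ck_on k T g" for k
  proof (induction k)
    case 0
    show ?case using assms(4) by (auto intro!: continuous_at_imp_continuous_on DERIV_isCont)
  next
    case (Suc k)
    have "Ck_on k T (\<lambda>y. F (g y))"
      using Ck_on_compose_real[OF assms(1,3) Suc] assms(2) unfolding smooth_on_def by blast
    then show ?case by (intro Ck_on_Suc_real[OF assms(1,4)])
  qed
  then show ?thesis by (simp add: smooth_on_def)
qed

lemma smooth_on_inverse: "smooth_on {0<..} (inverse :: real \<Rightarrow> real)"
proof (rule smooth_on_autonomous[where S = UNIV and F = "\<lambda>y. (-1) * (y * y)"])
  show "smooth_on UNIV (\<lambda>y::real. (-1) * (y * y))"
    by (intro smooth_on_intros bounded_linear_ident) auto
qed (auto intro!: derivative_eq_intros)

lemma smooth_on_ln: "smooth_on {0<..} (ln :: real \<Rightarrow> real)"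
  unfolding smooth_on_def
proof
  fix k show "Ck_on k {0<..} (ln :: real \<Rightarrow> real)"
  proof (cases k)
    case 0
    then show ?thesis by (auto intro!: continuous_intros)
  next
    case (Suc l)
    show ?thesis unfolding Suc
      by (rule Ck_on_Suc_real[where f' = inverse])
         (use smooth_on_inverse in \<open>auto simp: smooth_on_def intro!: DERIV_ln\<close>)
  qed
qed

lemma smooth_on_sqrt: "smooth_on {0<..} sqrt"
proof (rule smooth_on_autonomous[where S = "{0<..}" and F = "\<lambda>y. inverse y * (1/2)"])
  show "smooth_on {0<..} (\<lambda>y::real. inverse y * (1/2))"
    by (intro smooth_on_intros smooth_on_inverse) auto
qed (auto intro!: derivative_eq_intros)

text \<open>A positive derivative makes \<open>f\<close> injective on an interval, and the inverse solves
  \<open>g' = 1 / f'(g)\<close>. It will produce the parameter of a pair of turning points as a function of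
  their height, and the energy as a function of the action.\<close>

lemma smooth_inverse_function:
  fixes f f' :: "real \<Rightarrow> real"
  assumes "open S" "connected S" "smooth_on S f"
    and der: "\<And>x. x \<in> S \<Longrightarrow> (f has_real_derivative f' x) (at x)"
    and pos: "\<And>x. x \<in> S \<Longrightarrow> f' x > 0"
  obtains g where "strict_mono_on S f" "open (f ` S)" "connected (f ` S)" "smooth_on (f ` S) g"
    "\<And>x. x \<in> S \<Longrightarrow> g (f x) = x"
    "\<And>y. y \<in> f ` S \<Longrightarrow> (g has_real_derivative inverse (f' (g y))) (at y)"
proof -
  have mono: "strict_mono_on S f"
  proof (rule strict_mono_onI)
    fix a b assume ab: "a \<in> S" "b \<in> S" "a < b"
    then have "x \<in> S" if "a \<le> x" "x \<le> b" for x
      using assms(2) connected_contains_Icc that by (meson atLeastAtMost_iff subsetD)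
    then show "f a < f b"
      using der pos by (intro DERIV_pos_imp_increasing[OF ab(3)]) blast
  qed
  then have inj: "inj_on f S" by (rule strict_mono_on_imp_inj_on)
  have cont: "continuous_on S f" using smooth_on_imp_continuous_on assms(3) by blast
  obtain g where "homeomorphism S (f ` S) f g"
    using invariance_of_domain_homeomorphism[OF assms(1) cont _ inj] by auto
  then have gf: "g (f x) = x" if "x \<in> S" for x
    using that by (auto simp: homeomorphism_def)
  have op: "open (f ` S)"
    using injective_into_1d_imp_open_map_UNIV[OF assms(1) cont inj] by auto
  have dg: "(g has_real_derivative inverse (f' (g y))) (at y)" if y: "y \<in> f ` S" for y
  proof -
    obtain x where x: "x \<in> S" "y = f x" using y by blast
    have "(g has_derivative (\<lambda>v. inverse (f' x) * v)) (at (f x))"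
    proof (rule has_derivative_inverse_strong[OF assms(1) x(1) cont])
      show "(f has_derivative (\<lambda>v. f' x * v)) (at x)"
        using der[OF x(1)] by (simp add: has_field_derivative_def)
      show "(\<lambda>v. f' x * v) \<circ> (\<lambda>v. inverse (f' x) * v) = id"
        using pos[OF x(1)] by auto
    qed (use x gf in auto)
    then have "(g has_field_derivative inverse (f' x)) (at (f x))"
      by (simp add: has_field_derivative_def)
    then show ?thesis using x gf by simp
  qed
  obtain f1 where f1: "smooth_on S f1" "\<And>x. x \<in> S \<Longrightarrow> (f has_real_derivative f1 x) (at x)"
    using smooth_on_deriv_real[OF assms(1,3)] by blast
  have f1f: "f1 x = f' x" if "x \<in> S" for x
    using DERIV_unique f1(2) der that by blast
  have "smooth_on S (\<lambda>x. inverse (f1 x))"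
    by (rule smooth_on_compose_real[OF assms(1) smooth_on_inverse f1(1)]) (use f1f pos in auto)
  then have "smooth_on (f ` S) g"
  proof (rule smooth_on_autonomous[OF op])
    show "g ` (f ` S) \<subseteq> S" using gf by auto
    show "(g has_real_derivative inverse (f1 (g y))) (at y)" if "y \<in> f ` S" for y
      using dg[OF that] gf f1f that by auto
  qed
  moreover have "connected (f ` S)" using connected_continuous_image cont assms(2) by blast
  ultimately show ?thesis using that mono op gf dg by blast
qed

text \<open>The derived series again converges everywhere, so the induction is over all coefficient
  sequences at once.\<close>

lemma smooth_on_power_series:
  fixes c :: "nat \<Rightarrow> real"
  assumes "\<And>x. summable (\<lambda>n. c n * x ^ n)"
  shows "smooth_on UNIV (\<lambda>x. \<Sum>n. c n * x ^ n)"
proof -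
  have "Ck_on k UNIV (\<lambda>x. \<Sum>n. c n * x ^ n)" for k
    using assms
  proof (induction k arbitrary: c)
    case 0
    then show ?case
      using termdiffs_strong_converges_everywhere DERIV_isCont
      by (auto intro!: continuous_at_imp_continuous_on) blast
  next
    case (Suc k)
    show ?case
      by (rule Ck_on_Suc_real[OF open_UNIV termdiffs_strong_converges_everywhere[OF Suc.prems]])
         (rule Suc.IH[OF termdiff_converges_all[OF Suc.prems]])
  qed
  then show ?thesis by (simp add: smooth_on_def)
qed

text \<open>Since \<open>S\<close> is star-shaped about \<open>0\<close> and \<open>0 \<le> \<kappa> \<le> 1\<close>, the integrand only evaluates \<open>f\<close> inside \<open>S\<close>.
  Differentiation under the integral sign reproduces an integral of the same kind, with weight
  \<open>\<omega> \<kappa>\<close> and integrand \<open>f'\<close>, so that smoothness follows by induction. Both the quotient \<open>f(x) / x\<close>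
  and the action integral have this form.\<close>

lemma weighted_dilation_integral_deriv:
  fixes f f' \<omega> \<kappa> :: "real \<Rightarrow> real"
  assumes "open S" "convex S" "0 \<in> S" and cont: "continuous_on S f'"
    and der: "\<And>x. x \<in> S \<Longrightarrow> (f has_real_derivative f' x) (at x)"
    and \<omega>: "continuous_on {a..b} \<omega>" and \<kappa>: "continuous_on {a..b} \<kappa>"
    and \<kappa>01: "\<And>t. t \<in> {a..b} \<Longrightarrow> \<kappa> t \<in> {0..1}"
    and x: "x \<in> S"
  shows "((\<lambda>x. integral {a..b} (\<lambda>t. \<omega> t * f (\<kappa> t * x))) has_real_derivative
     integral {a..b} (\<lambda>t. (\<omega> t * \<kappa> t) * f' (\<kappa> t * x))) (at x)"
proof -
  have star: "\<kappa> t * y \<in> S" if "y \<in> S" "t \<in> {a..b}" for t y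
    using convexD_alt[OF assms(2,3) that(1), of "\<kappa> t"] \<kappa>01[OF that(2)] by simp
  have cf: "continuous_on S f"
    using der by (auto intro!: continuous_at_imp_continuous_on DERIV_isCont)
  have "((\<lambda>x. integral (cbox a b) (\<lambda>t. \<omega> t * f (\<kappa> t * x))) has_field_derivative
     integral (cbox a b) (\<lambda>t. (\<omega> t * \<kappa> t) * f' (\<kappa> t * x))) (at x within S)"
  proof (rule leibniz_rule_field_derivative[OF _ _ _ x assms(2)])
    fix y t assume yt: "y \<in> S" "t \<in> cbox a b"
    have "((\<lambda>y. \<omega> t * f (\<kappa> t * y)) has_real_derivative \<omega> t * (f' (\<kappa> t * y) * \<kappa> t)) (at y)"
      using star[of y t] yt
      by (intro DERIV_cmult DERIV_chain2[OF der]) (auto intro!: derivative_eq_intros)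
    then show "((\<lambda>y. \<omega> t * f (\<kappa> t * y)) has_field_derivative \<omega> t * \<kappa> t * f' (\<kappa> t * y)) (at y within S)"
      by (auto simp: mult_ac intro: has_field_derivative_at_within)
  next
    fix y assume "y \<in> S"
    then show "(\<lambda>t. \<omega> t * f (\<kappa> t * y)) integrable_on cbox a b"
      using star by (intro integrable_continuous continuous_intros continuous_on_compose2[OF cf])
        (use \<omega> \<kappa> in auto)
  next
    show "continuous_on (S \<times> cbox a b) (\<lambda>(x, t). \<omega> t * \<kappa> t * f' (\<kappa> t * x))"
      unfolding split_def
      by (intro continuous_intros continuous_on_compose2[OF cont]
           continuous_on_compose2[OF \<omega>] continuous_on_compose2[OF \<kappa>]) (use star in auto)
  qed
  then show ?thesis
    using at_within_open[OF x assms(1)] by simp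
qed

lemma smooth_on_weighted_dilation_integral:
  fixes f \<omega> \<kappa> :: "real \<Rightarrow> real"
  assumes "open S" "convex S" "0 \<in> S" and "smooth_on S f"
    and \<omega>: "continuous_on {a..b} \<omega>" and \<kappa>: "continuous_on {a..b} \<kappa>"
    and \<kappa>01: "\<And>t. t \<in> {a..b} \<Longrightarrow> \<kappa> t \<in> {0..1}"
  shows "smooth_on S (\<lambda>x. integral {a..b} (\<lambda>t. \<omega> t * f (\<kappa> t * x)))"
proof -
  have C1: "Ck_on 0 S (\<lambda>x. integral {a..b} (\<lambda>t. \<omega> t * f (\<kappa> t * x)))"
    and step: "\<exists>f'. smooth_on S f' \<and> (\<forall>x\<in>S. ((\<lambda>x. integral {a..b} (\<lambda>t. \<omega> t * f (\<kappa> t * x))) has_real_derivative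
     integral {a..b} (\<lambda>t. (\<omega> t * \<kappa> t) * f' (\<kappa> t * x))) (at x))"
    if "smooth_on S f" "continuous_on {a..b} \<omega>" for f \<omega>
  proof -
    obtain f' where f': "smooth_on S f'" "\<And>x. x \<in> S \<Longrightarrow> (f has_real_derivative f' x) (at x)"
      using smooth_on_deriv_real[OF assms(1) \<open>smooth_on S f\<close>] by blast
    note D = weighted_dilation_integral_deriv[OF assms(1-3) smooth_on_imp_continuous_on[OF f'(1)]
       f'(2) that(2) \<kappa> \<kappa>01]
    show "Ck_on 0 S (\<lambda>x. integral {a..b} (\<lambda>t. \<omega> t * f (\<kappa> t * x)))"
      using D by (auto intro!: continuous_at_imp_continuous_on intro: DERIV_isCont)
    show "\<exists>f'. smooth_on S f' \<and> (\<forall>x\<in>S. ((\<lambda>x. integral {a..b} (\<lambda>t. \<omega> t * f (\<kappa> t * x))) has_real_derivative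
     integral {a..b} (\<lambda>t. (\<omega> t * \<kappa> t) * f' (\<kappa> t * x))) (at x))"
      using f'(1) D by blast
  qed
  have "Ck_on k S (\<lambda>x. integral {a..b} (\<lambda>t. \<omega> t * f (\<kappa> t * x)))" for k
    using \<open>smooth_on S f\<close> \<omega>
  proof (induction k arbitrary: f \<omega>)
    case 0
    then show ?case by (rule C1)
  next
    case (Suc k)
    obtain f' where f': "smooth_on S f'" "\<And>x. x \<in> S \<Longrightarrow> ((\<lambda>x. integral {a..b} (\<lambda>t. \<omega> t * f (\<kappa> t * x))) has_real_derivative
     integral {a..b} (\<lambda>t. (\<omega> t * \<kappa> t) * f' (\<kappa> t * x))) (at x)"
      using step[OF Suc.prems] by blast
    show ?case
      by (intro Ck_on_Suc_real[OF assms(1) f'(2)] Suc.IH f'(1) continuous_intros Suc.prems \<kappa>)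
  qed
  then show ?thesis by (simp add: smooth_on_def)
qed

text \<open>Hadamard's lemma: \<open>f(x) / x\<close> is the integral of \<open>f'(t x)\<close> over \<open>0 \<le> t \<le> 1\<close>.\<close>

lemma smooth_on_quotient_at_zero:
  fixes f :: "real \<Rightarrow> real"
  assumes "open S" "convex S" "0 \<in> S" "smooth_on S f" "f 0 = 0"
  obtains q where "smooth_on S q" "\<And>x. x \<in> S \<Longrightarrow> f x = x * q x"
proof -
  obtain f' where f': "smooth_on S f'" "\<And>x. x \<in> S \<Longrightarrow> (f has_real_derivative f' x) (at x)"
    using smooth_on_deriv_real[OF assms(1,4)] by blast
  define q where "q x = integral {0..1} (\<lambda>t. 1 * f' (t * x))" for x
  have "smooth_on S q"
    unfolding q_def by (rule smooth_on_weighted_dilation_integral[OF assms(1-3) f'(1)]) auto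
  moreover have "f x = x * q x" if x: "x \<in> S" for x
  proof -
    have star: "t * x \<in> S" if "t \<in> {0..1}" for t
      using convexD_alt[OF assms(2,3) x, of t] that by simp
    have "((\<lambda>t. f' (t * x) * x) has_integral f (1 * x) - f (0 * x)) {0..1}"
    proof (rule fundamental_theorem_of_calculus)
      fix t :: real assume t: "t \<in> {0..1}"
      have "((\<lambda>t. f (t * x)) has_real_derivative f' (t * x) * x) (at t)"
        by (rule DERIV_chain2[where f = f and g = "\<lambda>t. t * x", OF f'(2)[OF star[OF t]]]) (auto intro!: derivative_eq_intros)
      then show "((\<lambda>t. f (t * x)) has_vector_derivative f' (t * x) * x) (at t within {0..1})"
        using has_real_derivative_iff_has_vector_derivative has_vector_derivative_at_within by blast
    qed simp
    then have "f x = integral {0..1} (\<lambda>t. f' (t * x) * x)"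
      using assms(5) by (simp add: has_integral_iff)
    then show ?thesis by (simp add: q_def mult.commute)
  qed
  ultimately show ?thesis using that by blast
qed

section \<open>The two entire functions behind the oscillator\<close>

text \<open>The functions \<open>sinh \<sigma> / \<sigma>\<close> and \<open>cosh \<sigma>\<close> are even, hence functions of \<open>t = \<sigma>\<^sup>2\<close>; as power series
  in \<open>t\<close> they are smooth on the whole line. This is what later carries the energy across zero
  action: the range \<open>t < 0\<close>, where \<open>\<sigma>\<close> is imaginary, corresponds to negative actions.\<close>

definition sinhc_sqrt :: "real \<Rightarrow> real" where
  "sinhc_sqrt t = (\<Sum>n. inverse (fact (2 * n + 1)) * t ^ n)"

definition cosh_sqrt :: "real \<Rightarrow> real" where
  "cosh_sqrt t = (\<Sum>n. inverse (fact (2 * n)) * t ^ n)"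

definition sinhc_sqrt_deriv :: "real \<Rightarrow> real" where
  "sinhc_sqrt_deriv t = (\<Sum>n. diffs (\<lambda>n. inverse (fact (2 * n + 1))) n * t ^ n)"

lemma summable_inverse_fact_double:
  fixes t :: real
  shows "summable (\<lambda>n. inverse (fact (2 * n)) * t ^ n)"
    and "summable (\<lambda>n. inverse (fact (2 * n + 1)) * t ^ n)"
proof -
  \<comment> \<open>both series are dominated by the exponential series\<close>
  have *: "summable (\<lambda>n. inverse (fact (k n)) * t ^ n)" if "\<And>n. n \<le> k n" for k
  proof (rule summable_comparison_test')
    show "summable (\<lambda>n. \<bar>t\<bar> ^ n /\<^sub>R fact n)" by (rule summable_exp_generic)
    fix n :: nat assume "n \<ge> 0"
    have "(fact n :: real) \<le> fact (k n)" using that by (rule fact_mono)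
    then have "inverse (fact (k n)) \<le> (inverse (fact n) :: real)"
      by (intro le_imp_inverse_le) auto
    then show "norm (inverse (fact (k n)) * t ^ n) \<le> \<bar>t\<bar> ^ n /\<^sub>R fact n"
      by (simp add: abs_mult power_abs mult_right_mono)
  qed
  show "summable (\<lambda>n. inverse (fact (2 * n)) * t ^ n)" by (rule *) auto
  show "summable (\<lambda>n. inverse (fact (2 * n + 1)) * t ^ n)" by (rule *) auto
qed

lemma sinhc_sqrt_square: "\<sigma> * sinhc_sqrt (\<sigma>\<^sup>2) = sinh \<sigma>"
proof -
  have "(\<lambda>n. if even (2 * n + 1) then 0 else \<sigma> ^ (2 * n + 1) /\<^sub>R fact (2 * n + 1)) sums sinh \<sigma>"
  proof (subst sums_mono_reindex[of "\<lambda>n. 2 * n + 1"])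
    fix n :: nat assume n: "n \<notin> range (\<lambda>n. 2 * n + 1)"
    have "even n" using n by (metis oddE rangeI)
    then show "(if even n then 0 else \<sigma> ^ n /\<^sub>R fact n) = 0" by simp
  qed (use sinh_converges in \<open>auto simp: strict_mono_def\<close>)
  then have "(\<lambda>n. \<sigma> * (inverse (fact (2 * n + 1)) * (\<sigma>\<^sup>2) ^ n)) sums sinh \<sigma>"
    by (simp add: power_mult[symmetric] mult_ac del: fact_Suc)
  moreover have "(\<lambda>n. \<sigma> * (inverse (fact (2 * n + 1)) * (\<sigma>\<^sup>2) ^ n)) sums (\<sigma> * sinhc_sqrt (\<sigma>\<^sup>2))"
    unfolding sinhc_sqrt_def
    by (intro sums_mult summable_sums summable_inverse_fact_double)
  ultimately show ?thesis by (rule sums_unique2[symmetric])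
qed

lemma cosh_sqrt_square: "cosh_sqrt (\<sigma>\<^sup>2) = cosh \<sigma>"
proof -
  have "(\<lambda>n. if even (2 * n) then \<sigma> ^ (2 * n) /\<^sub>R fact (2 * n) else 0) sums cosh \<sigma>"
  proof (subst sums_mono_reindex[of "\<lambda>n. 2 * n"])
    fix n :: nat assume n: "n \<notin> range (\<lambda>n. 2 * n)"
    have "odd n" using n by (metis evenE rangeI)
    then show "(if even n then \<sigma> ^ n /\<^sub>R fact n else 0) = 0" by simp
  qed (use cosh_converges in \<open>auto simp: strict_mono_def\<close>)
  then have "(\<lambda>n. inverse (fact (2 * n)) * (\<sigma>\<^sup>2) ^ n) sums cosh \<sigma>"
    by (simp add: power_mult[symmetric] mult_ac del: fact_Suc)
  moreover have "(\<lambda>n. inverse (fact (2 * n)) * (\<sigma>\<^sup>2) ^ n) sums cosh_sqrt (\<sigma>\<^sup>2)"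
    unfolding cosh_sqrt_def
    by (intro summable_sums summable_inverse_fact_double)
  ultimately show ?thesis by (rule sums_unique2[symmetric])
qed

lemma smooth_on_sinhc_sqrt: "smooth_on UNIV sinhc_sqrt"
  unfolding sinhc_sqrt_def[abs_def]
  by (rule smooth_on_power_series) (rule summable_inverse_fact_double)

lemma smooth_on_cosh_sqrt: "smooth_on UNIV cosh_sqrt"
  unfolding cosh_sqrt_def[abs_def]
  by (rule smooth_on_power_series) (rule summable_inverse_fact_double)

lemma smooth_on_sinhc_sqrt_deriv: "smooth_on UNIV sinhc_sqrt_deriv"
  unfolding sinhc_sqrt_deriv_def[abs_def]
  by (rule smooth_on_power_series) (rule termdiff_converges_all, rule summable_inverse_fact_double)

lemma has_real_derivative_sinhc_sqrt:
  "(sinhc_sqrt has_real_derivative sinhc_sqrt_deriv t) (at t)"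
  unfolding sinhc_sqrt_def[abs_def] sinhc_sqrt_deriv_def
  by (rule termdiffs_strong_converges_everywhere) (rule summable_inverse_fact_double)

lemma has_real_derivative_cosh_sqrt:
  "(cosh_sqrt has_real_derivative sinhc_sqrt t / 2) (at t)"
proof -
  have d: "diffs (\<lambda>n. inverse (fact (2 * n))) n = (inverse (fact (2 * n + 1)) * (1/2) :: real)" for n
  proof -
    have "(fact (2 * Suc n) :: real) = 2 * real (Suc n) * fact (2 * n + 1)"
      by (simp add: algebra_simps)
    then show ?thesis
      by (simp add: diffs_def del: fact_Suc of_nat_Suc mult_Suc_right)
  qed
  have "(cosh_sqrt has_real_derivative (\<Sum>n. diffs (\<lambda>n. inverse (fact (2 * n))) n * t ^ n)) (at t)"
    unfolding cosh_sqrt_def[abs_def]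
    by (rule termdiffs_strong_converges_everywhere) (rule summable_inverse_fact_double)
  also have "(\<Sum>n. diffs (\<lambda>n. inverse (fact (2 * n))) n * t ^ n) =
      (\<Sum>n. (1/2) * (inverse (fact (2 * n + 1)) * t ^ n))"
    unfolding d by (simp only: mult_ac)
  also have "\<dots> = sinhc_sqrt t / 2"
    unfolding sinhc_sqrt_def by (subst suminf_mult[OF summable_inverse_fact_double(2)]) simp
  finally show ?thesis .
qed

lemma sinhc_sqrt_at_zero: "sinhc_sqrt 0 = 1" "cosh_sqrt 0 = 1" "sinhc_sqrt_deriv 0 = 1/6"
  unfolding sinhc_sqrt_def cosh_sqrt_def sinhc_sqrt_deriv_def powser_zero
  by (simp_all add: diffs_def fact_numeral)

lemma sinh_ge_self:
  fixes x :: real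
  assumes "x \<ge> 0"
  shows "sinh x \<ge> x"
proof -
  have "sinh 0 - 0 \<le> sinh x - x"
  proof (rule DERIV_nonneg_imp_nondecreasing[OF assms])
    fix y :: real assume "0 \<le> y" "y \<le> x"
    show "\<exists>d. ((\<lambda>x. sinh x - x) has_real_derivative d) (at y) \<and> 0 \<le> d"
      by (rule exI[of _ "cosh y - 1"]) (auto intro!: derivative_eq_intros simp: cosh_real_ge_1)
  qed
  then show ?thesis by simp
qed

lemma sinhc_sqrt_ge_1:
  assumes "t \<ge> 0"
  shows "sinhc_sqrt t \<ge> 1"
proof (cases "t = 0")
  case False
  then have s: "sqrt t > 0" using assms by simp
  have "sqrt t * 1 \<le> sqrt t * sinhc_sqrt t"
    using sinhc_sqrt_square[of "sqrt t"] sinh_ge_self[of "sqrt t"] assms by simp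
  then show ?thesis using s by simp
qed (simp add: sinhc_sqrt_at_zero)

text \<open>Differentiate \<open>\<sigma> (sinh \<sigma> / \<sigma>) = sinh \<sigma>\<close> and substitute \<open>t = \<sigma>\<^sup>2\<close>.\<close>

lemma cosh_sqrt_eq:
  assumes "t \<ge> 0"
  shows "cosh_sqrt t = sinhc_sqrt t + 2 * t * sinhc_sqrt_deriv t"
proof (cases "t = 0")
  case False
  have "((\<lambda>\<sigma>. \<sigma> * sinhc_sqrt (\<sigma>\<^sup>2)) has_real_derivative
      sinhc_sqrt t + 2 * t * sinhc_sqrt_deriv t) (at (sqrt t))"
    using assms
    by (auto intro!: derivative_eq_intros DERIV_chain2[OF has_real_derivative_sinhc_sqrt]
        simp: power2_eq_square[symmetric] algebra_simps)
  then have "(sinh has_real_derivative sinhc_sqrt t + 2 * t * sinhc_sqrt_deriv t) (at (sqrt t))"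
    by (simp add: sinhc_sqrt_square)
  moreover have "(sinh has_real_derivative cosh (sqrt t)) (at (sqrt t))"
    by (auto intro!: derivative_eq_intros)
  ultimately show ?thesis
    using cosh_sqrt_square[of "sqrt t"] assms DERIV_unique by force
qed (simp add: sinhc_sqrt_at_zero)

section \<open>Turning points in terms of a uniformizing parameter\<close>

text \<open>The potential of the normalised oscillator is \<open>1/(2 u\<^sup>2) + ln u\<close>, with minimum \<open>1/2\<close> at \<open>u = 1\<close>. In
  terms of \<open>w = 1/u\<^sup>2\<close> it is \<open>(w - ln w)/2\<close>, so two points \<open>w e\<^sup>\<sigma>\<close> and \<open>w e\<^sup>-\<^sup>\<sigma>\<close> lie at the same height iff
  \<open>w sinh \<sigma> = \<sigma>\<close>. Thus \<open>\<sigma>\<close> parametrizes the pairs of turning points explicitly, and their height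
  above the minimum, written in \<open>t = \<sigma>\<^sup>2\<close>, is the following function.\<close>

definition level_height :: "real \<Rightarrow> real" where
  "level_height t = (cosh_sqrt t / sinhc_sqrt t - 1 + ln (sinhc_sqrt t)) / 2"

definition level_height_deriv :: "real \<Rightarrow> real" where
  "level_height_deriv t = (1/2 - cosh_sqrt t * sinhc_sqrt_deriv t / (sinhc_sqrt t)\<^sup>2
     + sinhc_sqrt_deriv t / sinhc_sqrt t) / 2"

lemma has_real_derivative_level_height:
  assumes "sinhc_sqrt t > 0"
  shows "(level_height has_real_derivative level_height_deriv t) (at t)"
proof -
  have "((\<lambda>t. (cosh_sqrt t / sinhc_sqrt t - 1 + ln (sinhc_sqrt t)) / 2)
      has_real_derivative level_height_deriv t) (at t)"
    unfolding level_height_deriv_def using assms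
    by (auto intro!: derivative_eq_intros has_real_derivative_sinhc_sqrt has_real_derivative_cosh_sqrt
        simp: field_simps power2_eq_square)
  then show ?thesis by (simp add: level_height_def[abs_def])
qed

text \<open>The identity \<open>cosh \<sigma> = S + 2 t S'\<close>, where \<open>S(\<sigma>\<^sup>2) = sinh \<sigma> / \<sigma>\<close>, turns the derivative into
  \<open>1/4 - (\<sigma> S'/S)\<^sup>2\<close>, and \<open>2 \<sigma> S' < S\<close> amounts to \<open>\<sigma> e\<^sup>-\<^sup>\<sigma> < sinh \<sigma>\<close>.\<close>

lemma level_height_deriv_pos:
  assumes "t \<ge> 0"
  shows "level_height_deriv t > 0"
proof -
  define \<sigma> where "\<sigma> = sqrt t"
  define S where "S = sinhc_sqrt t"
  define S1 where "S1 = sinhc_sqrt_deriv t"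
  have t: "t = \<sigma>\<^sup>2" "\<sigma> \<ge> 0" using assms by (auto simp: \<sigma>_def)
  have S: "S \<ge> 1" using sinhc_sqrt_ge_1[OF assms] by (simp add: S_def)
  have C: "cosh_sqrt t = S + 2 * t * S1" using cosh_sqrt_eq[OF assms] by (simp add: S_def S1_def)
  have eq: "level_height_deriv t = 1/4 - (\<sigma> * S1 / S)\<^sup>2"
    unfolding level_height_deriv_def C S_def[symmetric] S1_def[symmetric] using S t(1)
    by (simp add: field_simps power2_eq_square)
  have "2 * (\<sigma> * S1) < S \<and> 0 \<le> \<sigma> * S1"
  proof (cases "\<sigma> = 0")
    case False
    then have "\<sigma> > 0" using t by simp
    have sh: "\<sigma> * S = sinh \<sigma>" using sinhc_sqrt_square[of \<sigma>] t by (simp add: S_def)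
    have ch: "S + 2 * \<sigma>\<^sup>2 * S1 = cosh \<sigma>" using cosh_sqrt_square[of \<sigma>] t C by simp
    have "\<sigma> * exp (- \<sigma>) < \<sigma>" using \<open>\<sigma> > 0\<close> by simp
    also have "\<sigma> \<le> sinh \<sigma>" using sinh_ge_self t by blast
    finally have "\<sigma> * (cosh \<sigma> - sinh \<sigma>) < sinh \<sigma>" by (simp add: cosh_minus_sinh)
    moreover have "\<sigma> * cosh \<sigma> = sinh \<sigma> + \<sigma> * (2 * \<sigma>\<^sup>2 * S1)"
      using ch sh by (metis distrib_left)
    ultimately have "\<sigma> * (2 * \<sigma>\<^sup>2 * S1) < \<sigma> * sinh \<sigma>" by (simp add: algebra_simps)
    then have "2 * \<sigma>\<^sup>2 * S1 < \<sigma> * S" using \<open>\<sigma> > 0\<close> sh by simp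
    then have "\<sigma> * (2 * (\<sigma> * S1)) < \<sigma> * S" by (simp add: power2_eq_square mult_ac)
    then have 1: "2 * (\<sigma> * S1) < S" using \<open>\<sigma> > 0\<close> by simp
    have "sinh \<sigma> \<le> \<sigma> * cosh \<sigma>"
    proof -
      have "0 * cosh 0 - sinh 0 \<le> \<sigma> * cosh \<sigma> - sinh \<sigma>"
      proof (rule DERIV_nonneg_imp_nondecreasing[OF t(2)])
        fix y :: real assume "0 \<le> y" "y \<le> \<sigma>"
        then show "\<exists>d. ((\<lambda>x. x * cosh x - sinh x) has_real_derivative d) (at y) \<and> 0 \<le> d"
          by (intro exI[of _ "y * sinh y"]) (auto intro!: derivative_eq_intros)
      qed
      then show ?thesis by simp
    qed
    then have "0 \<le> \<sigma> * (2 * \<sigma>\<^sup>2 * S1)"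
      using \<open>\<sigma> * cosh \<sigma> = sinh \<sigma> + \<sigma> * (2 * \<sigma>\<^sup>2 * S1)\<close> by linarith
    then have "0 \<le> S1" using \<open>\<sigma> > 0\<close> by (simp add: zero_le_mult_iff)
    then show ?thesis using 1 t by simp
  qed (use S in auto)
  then have "\<bar>\<sigma> * S1 / S\<bar> < 1/2" using S by (simp add: field_simps)
  then have "\<bar>\<sigma> * S1 / S\<bar>\<^sup>2 < (1/2)\<^sup>2" by (intro power_strict_mono) auto
  then show ?thesis unfolding eq by (simp add: power_divide)
qed

lemma level_height_at_zero: "level_height 0 = 0" "level_height_deriv 0 = 1/4"
  by (simp_all add: level_height_def level_height_deriv_def sinhc_sqrt_at_zero)

text \<open>The second derivative of \<open>sinhc_sqrt\<close> cancels, so that only first-order Taylor coefficients enter.\<close>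

lemma has_real_derivative_level_height_deriv_at_zero:
  "(level_height_deriv has_real_derivative -1/36) (at 0)"
proof -
  obtain S2 where S2: "\<And>t. (sinhc_sqrt_deriv has_real_derivative S2 t) (at t)"
    using smooth_on_deriv_real[OF open_UNIV smooth_on_sinhc_sqrt_deriv] by auto
  have "((\<lambda>t. (1/2 - cosh_sqrt t * sinhc_sqrt_deriv t / (sinhc_sqrt t)\<^sup>2
     + sinhc_sqrt_deriv t / sinhc_sqrt t) / 2) has_real_derivative -1/36) (at 0)"
    by (auto intro!: derivative_eq_intros S2 has_real_derivative_sinhc_sqrt has_real_derivative_cosh_sqrt
        simp: sinhc_sqrt_at_zero power2_eq_square field_simps)
  then show ?thesis by (simp add: level_height_deriv_def[abs_def])
qed

lemma level_height_unbounded: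
  assumes "y \<ge> 0"
  obtains t where "t \<ge> 0" "level_height t \<ge> y"
proof
  define \<sigma> where "\<sigma> = 2 * y + 1"
  have \<sigma>: "\<sigma> > 0" using assms by (simp add: \<sigma>_def)
  show "\<sigma>\<^sup>2 \<ge> 0" by simp
  define S where "S = sinhc_sqrt (\<sigma>\<^sup>2)"
  have S: "S \<ge> 1" "\<sigma> * S = sinh \<sigma>"
    using sinhc_sqrt_ge_1[of "\<sigma>\<^sup>2"] sinhc_sqrt_square by (auto simp: S_def)
  have "\<sigma> * S \<le> cosh \<sigma>" using S(2) sinh_le_cosh_real[of \<sigma>] by simp
  then have "\<sigma> \<le> cosh \<sigma> / S" using S(1) by (simp add: field_simps)
  moreover have "ln S \<ge> 0" using S by simp
  ultimately show "level_height (\<sigma>\<^sup>2) \<ge> y"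
    unfolding level_height_def cosh_sqrt_square S_def[symmetric] by (simp add: \<sigma>_def)
qed

definition shape :: "real \<Rightarrow> real" where
  "shape u = 1 / (2 * u\<^sup>2) + ln u"

text \<open>The sign \<open>\<epsilon>\<close> selects one of the two turning points.\<close>

lemma shape_at_turning_point:
  assumes "\<bar>\<epsilon>\<bar> = 1" "\<sigma> \<ge> 0"
  shows "shape (sqrt (sinhc_sqrt (\<sigma>\<^sup>2)) * exp (\<epsilon> * \<sigma> / 2)) = 1/2 + level_height (\<sigma>\<^sup>2)"
proof -
  define S where "S = sinhc_sqrt (\<sigma>\<^sup>2)"
  have S: "S \<ge> 1" "\<sigma> * S = sinh \<sigma>"
    using sinhc_sqrt_ge_1[of "\<sigma>\<^sup>2"] sinhc_sqrt_square by (auto simp: S_def)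
  have \<epsilon>: "\<epsilon> = 1 \<or> \<epsilon> = -1" using assms by linarith
  have ln: "ln (sqrt S * exp (\<epsilon> * \<sigma> / 2)) = ln S / 2 + \<epsilon> * \<sigma> / 2"
    using S by (simp add: ln_mult ln_sqrt)
  have "(sqrt S * exp (\<epsilon> * \<sigma> / 2))\<^sup>2 = S * exp (\<epsilon> * \<sigma>)"
    using S by (simp add: power_mult_distrib exp_double[symmetric])
  then have "1 / (2 * (sqrt S * exp (\<epsilon> * \<sigma> / 2))\<^sup>2) = exp (- (\<epsilon> * \<sigma>)) / (2 * S)"
    by (simp add: exp_minus field_simps)
  also have "exp (- (\<epsilon> * \<sigma>)) = cosh \<sigma> - \<epsilon> * (\<sigma> * S)"
    using \<epsilon> S(2) cosh_minus_sinh[of \<sigma>] cosh_plus_sinh[of \<sigma>] by auto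
  also have "\<dots> / (2 * S) = (cosh \<sigma> / S) / 2 - \<epsilon> * \<sigma> / 2"
    using S by (simp add: field_simps)
  finally show ?thesis
    unfolding shape_def level_height_def cosh_sqrt_square S_def[symmetric] ln by (simp add: diff_divide_distrib add_divide_distrib)
qed

lemma turning_point_side:
  assumes "\<sigma> > 0"
  shows "sqrt (sinhc_sqrt (\<sigma>\<^sup>2)) * exp (\<sigma> / 2) > 1"
    and "sqrt (sinhc_sqrt (\<sigma>\<^sup>2)) * exp (- \<sigma> / 2) < 1"
proof -
  define S where "S = sinhc_sqrt (\<sigma>\<^sup>2)"
  have S: "S \<ge> 1" "\<sigma> * S = sinh \<sigma>"
    using sinhc_sqrt_ge_1[of "\<sigma>\<^sup>2"] sinhc_sqrt_square by (auto simp: S_def)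
  have "1 * 1 < exp (\<sigma> / 2) * sqrt S"
    using S assms by (intro mult_less_le_imp_less) auto
  then show "sqrt (sinhc_sqrt (\<sigma>\<^sup>2)) * exp (\<sigma> / 2) > 1" by (simp add: S_def mult.commute)
  have "1 + (- 2 * \<sigma>) < exp (- 2 * \<sigma>)"
    using assms exp_minus_greater[of "2 * \<sigma>"] by simp
  moreover have "\<sigma> * (S * exp (- \<sigma>)) = (1 - exp (- 2 * \<sigma>)) / 2"
  proof -
    have "\<sigma> * (S * exp (- \<sigma>)) = sinh \<sigma> * exp (- \<sigma>)" using S by (metis mult.assoc)
    also have "\<dots> = (exp \<sigma> * exp (- \<sigma>) - exp (- \<sigma>) * exp (- \<sigma>)) / 2"
      by (simp add: sinh_field_def algebra_simps)
    also have "\<dots> = (1 - exp (- 2 * \<sigma>)) / 2" by (simp add: exp_add[symmetric])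
    finally show ?thesis .
  qed
  ultimately have "\<sigma> * (S * exp (- \<sigma>)) < \<sigma> * 1" by simp
  then have "S * exp (- \<sigma>) < 1" using assms by simp
  moreover have "(sqrt S * exp (- \<sigma> / 2))\<^sup>2 = S * exp (- \<sigma>)"
    using S by (simp add: power_mult_distrib exp_double[symmetric])
  ultimately have "(sqrt S * exp (- \<sigma> / 2))\<^sup>2 < 1\<^sup>2" by simp
  then show "sqrt (sinhc_sqrt (\<sigma>\<^sup>2)) * exp (- \<sigma> / 2) < 1"
    unfolding S_def by (rule power_less_imp_less_base) simp
qed

section \<open>The turning points as functions of the energy\<close>

text \<open>If \<open>f(t) = t q(t)\<close>, then \<open>f'(0) = q(0)\<close> and \<open>f''(0) = 2 q'(0)\<close>. With \<open>q\<close> from Hadamard's lemma this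
  replaces a Taylor expansion.\<close>

lemma derivatives_of_quotient_by_argument:
  fixes f q :: "real \<Rightarrow> real"
  assumes "open D" "0 \<in> D" and f: "\<And>t. t \<in> D \<Longrightarrow> f t = t * q t"
    and q: "\<And>t. t \<in> D \<Longrightarrow> (q has_real_derivative q1 t) (at t)"
    and q1: "(q1 has_real_derivative q2) (at 0)"
    and f1: "\<And>t. t \<in> D \<Longrightarrow> (f has_real_derivative f1 t) (at t)"
    and f2: "(f1 has_real_derivative f2) (at 0)"
  shows "f1 0 = q 0" "f2 = 2 * q1 0"
proof -
  have eq: "f1 t = q t + t * q1 t" if "t \<in> D" for t
  proof -
    have "((\<lambda>t. t * q t) has_real_derivative q t + t * q1 t) (at t)"
      using q[OF that] by (auto intro!: derivative_eq_intros)
    then have "(f has_real_derivative q t + t * q1 t) (at t)"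
      by (rule has_field_derivative_transform_within_open[OF _ assms(1) that]) (simp add: f)
    then show ?thesis using f1[OF that] DERIV_unique by blast
  qed
  show "f1 0 = q 0" using eq[OF assms(2)] by simp
  have "((\<lambda>t. q t + t * q1 t) has_real_derivative 2 * q1 0) (at 0)"
    using q[OF assms(2)] q1 by (auto intro!: derivative_eq_intros)
  then have "(f1 has_real_derivative 2 * q1 0) (at 0)"
    by (rule has_field_derivative_transform_within_open[OF _ assms(1,2)]) (simp add: eq)
  then show "f2 = 2 * q1 0" using f2 DERIV_unique by blast
qed

text \<open>Let \<open>z = \<xi>\<^sup>2\<close> be the height above the minimum. The two turning points are \<open>p(z) + \<xi> m(z)\<close>, one for
  each sign of \<open>\<xi>\<close>. That the mean \<open>p\<close> and the half-distance \<open>m\<close> (in units of \<open>\<xi>\<close>) are smooth functions of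
  \<open>z\<close> on an interval that contains a neighbourhood of \<open>0\<close> is the point of the explicit
  parametrization: both are smooth in \<open>t\<close>, and \<open>z\<close> is a smooth increasing function of \<open>t\<close>.\<close>

lemma turning_point_functions:
  obtains J p m where
    "open J" "connected J" "{0..} \<subseteq> J" "smooth_on J p" "smooth_on J m"
    "m 0 = 1" "(m has_real_derivative 11/18) (at 0)"
    "\<And>\<xi>. p (\<xi>\<^sup>2) + \<xi> * m (\<xi>\<^sup>2) > 0"
    "\<And>\<xi>. shape (p (\<xi>\<^sup>2) + \<xi> * m (\<xi>\<^sup>2)) = 1/2 + \<xi>\<^sup>2"
    "\<And>\<xi>. \<xi> > 0 \<Longrightarrow> p (\<xi>\<^sup>2) + \<xi> * m (\<xi>\<^sup>2) > 1"
    "\<And>\<xi>. \<xi> < 0 \<Longrightarrow> p (\<xi>\<^sup>2) + \<xi> * m (\<xi>\<^sup>2) < 1"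
proof -
  define D0 where "D0 = {t. sinhc_sqrt t > 0}"
  have contS: "continuous_on A sinhc_sqrt" for A
    using smooth_on_imp_continuous_on[OF smooth_on_sinhc_sqrt] continuous_on_subset by blast
  have opD0: "open D0"
    unfolding D0_def using contS by (intro open_Collect_less continuous_intros) auto
  have D0: "{0..} \<subseteq> D0" using sinhc_sqrt_ge_1 by (force simp: D0_def)
  define D1 where "D1 = D0 \<inter> level_height_deriv -` {0<..}"
  have "continuous_on D0 level_height_deriv"
    unfolding level_height_deriv_def[abs_def] using contS
      smooth_on_imp_continuous_on[OF smooth_on_cosh_sqrt]
      smooth_on_imp_continuous_on[OF smooth_on_sinhc_sqrt_deriv]
    by (intro continuous_intros) (auto simp: D0_def intro: continuous_on_subset)
  then have opD1: "open D1"
    unfolding D1_def by (rule continuous_open_preimage) (use opD0 in auto)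
  have D1: "{0..} \<subseteq> D1" using D0 level_height_deriv_pos by (auto simp: D1_def)
  then obtain \<delta> where \<delta>: "\<delta> > 0" "ball 0 \<delta> \<subseteq> D1"
    using opD1 by (metis open_contains_ball atLeast_iff order_refl subsetD)
  define D where "D = {-\<delta><..}"
  have D: "D \<subseteq> D1"
  proof
    fix x assume x: "x \<in> D"
    show "x \<in> D1"
    proof (cases "x \<ge> 0")
      case False
      then have "x \<in> ball 0 \<delta>" using x by (simp add: D_def dist_real_def)
      then show ?thesis using \<delta> by blast
    qed (use D1 in auto)
  qed
  have opD: "open D" and conD: "connected D" "convex D" and D00: "0 \<in> D"
    using \<delta>(1) by (auto simp: D_def)
  have Spos: "sinhc_sqrt t > 0" if "t \<in> D" for t using D that by (auto simp: D1_def D0_def)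
  have Zpos: "level_height_deriv t > 0" if "t \<in> D" for t using D that by (auto simp: D1_def)
  have Zder: "(level_height has_real_derivative level_height_deriv t) (at t)" if "t \<in> D" for t
    using has_real_derivative_level_height Spos that by blast
  note S_smooth = smooth_on_subset[OF smooth_on_sinhc_sqrt subset_UNIV[of D]]
  note C_smooth = smooth_on_subset[OF smooth_on_cosh_sqrt subset_UNIV[of D]]
  have inv_smooth: "smooth_on D (\<lambda>t. inverse (f t))" if "smooth_on D f" "\<And>t. t \<in> D \<Longrightarrow> f t > 0" for f :: "real \<Rightarrow> real"
    by (rule smooth_on_compose_real[OF opD smooth_on_inverse that(1)]) (use that in auto)
  have sqrt_smooth: "smooth_on D (\<lambda>t. sqrt (f t))" if "smooth_on D f" "\<And>t. t \<in> D \<Longrightarrow> f t > 0" for f :: "real \<Rightarrow> real"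
    by (rule smooth_on_compose_real[OF opD smooth_on_sqrt that(1)]) (use that in auto)
  have ln_smooth: "smooth_on D (\<lambda>t. ln (f t))" if "smooth_on D f" "\<And>t. t \<in> D \<Longrightarrow> f t > 0" for f :: "real \<Rightarrow> real"
    by (rule smooth_on_compose_real[OF opD smooth_on_ln that(1)]) (use that in auto)
  have quarter: "smooth_on D (\<lambda>t. f (t * (1/4)))" if "smooth_on UNIV f" for f :: "real \<Rightarrow> real"
    by (rule smooth_on_compose_real[OF opD that])
       (auto intro!: smooth_on_intros(5) opD bounded_linear_divide)
  have Zsmooth: "smooth_on D level_height"
  proof -
    have "smooth_on D (\<lambda>t. (cosh_sqrt t * inverse (sinhc_sqrt t) - 1 + ln (sinhc_sqrt t)) * inverse 2)"
      by (intro smooth_on_intros opD S_smooth C_smooth inv_smooth ln_smooth Spos)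
    then show ?thesis by (simp only: level_height_def[abs_def] divide_inverse)
  qed
  obtain g where g: "strict_mono_on D level_height" "open (level_height ` D)"
      "connected (level_height ` D)" "smooth_on (level_height ` D) g"
      "\<And>x. x \<in> D \<Longrightarrow> g (level_height x) = x"
      "\<And>y. y \<in> level_height ` D \<Longrightarrow>
        (g has_real_derivative inverse (level_height_deriv (g y))) (at y)"
    using smooth_inverse_function[OF opD conD(1) Zsmooth Zder Zpos] by metis
  define J where "J = level_height ` D"
  have gD: "g y \<in> D" if "y \<in> J" for y using that g(5) by (auto simp: J_def)
  have surj: "\<exists>t\<ge>0. level_height t = y" if "y \<ge> 0" for y
  proof -
    obtain T where T: "T \<ge> 0" "level_height T \<ge> y" using level_height_unbounded[OF \<open>y \<ge> 0\<close>] .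
    have "continuous_on {0..T} level_height"
      using smooth_on_imp_continuous_on[OF Zsmooth] by (rule continuous_on_subset) (use \<delta> in \<open>auto simp: D_def\<close>)
    then show ?thesis
      using IVT'[of level_height 0 y T] T that by (auto simp: level_height_at_zero)
  qed
  have nonnegD: "t \<in> D" if "t \<ge> 0" for t using that \<delta>(1) by (simp add: D_def)
  have J0: "{0..} \<subseteq> J" unfolding J_def using surj nonnegD by (force simp: image_iff)
  \<comment> \<open>since z = t Q(t), the ratio of sqrt t and sqrt z is smooth at t = 0\<close>
  obtain Q where Q: "smooth_on D Q" "\<And>t. t \<in> D \<Longrightarrow> level_height t = t * Q t"
    using smooth_on_quotient_at_zero[OF opD conD(2) D00 Zsmooth] level_height_at_zero(1) by blast
  obtain Q1 where Q1: "smooth_on D Q1" "\<And>x. x \<in> D \<Longrightarrow> (Q has_real_derivative Q1 x) (at x)"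
    using smooth_on_deriv_real[OF opD Q(1)] by blast
  obtain Q2 where Q2: "\<And>x. x \<in> D \<Longrightarrow> (Q1 has_real_derivative Q2 x) (at x)"
    using smooth_on_deriv_real[OF opD Q1(1)] by blast
  have Q0: "Q 0 = 1/4" "Q1 0 = -1/72"
    using derivatives_of_quotient_by_argument[OF opD D00 Q(2) Q1(2) Q2[OF D00] Zder
        has_real_derivative_level_height_deriv_at_zero] level_height_at_zero by auto
  have Qpos: "Q t > 0" if "t \<in> D" for t
  proof (cases "t = 0")
    case False
    have "t > 0 \<Longrightarrow> t * Q t > 0" "t < 0 \<Longrightarrow> t * Q t < 0"
      using strict_mono_onD[OF g(1) D00 that] strict_mono_onD[OF g(1) that D00]
        Q(2)[OF that] by (simp_all add: level_height_at_zero)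
    then show ?thesis
      using False by (cases "t > 0") (simp_all add: zero_less_mult_iff mult_less_0_iff)
  qed (simp add: Q0)
  \<comment> \<open>half the sum of the turning points, and half their difference divided by sqrt z\<close>
  define P where "P t = sqrt (sinhc_sqrt t) * cosh_sqrt (t * (1/4))" for t
  define M where "M t = sqrt (sinhc_sqrt t) * sinhc_sqrt (t * (1/4)) * inverse (sqrt (Q t)) * (1/2)" for t
  have Psm: "smooth_on D P" unfolding P_def[abs_def]
    by (intro smooth_on_intros opD S_smooth sqrt_smooth Spos quarter[OF smooth_on_cosh_sqrt])
  have Msm: "smooth_on D M" unfolding M_def[abs_def]
    by (intro smooth_on_intros opD S_smooth sqrt_smooth inv_smooth Spos Q(1)
         quarter[OF smooth_on_sinhc_sqrt] real_sqrt_gt_zero Qpos)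
  define p where "p z = P (g z)" for z
  define m where "m z = M (g z)" for z
  have "smooth_on J p" "smooth_on J m"
    unfolding p_def[abs_def] m_def[abs_def] J_def
    using g(2) gD Psm Msm
    by (auto intro!: smooth_on_compose_real[where T = D and f = g, OF _ _ g(4)] simp: J_def)
  moreover have "g 0 = 0" using g(5)[OF D00] by (simp add: level_height_at_zero)
  then have "m 0 = 1" by (simp add: m_def M_def sinhc_sqrt_at_zero Q0 real_sqrt_divide)
  moreover have "(m has_real_derivative 11/18) (at 0)"
  proof -
    have "(M has_real_derivative 11/72) (at 0)"
    proof -
      have "((\<lambda>t. sqrt (sinhc_sqrt t)) has_real_derivative 1/12) (at 0)"
        by (rule DERIV_cong[OF DERIV_chain2[OF DERIV_real_sqrt has_real_derivative_sinhc_sqrt]])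
           (auto simp: sinhc_sqrt_at_zero)
      moreover have "((\<lambda>t. sinhc_sqrt (t * (1/4))) has_real_derivative 1/24) (at 0)"
        by (rule DERIV_cong[OF DERIV_chain2[OF has_real_derivative_sinhc_sqrt DERIV_cmult_right[OF DERIV_ident]]])
           (auto simp: sinhc_sqrt_at_zero)
      moreover have "((\<lambda>t. inverse (sqrt (Q t))) has_real_derivative 1/18) (at 0)"
        by (rule DERIV_cong[OF DERIV_inverse'[OF DERIV_chain2[OF DERIV_real_sqrt Q1(2)[OF D00]]]])
           (auto simp: Q0 real_sqrt_divide)
      ultimately show ?thesis
        unfolding M_def[abs_def]
        by (intro DERIV_cong[OF DERIV_cmult_right[OF DERIV_mult[OF DERIV_mult]]])
           (auto simp: sinhc_sqrt_at_zero Q0 real_sqrt_divide)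
    qed
    moreover have "(g has_real_derivative 4) (at 0)"
      using g(6)[of 0] J0 \<open>g 0 = 0\<close> by (auto simp: J_def level_height_at_zero)
    ultimately have "((\<lambda>z. M (g z)) has_real_derivative 11/72 * 4) (at 0)"
      using \<open>g 0 = 0\<close> by (intro DERIV_chain2[of M _ "g"]) auto
    then show ?thesis by (simp add: m_def[abs_def])
  qed
  moreover have main: "\<exists>\<epsilon> \<sigma>. \<bar>\<epsilon>\<bar> = 1 \<and> \<sigma> \<ge> 0 \<and> level_height (\<sigma>\<^sup>2) = \<xi>\<^sup>2 \<and> (\<xi> > 0 \<longrightarrow> \<epsilon> = 1) \<and>
     (\<xi> < 0 \<longrightarrow> \<epsilon> = -1) \<and> (\<xi> \<noteq> 0 \<longrightarrow> \<sigma> > 0) \<and>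
     p (\<xi>\<^sup>2) + \<xi> * m (\<xi>\<^sup>2) = sqrt (sinhc_sqrt (\<sigma>\<^sup>2)) * exp (\<epsilon> * \<sigma> / 2)" for \<xi>
  proof -
    obtain t where t: "t \<ge> 0" "level_height t = \<xi>\<^sup>2" using surj[of "\<xi>\<^sup>2"] by auto
    define \<sigma> where "\<sigma> = sqrt t"
    have \<sigma>: "\<sigma> \<ge> 0" "t = \<sigma>\<^sup>2" using t by (auto simp: \<sigma>_def)
    \<comment> \<open>at \<open>\<xi> = 0\<close> the two turning points coincide and the sign is immaterial\<close>
    define \<epsilon> :: real where "\<epsilon> = (if \<xi> < 0 then -1 else 1)"
    have gt: "g (\<xi>\<^sup>2) = t" using g(5)[OF nonnegD[OF t(1)]] t(2) by simp
    have "\<sigma>\<^sup>2 * Q t = \<xi>\<^sup>2" using Q(2)[OF nonnegD[OF t(1)]] t \<sigma> by simp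
    then have "sqrt (\<sigma>\<^sup>2 * Q t) = sqrt (\<xi>\<^sup>2)" by simp
    then have sq: "\<sigma> * sqrt (Q t) = \<bar>\<xi>\<bar>" using \<sigma> by (simp add: real_sqrt_mult)
    have Qs: "sqrt (Q t) > 0" using Qpos nonnegD t by simp
    have "\<xi> * inverse (sqrt (Q t)) = \<epsilon> * \<sigma>"
      using sq Qs by (auto simp: \<epsilon>_def field_simps abs_if split: if_splits)
    then have "\<xi> * m (\<xi>\<^sup>2) = \<epsilon> * sqrt (sinhc_sqrt t) * ((\<sigma>/2) * sinhc_sqrt ((\<sigma>/2)\<^sup>2))"
      unfolding m_def gt M_def by (simp add: \<sigma>(2) power_divide mult_ac)
    also have "\<dots> = sqrt (sinhc_sqrt t) * (\<epsilon> * sinh (\<sigma>/2))"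
      unfolding sinhc_sqrt_square by simp
    finally have 1: "\<xi> * m (\<xi>\<^sup>2) = sqrt (sinhc_sqrt t) * (\<epsilon> * sinh (\<sigma>/2))" .
    have "p (\<xi>\<^sup>2) = sqrt (sinhc_sqrt t) * cosh_sqrt ((\<sigma>/2)\<^sup>2)"
      unfolding p_def gt P_def by (simp add: \<sigma>(2) power_divide)
    then have 2: "p (\<xi>\<^sup>2) = sqrt (sinhc_sqrt t) * cosh (\<sigma>/2)"
      by (simp only: cosh_sqrt_square)
    have "cosh (\<sigma>/2) + \<epsilon> * sinh (\<sigma>/2) = exp (\<epsilon> * \<sigma> / 2)"
      using cosh_minus_sinh[of "\<sigma>/2"] cosh_plus_sinh[of "\<sigma>/2"] by (auto simp: \<epsilon>_def)
    then have "p (\<xi>\<^sup>2) + \<xi> * m (\<xi>\<^sup>2) = sqrt (sinhc_sqrt (\<sigma>\<^sup>2)) * exp (\<epsilon> * \<sigma> / 2)"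
      unfolding 1 2 using \<sigma>(2) by (simp add: distrib_left[symmetric])
    moreover have "\<xi> \<noteq> 0 \<longrightarrow> \<sigma> > 0" using sq \<sigma>(1) by (cases "\<sigma> = 0") auto
    ultimately show ?thesis
      using t(2) \<sigma> by (intro exI[of _ \<epsilon>] exI[of _ \<sigma>]) (auto simp: \<epsilon>_def)
  qed
  have pos: "p (\<xi>\<^sup>2) + \<xi> * m (\<xi>\<^sup>2) > 0" for \<xi>
  proof -
    obtain \<epsilon> \<sigma> where *: "p (\<xi>\<^sup>2) + \<xi> * m (\<xi>\<^sup>2) = sqrt (sinhc_sqrt (\<sigma>\<^sup>2)) * exp (\<epsilon> * \<sigma> / 2)"
      using main[of \<xi>] by blast
    have "sinhc_sqrt (\<sigma>\<^sup>2) > 0" using sinhc_sqrt_ge_1[of "\<sigma>\<^sup>2"] by simp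
    then show ?thesis unfolding * by simp
  qed
  moreover have "shape (p (\<xi>\<^sup>2) + \<xi> * m (\<xi>\<^sup>2)) = 1/2 + \<xi>\<^sup>2" for \<xi>
    using main[of \<xi>] shape_at_turning_point by metis
  moreover have "p (\<xi>\<^sup>2) + \<xi> * m (\<xi>\<^sup>2) > 1" if \<xi>: "\<xi> > 0" for \<xi>
  proof -
    obtain \<sigma> where "\<sigma> > 0" "p (\<xi>\<^sup>2) + \<xi> * m (\<xi>\<^sup>2) = sqrt (sinhc_sqrt (\<sigma>\<^sup>2)) * exp (1 * \<sigma> / 2)"
      using main[of \<xi>] \<xi> by auto
    then show ?thesis using turning_point_side(1) by simp
  qed
  moreover have "p (\<xi>\<^sup>2) + \<xi> * m (\<xi>\<^sup>2) < 1" if \<xi>: "\<xi> < 0" for \<xi>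
  proof -
    obtain \<sigma> where "\<sigma> > 0" "p (\<xi>\<^sup>2) + \<xi> * m (\<xi>\<^sup>2) = sqrt (sinhc_sqrt (\<sigma>\<^sup>2)) * exp (-1 * \<sigma> / 2)"
      using main[of \<xi>] \<xi> by auto
    then show ?thesis using turning_point_side(2) by simp
  qed
  moreover have "open J" "connected J" using g by (auto simp: J_def)
  ultimately show ?thesis using that J0 by blast
qed

text \<open>The data produced by the preceding lemma. The coordinate \<open>\<xi>\<close> straightens the potential: in the
  coordinates \<open>(\<xi>, y)\<close> of the point \<open>(u(\<xi>), y)\<close> the energy \<open>1/(2 u\<^sup>2) + ln u + y\<^sup>2\<close> is
  \<open>1/2 + \<xi>\<^sup>2 + y\<^sup>2\<close>, so the level curves are circles.\<close>

locale turning_points =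
  fixes J :: "real set" and p m :: "real \<Rightarrow> real"
  assumes open_J: "open J" and connected_J: "connected J" and nonneg_J: "{0..} \<subseteq> J"
    and smooth_p: "smooth_on J p" and smooth_m: "smooth_on J m"
    and m_0: "m 0 = 1" and m_deriv_0: "(m has_real_derivative 11/18) (at 0)"
    and turning_pos: "\<And>\<xi>. p (\<xi>\<^sup>2) + \<xi> * m (\<xi>\<^sup>2) > 0"
    and turning_shape: "\<And>\<xi>. shape (p (\<xi>\<^sup>2) + \<xi> * m (\<xi>\<^sup>2)) = 1/2 + \<xi>\<^sup>2"
    and turning_gt_1: "\<And>\<xi>. \<xi> > 0 \<Longrightarrow> p (\<xi>\<^sup>2) + \<xi> * m (\<xi>\<^sup>2) > 1"
    and turning_less_1: "\<And>\<xi>. \<xi> < 0 \<Longrightarrow> p (\<xi>\<^sup>2) + \<xi> * m (\<xi>\<^sup>2) < 1"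
begin

definition u :: "real \<Rightarrow> real" where "u \<xi> = p (\<xi>\<^sup>2) + \<xi> * m (\<xi>\<^sup>2)"

definition u' :: "real \<Rightarrow> real" where "u' = deriv u"

text \<open>The action of the normalised oscillator at height \<open>x\<close> above the minimum. Only the odd part
  \<open>\<xi> m(\<xi>\<^sup>2)\<close> of \<open>u\<close> contributes to the enclosed area, so the integral involves \<open>x\<close> but not \<open>sqrt x\<close> and
  makes sense, smoothly, for \<open>x\<close> slightly negative.\<close>

definition reduced_action :: "real \<Rightarrow> real" where
  "reduced_action x = integral {-pi..pi} (\<lambda>t. (1 / (2 * pi)) * ((sin t)\<^sup>2 * x * m ((sin t)\<^sup>2 * x)))"

lemma square_in_J: "\<xi>\<^sup>2 \<in> J"
  using nonneg_J by auto

lemma zero_in_J: "0 \<in> J"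
  using nonneg_J by auto

lemma u_smooth: "smooth_on UNIV u"
proof -
  have sq: "smooth_on UNIV (\<lambda>\<xi>::real. \<xi> * \<xi>)"
    by (intro smooth_on_intros bounded_linear_ident) auto
  have "smooth_on UNIV (\<lambda>\<xi>. p (\<xi> * \<xi>) + \<xi> * m (\<xi> * \<xi>))"
    by (intro smooth_on_intros bounded_linear_ident open_UNIV
         smooth_on_compose_real[OF _ smooth_p sq] smooth_on_compose_real[OF _ smooth_m sq])
       (use square_in_J in \<open>auto simp: power2_eq_square\<close>)
  then show ?thesis by (simp add: u_def[abs_def] power2_eq_square)
qed

lemma u_deriv: "(u has_real_derivative u' \<xi>) (at \<xi>)"
  unfolding u'_def using smooth_on_imp_differentiable[OF u_smooth]
  by (simp add: DERIV_deriv_iff_real_differentiable)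

lemma u'_continuous: "continuous_on A u'"
proof -
  obtain f where f: "smooth_on UNIV f" "\<And>x. (u has_real_derivative f x) (at x)"
    using smooth_on_deriv_real[OF open_UNIV u_smooth] by auto
  have "f = u'" using f(2) u_deriv DERIV_unique by blast
  then show ?thesis
    using smooth_on_imp_continuous_on[OF f(1)] continuous_on_subset by blast
qed

lemma u_continuous: "continuous_on A u"
  using smooth_on_imp_continuous_on[OF u_smooth] continuous_on_subset by blast

lemma shape_deriv:
  assumes "v > 0"
  shows "(shape has_real_derivative (v\<^sup>2 - 1) / v ^ 3) (at v)"
  unfolding shape_def[abs_def] using assms
  by (auto intro!: derivative_eq_intros simp: field_simps power2_eq_square power3_eq_cube)

lemma u'_0: "u' 0 = 1"
proof -
  obtain p' where "(p has_real_derivative p') (at 0)"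
    using smooth_on_imp_differentiable[OF smooth_p zero_in_J] real_differentiable_def by blast
  then have "((\<lambda>\<xi>. p (\<xi>\<^sup>2) + \<xi> * m (\<xi>\<^sup>2)) has_real_derivative 1) (at 0)"
    using m_deriv_0
    by (auto intro!: derivative_eq_intros DERIV_chain2[of p] DERIV_chain2[of m] simp: m_0)
  then show ?thesis using u_deriv[of 0] DERIV_unique by (fastforce simp: u_def[abs_def])
qed

text \<open>In \<open>shape'(u \<xi>) u'(\<xi>) = 2 \<xi>\<close> the first factor has the sign of \<open>\<xi>\<close>; at \<open>\<xi> = 0\<close> the derivative is
  \<open>m(0) = 1\<close>.\<close>

lemma u'_pos: "u' \<xi> > 0"
proof (cases "\<xi> = 0")
  case False
  have pos: "u \<xi> > 0" using turning_pos by (simp add: u_def)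
  have "((\<lambda>\<xi>. shape (u \<xi>)) has_real_derivative ((u \<xi>)\<^sup>2 - 1) / u \<xi> ^ 3 * u' \<xi>) (at \<xi>)"
    by (rule DERIV_chain2[OF shape_deriv[OF pos] u_deriv])
  moreover have "((\<lambda>\<xi>. shape (u \<xi>)) has_real_derivative 2 * \<xi>) (at \<xi>)"
    unfolding u_def turning_shape by (auto intro!: derivative_eq_intros)
  ultimately have eq: "((u \<xi>)\<^sup>2 - 1) / u \<xi> ^ 3 * u' \<xi> = 2 * \<xi>" using DERIV_unique by blast
  show ?thesis
  proof (cases "\<xi> > 0")
    case True
    then have "(u \<xi>)\<^sup>2 > 1" using turning_gt_1[of \<xi>] by (simp add: u_def one_less_power)
    then have "((u \<xi>)\<^sup>2 - 1) / u \<xi> ^ 3 > 0" using pos by simp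
    then show ?thesis using eq True by (metis mult_pos_pos zero_less_mult_pos zero_less_numeral)
  next
    case f: False
    then have n: "\<xi> < 0" using False by simp
    then have "(u \<xi>)\<^sup>2 < 1" using turning_less_1[of \<xi>] pos by (simp add: u_def power_less_one_iff)
    then have "((u \<xi>)\<^sup>2 - 1) / u \<xi> ^ 3 < 0" using pos by (simp add: divide_neg_pos)
    then show ?thesis using eq n
      by (smt (verit) mult_nonneg_nonpos mult_nonpos_nonpos mult.commute)
  qed
qed (simp add: u'_0)

text \<open>The potential is strictly monotone on each side of its minimum.\<close>

lemma shape_inj:
  assumes "v > 0" "w > 0" "shape v = shape w" "(v \<ge> 1 \<and> w \<ge> 1) \<or> (v \<le> 1 \<and> w \<le> 1)"
  shows "v = w"
proof -
  have *: False if "0 < a" "a < b" "shape a = shape b" "a \<ge> 1 \<or> b \<le> 1" for a b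
  proof -
    have "\<exists>z>a. z < b \<and> shape b - shape a = (b - a) * ((z\<^sup>2 - 1) / z ^ 3)"
      by (rule MVT2[OF that(2)]) (use that(1) in \<open>auto intro!: shape_deriv\<close>)
    then obtain z where z: "a < z" "z < b" "shape b - shape a = (b - a) * ((z\<^sup>2 - 1) / z ^ 3)"
      by blast
    then have "z\<^sup>2 = 1" using that by simp
    then have "z = 1" using z that(1) by (simp add: power2_eq_1_iff)
    then show False using z that(4) by auto
  qed
  show ?thesis using *[of v w] *[of w v] assms by (metis linorder_neqE_linordered_idom)
qed

lemma u_surj:
  assumes "v > 0"
  obtains \<xi> where "u \<xi> = v" "\<xi>\<^sup>2 = shape v - 1/2"
proof -
  have ge: "shape v \<ge> 1/2"
  proof -
    have "ln (1 / v\<^sup>2) \<le> 1 / v\<^sup>2 - 1" using assms by (intro ln_le_minus_one) simp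
    then show ?thesis using assms by (simp add: shape_def ln_div ln_realpow field_simps)
  qed
  define \<xi> where "\<xi> = (if v \<ge> 1 then sqrt (shape v - 1/2) else - sqrt (shape v - 1/2))"
  have sq: "\<xi>\<^sup>2 = shape v - 1/2" using ge by (simp add: \<xi>_def)
  have "shape (u \<xi>) = shape v" using turning_shape[of \<xi>] sq by (simp add: u_def)
  moreover have "u \<xi> > 0" using turning_pos by (simp add: u_def)
  moreover have "(u \<xi> \<ge> 1 \<and> v \<ge> 1) \<or> (u \<xi> \<le> 1 \<and> v \<le> 1)"
  proof (cases "\<xi> = 0")
    case True
    have "shape (u 0) = 1/2" using turning_shape[of 0] by (simp add: u_def)
    moreover have "shape 1 = 1/2" by (simp add: shape_def)
    moreover have "u 0 > 0" using turning_pos[of 0] by (simp add: u_def)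
    ultimately have "u 0 = 1"
      using shape_inj[of "u 0" 1] linear[of "u 0" 1] by auto
    then show ?thesis using True by auto
  next
    case False
    then have "shape v - 1/2 > 0" using sq by (metis zero_less_power2)
    then show ?thesis
      using turning_gt_1[of \<xi>] turning_less_1[of \<xi>] by (auto simp: u_def \<xi>_def)
  qed
  ultimately have "u \<xi> = v" using shape_inj assms by blast
  then show ?thesis using that sq by blast
qed

lemma u_inverse:
  obtains v where "continuous_on {0<..} v" "\<And>x. x > 0 \<Longrightarrow> u (v x) = x"
proof -
  obtain g where g: "smooth_on (u ` UNIV) g" "\<And>x. g (u x) = x"
    using smooth_inverse_function[OF open_UNIV connected_UNIV u_smooth u_deriv u'_pos] by (metis UNIV_I)
  have "u ` UNIV = {0<..}"
    using turning_pos u_surj by (auto simp: u_def[symmetric] image_iff) metis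
  then have "continuous_on {0<..} g" using smooth_on_imp_continuous_on g(1) by metis
  moreover have "u (g x) = x" if "x > 0" for x
    using u_surj[OF that] g(2) by metis
  ultimately show ?thesis using that by blast
qed

end

section \<open>The action of the normalised oscillator\<close>

lemma integral_sin_power:
  "((\<lambda>t. (sin t)\<^sup>2) has_integral pi) {-pi..pi}"
  "((\<lambda>t. (sin t) ^ 4) has_integral (3 * pi / 4)) {-pi..pi}"
proof -
  have 1: "((\<lambda>t. (t - sin t * cos t) / 2) has_real_derivative (sin t)\<^sup>2) (at t)" for t :: real
    by (auto intro!: derivative_eq_intros simp: cos_squared_eq power2_eq_square[symmetric])
  have "((\<lambda>t. (sin t)\<^sup>2) has_integral (pi - sin pi * cos pi) / 2 - ((- pi) - sin (- pi) * cos (- pi)) / 2) {-pi..pi}"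
    by (rule fundamental_theorem_of_calculus)
       (use 1 in \<open>auto simp: has_real_derivative_iff_has_vector_derivative[symmetric]
          intro: has_field_derivative_at_within\<close>)
  then show "((\<lambda>t. (sin t)\<^sup>2) has_integral pi) {-pi..pi}" by simp
  have 2: "((\<lambda>t. 3/4 * ((t - sin t * cos t) / 2) - (sin t) ^ 3 * cos t / 4) has_real_derivative (sin t) ^ 4) (at t)"
    for t :: real
  proof -
    have "((\<lambda>t. 3/4 * ((t - sin t * cos t) / 2) - (sin t) ^ 3 * cos t / 4) has_real_derivative
        3/4 * (sin t)\<^sup>2 - (3 * (sin t)\<^sup>2 * (cos t)\<^sup>2 - sin t ^ 4) / 4) (at t)"
    proof (rule DERIV_diff[OF DERIV_cmult[OF 1]])
      show "((\<lambda>t. (sin t) ^ 3 * cos t / 4) has_real_derivative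
          (3 * (sin t)\<^sup>2 * (cos t)\<^sup>2 - sin t ^ 4) / 4) (at t)"
        by (auto intro!: derivative_eq_intros
            simp: power2_eq_square power4_eq_xxxx power3_eq_cube field_simps)
    qed
    also have "3/4 * (sin t)\<^sup>2 - (3 * (sin t)\<^sup>2 * (cos t)\<^sup>2 - sin t ^ 4) / 4 = sin t ^ 4"
      unfolding cos_squared_eq by (simp add: field_simps power2_eq_square power4_eq_xxxx)
    finally show ?thesis .
  qed
  have "((\<lambda>t. (sin t) ^ 4) has_integral (3/4 * ((pi - sin pi * cos pi) / 2) - (sin pi) ^ 3 * cos pi / 4) -
      (3/4 * (((- pi) - sin (- pi) * cos (- pi)) / 2) - (sin (- pi)) ^ 3 * cos (- pi) / 4)) {-pi..pi}"
    by (rule fundamental_theorem_of_calculus)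
       (use 2 in \<open>auto simp: has_real_derivative_iff_has_vector_derivative[symmetric]
          intro: has_field_derivative_at_within\<close>)
  then show "((\<lambda>t. (sin t) ^ 4) has_integral (3 * pi / 4)) {-pi..pi}" by simp
qed

context turning_points
begin

lemma convex_J: "convex J"
  using connected_J by (simp add: is_interval_convex_1[symmetric] is_interval_connected_1)

text \<open>The part of the integrand that contains \<open>p\<close> is odd in \<open>t\<close> and integrates to zero. The left-hand
  integrand is that of the area \<open>- \<integral> u dy\<close> along the circle \<open>\<xi> = \<rho> sin t\<close>, \<open>y = \<rho> cos t\<close>.\<close>

lemma reduced_action_eq_integral:
  assumes "\<rho> \<ge> 0"
  shows "((\<lambda>t. (\<rho> * sin t) * u (\<rho> * sin t)) has_integral 2 * pi * reduced_action (\<rho>\<^sup>2)) {-pi..pi}"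
proof -
  have sq: "(sin t)\<^sup>2 * \<rho>\<^sup>2 \<in> J" for t
    using square_in_J[of "sin t * \<rho>"] by (simp add: power_mult_distrib)
  have cp: "continuous_on {-pi..pi} (\<lambda>t. p ((sin t)\<^sup>2 * \<rho>\<^sup>2))"
    by (rule continuous_on_compose2[OF smooth_on_imp_continuous_on[OF smooth_p]])
       (use sq in \<open>auto intro!: continuous_intros\<close>)
  have cm: "continuous_on {-pi..pi} (\<lambda>t. m ((sin t)\<^sup>2 * \<rho>\<^sup>2))"
    by (rule continuous_on_compose2[OF smooth_on_imp_continuous_on[OF smooth_m]])
       (use sq in \<open>auto intro!: continuous_intros\<close>)
  define f where "f t = \<rho> * sin t * p ((sin t)\<^sup>2 * \<rho>\<^sup>2)" for t
  define I where "I = integral {-pi..pi} f"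
  have f: "(f has_integral I) {-pi..pi}"
    unfolding I_def f_def[abs_def]
    by (intro integrable_integral integrable_continuous_real continuous_intros cp)
  then have "((\<lambda>t. f (- t)) has_integral I) {- pi..- (- pi)}"
    by (subst has_integral_reflect_real) auto
  moreover have "(\<lambda>t. f (- t)) = (\<lambda>t. - f t)" by (rule ext) (simp add: f_def)
  ultimately have "((\<lambda>t. - f t) has_integral I) {-pi..pi}" by simp
  from has_integral_unique[OF has_integral_neg[OF f] this] have "I = 0" by simp
  define g where "g t = (1 / (2 * pi)) * ((sin t)\<^sup>2 * \<rho>\<^sup>2 * m ((sin t)\<^sup>2 * \<rho>\<^sup>2))" for t
  have "(g has_integral reduced_action (\<rho>\<^sup>2)) {-pi..pi}"
    unfolding reduced_action_def g_def[abs_def]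
    by (intro integrable_integral integrable_continuous_real continuous_intros cm)
  from has_integral_add[OF f has_integral_mult_right[OF this, of "2 * pi"]]
  have "((\<lambda>t. f t + 2 * pi * g t) has_integral 2 * pi * reduced_action (\<rho>\<^sup>2)) {-pi..pi}"
    using \<open>I = 0\<close> by simp
  moreover have "f t + 2 * pi * g t = (\<rho> * sin t) * u (\<rho> * sin t)" for t
    by (simp add: f_def g_def u_def power_mult_distrib algebra_simps power2_eq_square)
  ultimately show ?thesis by simp
qed

text \<open>With \<open>z = \<xi>\<^sup>2\<close>, the function \<open>z m(z)\<close> is \<open>\<xi>\<close> times half the distance of the turning points,
  and both factors increase with \<open>\<xi> > 0\<close>.\<close>

lemma moment_derivative_pos:
  assumes "x \<ge> 0" and N': "\<And>z. z \<in> J \<Longrightarrow> ((\<lambda>z. z * m z) has_real_derivative N' z) (at z)"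
  shows "N' x > 0"
proof (cases "x = 0")
  case True
  have "((\<lambda>z. z * m z) has_real_derivative 1) (at 0)"
    using m_deriv_0 by (auto intro!: derivative_eq_intros simp: m_0)
  then show ?thesis using N'[OF zero_in_J] DERIV_unique True by fastforce
next
  case False
  define \<xi> where "\<xi> = sqrt x"
  have \<xi>: "\<xi> > 0" "x = \<xi>\<^sup>2" using assms False by (auto simp: \<xi>_def)
  have "((\<lambda>\<xi>. \<xi>\<^sup>2 * m (\<xi>\<^sup>2)) has_real_derivative N' x * (2 * \<xi>)) (at \<xi>)"
    by (rule DERIV_chain2[of "\<lambda>z. z * m z"])
       (use N'[OF square_in_J[of \<xi>]] \<xi> in \<open>auto intro!: derivative_eq_intros\<close>)
  moreover have "\<xi>\<^sup>2 * m (\<xi>\<^sup>2) = \<xi> * (u \<xi> - u (- \<xi>)) / 2" for \<xi>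
    by (simp add: u_def power2_eq_square)
  moreover have "((\<lambda>\<xi>. \<xi> * (u \<xi> - u (- \<xi>)) / 2) has_real_derivative
      ((u \<xi> - u (- \<xi>)) + \<xi> * (u' \<xi> + u' (- \<xi>))) / 2) (at \<xi>)"
    by (auto intro!: derivative_eq_intros u_deriv DERIV_chain2[OF u_deriv])
  ultimately have eq: "N' x * (2 * \<xi>) = ((u \<xi> - u (- \<xi>)) + \<xi> * (u' \<xi> + u' (- \<xi>))) / 2"
    using DERIV_unique by force
  have "u \<xi> > u (- \<xi>)" using turning_gt_1[of \<xi>] turning_less_1[of "- \<xi>"] \<xi>(1) by (simp add: u_def)
  moreover have "\<xi> * (u' \<xi> + u' (- \<xi>)) > 0" using u'_pos[of \<xi>] u'_pos[of "- \<xi>"] \<xi> by simp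
  ultimately have "N' x * (2 * \<xi>) > 0" unfolding eq by simp
  then show ?thesis using \<xi> by (simp add: zero_less_mult_iff)
qed

text \<open>The action \<open>B = reduced_action\<close> is smooth with positive derivative on an interval around \<open>[0, \<infinity>)\<close>, hence so is
  its inverse \<open>E\<close>. The averages \<open>1/2\<close> of \<open>sin\<^sup>2\<close> and \<open>3/8\<close> of \<open>sin\<^sup>4\<close> give \<open>B'(0) = 1/2\<close> and
  \<open>B''(0) = 3/8 \<cdot> 2 m'(0) = 11/24\<close>, therefore \<open>E'(0) = 2\<close> and \<open>E''(0) = - B''(0) / B'(0)\<^sup>3 = - 11/3\<close>.
  What matters in the end is that \<open>E'' + E'\<^sup>2 = 1/3\<close> does not vanish at \<open>0\<close>.\<close>

lemma energy_of_action:
  obtains K E E1 where "open K" "smooth_on K E"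
    "\<And>x. x \<ge> 0 \<Longrightarrow> reduced_action x \<in> K" "\<And>x. x \<ge> 0 \<Longrightarrow> E (reduced_action x) = x"
    "\<And>x. x \<ge> 0 \<Longrightarrow> reduced_action x \<ge> 0" "reduced_action 0 = 0" "continuous_on {0..} reduced_action"
    "\<And>b. b \<in> K \<Longrightarrow> (E has_real_derivative E1 b) (at b)"
    "E1 0 = 2" "(E1 has_real_derivative -11/3) (at 0)"
proof -
  define N where "N z = z * m z" for z
  have Nsm: "smooth_on J N" unfolding N_def[abs_def]
    by (intro smooth_on_intros open_J smooth_m bounded_linear_ident)
  obtain N1 where N1: "smooth_on J N1" "\<And>z. z \<in> J \<Longrightarrow> (N has_real_derivative N1 z) (at z)"
    using smooth_on_deriv_real[OF open_J Nsm] by blast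
  obtain N2 where N2: "smooth_on J N2" "\<And>z. z \<in> J \<Longrightarrow> (N1 has_real_derivative N2 z) (at z)"
    using smooth_on_deriv_real[OF open_J N1(1)] by blast
  obtain m1 where m1: "smooth_on J m1" "\<And>z. z \<in> J \<Longrightarrow> (m has_real_derivative m1 z) (at z)"
    using smooth_on_deriv_real[OF open_J smooth_m] by blast
  obtain m2 where m2: "\<And>z. z \<in> J \<Longrightarrow> (m1 has_real_derivative m2 z) (at z)"
    using smooth_on_deriv_real[OF open_J m1(1)] by blast
  have "m1 0 = 11/18" using m1(2)[OF zero_in_J] m_deriv_0 DERIV_unique by blast
  then have N0: "N1 0 = 1" "N2 0 = 11/9"
    using derivatives_of_quotient_by_argument[OF open_J zero_in_J N_def m1(2) m2[OF zero_in_J]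
        N1(2) N2(2)[OF zero_in_J]] m_0 by auto
  have N1pos: "N1 z > 0" if "z \<ge> 0" for z
    using moment_derivative_pos[OF that] N1(2) by (simp add: N_def[abs_def])
  define \<kappa> where "\<kappa> t = (sin t)\<^sup>2" for t :: real
  have \<kappa>: "continuous_on A \<kappa>" "\<kappa> t \<in> {0..1}" for A t
    unfolding \<kappa>_def[abs_def] by (auto intro!: continuous_intros simp: abs_square_le_1)
  define \<omega> :: "real \<Rightarrow> real" where "\<omega> t = 1 / (2 * pi)" for t
  have \<omega>: "continuous_on A \<omega>" for A unfolding \<omega>_def[abs_def] by (intro continuous_intros)
  have \<omega>\<kappa>: "continuous_on A (\<lambda>t. \<omega> t * \<kappa> t)" for A by (intro continuous_intros \<omega> \<kappa>)
  have B_eq: "reduced_action = (\<lambda>x. integral {-pi..pi} (\<lambda>t. \<omega> t * N (\<kappa> t * x)))"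
    by (simp add: reduced_action_def[abs_def] \<omega>_def \<kappa>_def N_def)
  define B1 where "B1 x = integral {-pi..pi} (\<lambda>t. (\<omega> t * \<kappa> t) * N1 (\<kappa> t * x))" for x
  have Bsm: "smooth_on J reduced_action" unfolding B_eq
    by (rule smooth_on_weighted_dilation_integral[OF open_J convex_J zero_in_J Nsm \<omega> \<kappa>])
  have B1: "(reduced_action has_real_derivative B1 x) (at x)" if "x \<in> J" for x
    unfolding B_eq B1_def
    by (rule weighted_dilation_integral_deriv[OF open_J convex_J zero_in_J
          smooth_on_imp_continuous_on[OF N1(1)] N1(2) \<omega> \<kappa> that])
  have B2: "(B1 has_real_derivative integral {-pi..pi} (\<lambda>t. (\<omega> t * \<kappa> t * \<kappa> t) * N2 (\<kappa> t * 0))) (at 0)"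
    unfolding B1_def[abs_def]
    by (rule weighted_dilation_integral_deriv[OF open_J convex_J zero_in_J
          smooth_on_imp_continuous_on[OF N2(1)] N2(2) \<omega>\<kappa> \<kappa> zero_in_J])
  have "((\<lambda>t. (\<omega> t * \<kappa> t * \<kappa> t) * N2 (\<kappa> t * 0)) has_integral 11/24) {-pi..pi}"
    using has_integral_mult_right[OF integral_sin_power(2), of "1 / (2 * pi) * (11/9)"]
    by (simp add: \<omega>_def \<kappa>_def N0 power2_eq_square power4_eq_xxxx mult_ac)
  then have B2': "(B1 has_real_derivative 11/24) (at 0)"
    using B2 integral_unique by metis
  have "((\<lambda>t. (\<omega> t * \<kappa> t) * N1 (\<kappa> t * 0)) has_integral 1/2) {-pi..pi}"
    using has_integral_mult_right[OF integral_sin_power(1), of "1 / (2 * pi)"]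
    by (simp add: \<omega>_def \<kappa>_def N0 mult_ac)
  then have B10: "B1 0 = 1/2" unfolding B1_def by (rule integral_unique)
  have B1sm: "smooth_on J B1" unfolding B1_def[abs_def]
    by (rule smooth_on_weighted_dilation_integral[OF open_J convex_J zero_in_J N1(1) \<omega>\<kappa> \<kappa>])
  have B1pos: "B1 x > 0" if "x \<ge> 0" for x
  proof -
    define f where "f t = (\<omega> t * \<kappa> t) * N1 (\<kappa> t * x)" for t
    have "continuous_on {-pi..pi} (\<lambda>t. N1 (\<kappa> t * x))"
      by (rule continuous_on_compose2[OF smooth_on_imp_continuous_on[OF N1(1)]])
         (use nonneg_J \<kappa>(2) that in \<open>auto intro!: continuous_intros \<kappa>(1)\<close>)
    then have cf: "continuous_on {-pi..pi} f" unfolding f_def[abs_def] by (intro continuous_intros \<omega>\<kappa>)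
    have nn: "f t \<ge> 0" for t
      using N1pos[of "\<kappa> t * x"] \<kappa>(2)[of t] that by (simp add: f_def \<omega>_def)
    have "f (pi/2) > 0" using N1pos[of x] that by (simp add: f_def \<omega>_def \<kappa>_def)
    then have "integral {-pi..pi} f \<noteq> 0"
      using integral_eq_0_iff[OF cf] nn pi_gt_zero by force
    moreover have "integral {-pi..pi} f \<ge> 0"
      using nn by (intro integral_nonneg integrable_continuous_real cf)
    ultimately show ?thesis by (simp add: B1_def f_def[abs_def])
  qed
  \<comment> \<open>the derivative is positive on [0, \<infinity>), hence on a slightly larger half-line\<close>
  define J1 where "J1 = J \<inter> B1 -` {0<..}"
  have "open J1" unfolding J1_def
    by (rule continuous_open_preimage[OF smooth_on_imp_continuous_on[OF B1sm] open_J]) simp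
  moreover have J1: "{0..} \<subseteq> J1" using B1pos nonneg_J by (auto simp: J1_def)
  ultimately obtain \<delta> where \<delta>: "\<delta> > 0" "ball 0 \<delta> \<subseteq> J1"
    by (metis open_contains_ball atLeast_iff order_refl subsetD)
  define D where "D = {-\<delta><..}"
  have D: "D \<subseteq> J1"
  proof
    fix x assume x: "x \<in> D"
    show "x \<in> J1"
    proof (cases "x \<ge> 0")
      case False
      then have "x \<in> ball 0 \<delta>" using x by (simp add: D_def dist_real_def)
      then show ?thesis using \<delta> by blast
    qed (use J1 in auto)
  qed
  have nonnegD: "x \<in> D" if "x \<ge> 0" for x using that \<delta>(1) by (simp add: D_def)
  have DJ: "D \<subseteq> J" using D by (auto simp: J1_def)
  have opD: "open D" "connected D" by (auto simp: D_def)
  have BD: "(reduced_action has_real_derivative B1 x) (at x)" "B1 x > 0" if "x \<in> D" for x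
    using that B1 D by (auto simp: J1_def)
  obtain E where E: "strict_mono_on D reduced_action" "open (reduced_action ` D)" "smooth_on (reduced_action ` D) E"
      "\<And>x. x \<in> D \<Longrightarrow> E (reduced_action x) = x"
      "\<And>y. y \<in> reduced_action ` D \<Longrightarrow> (E has_real_derivative inverse (B1 (E y))) (at y)"
    using smooth_inverse_function[OF opD smooth_on_subset[OF Bsm DJ] BD] by metis
  have B0: "reduced_action 0 = 0" by (simp add: reduced_action_def)
  have Bpos: "reduced_action x > 0" if "x > 0" for x
    using strict_mono_onD[OF E(1) nonnegD[of 0] nonnegD[of x]] that B0 by auto
  have "0 \<in> D" using nonnegD by simp
  have E0: "E 0 = 0" using E(4)[OF \<open>0 \<in> D\<close>] B0 by simp
  have "(E has_real_derivative 2) (at 0)"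
    using E(5)[of 0] \<open>0 \<in> D\<close> B0 by (force simp: E0 B10)
  moreover have "((\<lambda>y. inverse (B1 (E y))) has_real_derivative -11/3) (at 0)"
  proof -
    have "((\<lambda>y. B1 (E y)) has_real_derivative 11/24 * 2) (at 0)"
      using \<open>(E has_real_derivative 2) (at 0)\<close> B2' E0 by (intro DERIV_chain2[of B1]) auto
    then show ?thesis
      by (rule DERIV_cong[OF DERIV_inverse']) (simp_all add: E0 B10)
  qed
  moreover have "continuous_on {0..} reduced_action"
    using smooth_on_imp_continuous_on[OF Bsm] continuous_on_subset nonneg_J by blast
  moreover have "reduced_action x \<ge> 0" if "x \<ge> 0" for x
    using Bpos[of x] B0 that by (cases "x = 0") auto
  ultimately show ?thesis
    using that[of "reduced_action ` D" E "\<lambda>y. inverse (B1 (E y))"] E(2-5) nonnegD Bpos B0 E0 B10 by simp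
qed

end

section \<open>Traversals of a closed curve\<close>

text \<open>By Caratheodory's characterization \<open>f(\<theta> s) - f(\<theta> t) = \<kappa>(\<theta> s) (\<theta> s - \<theta> t)\<close> with \<open>\<kappa>\<close> continuous and
  nonzero, so the difference quotient of \<open>\<theta>\<close> is that of \<open>f \<circ> \<theta>\<close> divided by \<open>\<kappa>(\<theta> s)\<close>.\<close>

lemma differentiable_through_chart:
  fixes f \<theta> :: "real \<Rightarrow> real"
  assumes f: "(f has_real_derivative f') (at (\<theta> t))" "f' \<noteq> 0"
    and \<theta>: "isCont \<theta> t" and comp: "((\<lambda>s. f (\<theta> s)) has_real_derivative d) (at t)"
  shows "(\<theta> has_real_derivative d / f') (at t)"
proof -
  obtain \<kappa> where \<kappa>: "\<And>z. f z - f (\<theta> t) = \<kappa> z * (z - \<theta> t)" "isCont \<kappa> (\<theta> t)" "\<kappa> (\<theta> t) = f'"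
    using f(1) by (auto simp: CARAT_DERIV)
  have "isCont (\<lambda>s. \<kappa> (\<theta> s)) t" using isCont_o2[OF \<theta> \<kappa>(2)] .
  then have \<kappa>lim: "((\<lambda>s. \<kappa> (\<theta> s)) \<longlongrightarrow> f') (at t)" using \<kappa>(3) by (simp add: isCont_def)
  have "((\<lambda>s. ((f (\<theta> s) - f (\<theta> t)) / (s - t)) / \<kappa> (\<theta> s)) \<longlongrightarrow> d / f') (at t)"
    using comp \<kappa>lim f(2) by (intro tendsto_divide) (auto simp: has_field_derivative_iff)
  moreover have "\<forall>\<^sub>F s in at t. \<kappa> (\<theta> s) \<noteq> 0"
    using \<kappa>lim f(2) by (rule tendsto_imp_eventually_ne)
  then have "\<forall>\<^sub>F s in at t. ((f (\<theta> s) - f (\<theta> t)) / (s - t)) / \<kappa> (\<theta> s) = (\<theta> s - \<theta> t) / (s - t)"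
    by eventually_elim (simp add: \<kappa>(1))
  ultimately have "((\<lambda>s. (\<theta> s - \<theta> t) / (s - t)) \<longlongrightarrow> d / f') (at t)"
    using tendsto_cong by force
  then show ?thesis by (simp add: has_field_derivative_iff)
qed

text \<open>The angle along a simple loop on a circle makes exactly one turn. More than one turn would pass
  through the starting direction in between, and with no turn at all the angle would go
  out and come back through the same values; both contradict injectivity.\<close>

lemma simple_loop_turns_once:
  fixes \<theta> :: "real \<Rightarrow> real" and n :: int
  assumes cont: "continuous_on {0..1} \<theta>"
    and closed: "\<theta> 1 - \<theta> 0 = 2 * pi * n"
    and inj: "\<And>x y k::int. \<lbrakk>x \<in> {0..1}; y \<in> {0..1}; \<theta> x - \<theta> y = 2 * pi * k\<rbrakk>
      \<Longrightarrow> x = y \<or> x = 0 \<and> y = 1 \<or> x = 1 \<and> y = 0"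
  shows "\<bar>\<theta> 1 - \<theta> 0\<bar> = 2 * pi"
proof -
  define injective_mod :: "(real \<Rightarrow> real) \<Rightarrow> bool" where
    "injective_mod \<theta> \<longleftrightarrow> (\<forall>x\<in>{0..1}. \<forall>y\<in>{0..1}. \<forall>k::int. \<theta> x - \<theta> y = 2 * pi * k \<longrightarrow>
       x = y \<or> x = 0 \<and> y = 1 \<or> x = 1 \<and> y = 0)" for \<theta>
  have less_2: False if cont: "continuous_on {0..1} \<theta>" and gt: "\<theta> 1 > \<theta> 0 + 2 * pi"
    and inj: "injective_mod \<theta>" for \<theta>
  proof -
    obtain t where t: "0 \<le> t" "t \<le> 1" "\<theta> t = \<theta> 0 + 2 * pi"
      using IVT'[of \<theta> 0 "\<theta> 0 + 2 * pi" 1] cont gt pi_gt_zero by (auto simp del: pi_gt_zero)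
    have "\<theta> t - \<theta> 0 = 2 * pi * real_of_int 1" using t by simp
    then have "t = 0 \<or> t = 1"
      using t inj[unfolded injective_mod_def, THEN bspec[of _ _ t], THEN bspec[of _ _ 0]] by auto
    then show False using t(3) gt by auto
  qed
  have not_0: False if cont: "continuous_on {0..1} \<theta>" and eq: "\<theta> 1 = \<theta> 0" and gt: "\<theta> (1/2) > \<theta> 0"
    and inj: "injective_mod \<theta>" for \<theta>
  proof -
    define y where "y = (\<theta> 0 + \<theta> (1/2)) / 2"
    have y: "\<theta> 0 < y" "y < \<theta> (1/2)" using gt by (auto simp: y_def)
    have c: "continuous_on {0..1/2} \<theta>" "continuous_on {1/2..1} \<theta>"
      by (rule continuous_on_subset[OF cont], force)+
    obtain a where a: "0 \<le> a" "a \<le> 1/2" "\<theta> a = y"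
      using IVT'[of \<theta> 0 y "1/2"] c(1) y by auto
    obtain b where b: "1/2 \<le> b" "b \<le> 1" "\<theta> b = y"
      using IVT2'[of \<theta> 1 y "1/2"] c(2) y eq by auto
    have "a \<noteq> 1/2" "b \<noteq> 1/2" using a(3) b(3) y by (metis less_irrefl)+
    then have "a < 1/2" "1/2 < b" using a b by auto
    have "a \<noteq> 0" using a(3) y by (metis less_irrefl)
    have "\<theta> a - \<theta> b = 2 * pi * real_of_int 0" using a b by simp
    then have "a = b \<or> a = 0 \<and> b = 1 \<or> a = 1 \<and> b = 0"
      using a b inj[unfolded injective_mod_def, THEN bspec[of _ _ a], THEN bspec[of _ _ b]] by auto
    then show False using \<open>a < 1/2\<close> \<open>1/2 < b\<close> \<open>a \<noteq> 0\<close> by auto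
  qed
  have neg: "continuous_on {0..1} (\<lambda>x. - \<theta> x)" by (intro continuous_intros cont)
  have im: "injective_mod \<theta>" using inj unfolding injective_mod_def by blast
  have im_neg: "injective_mod (\<lambda>x. - \<theta> x)"
    unfolding injective_mod_def
  proof (intro ballI allI impI)
    fix x y :: real and k :: int
    assume "x \<in> {0..1}" "y \<in> {0..1}" "- \<theta> x - - \<theta> y = 2 * pi * k"
    then show "x = y \<or> x = 0 \<and> y = 1 \<or> x = 1 \<and> y = 0"
      using inj[of x y "- k"] by simp
  qed
  have "\<theta> 1 \<noteq> \<theta> 0"
  proof
    assume eq: "\<theta> 1 = \<theta> 0"
    have "\<theta> (1/2) \<noteq> \<theta> 0" using inj[of "1/2" 0 0] by auto
    then show False
      using not_0[OF cont eq _ im] not_0[OF neg _ _ im_neg] eq by fastforce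
  qed
  moreover have "\<not> \<theta> 1 > \<theta> 0 + 2 * pi" using less_2[OF cont _ im] by blast
  moreover have "\<not> - \<theta> 1 > - \<theta> 0 + 2 * pi" using less_2[OF neg _ im_neg] by blast
  ultimately have *: "2 * pi * n \<noteq> 0" "\<not> 2 * pi * n > 2 * pi" "\<not> 2 * pi * n < - (2 * pi)"
    unfolding closed[symmetric] by linarith+
  then have n: "n \<noteq> 0" "\<not> 2 * pi * n > 2 * pi" "\<not> 2 * pi * n < - (2 * pi)"
    by (auto simp del: mult_less_cancel_left2)
  have "\<not> n \<ge> 2"
  proof
    assume "n \<ge> 2"
    then have "2 * pi * 2 \<le> 2 * pi * real_of_int n" by (intro mult_left_mono) auto
    then show False using n(2) pi_gt_zero by linarith
  qed
  moreover have "\<not> n \<le> -2"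
  proof
    assume "n \<le> -2"
    then have "2 * pi * real_of_int n \<le> 2 * pi * (-2)" by (intro mult_left_mono) auto
    then show False using n(3) pi_gt_zero by linarith
  qed
  ultimately have "n = 1 \<or> n = -1" using n(1) by linarith
  then show ?thesis using closed by auto
qed

text \<open>An antiderivative of a \<open>2\<pi>\<close>-periodic function grows by the integral over a period with every turn.\<close>

lemma periodic_antiderivative:
  fixes g :: "real \<Rightarrow> real"
  assumes cont: "continuous_on UNIV g" and per: "\<And>x. g (x + 2 * pi) = g x"
    and I: "(g has_integral I) {-pi..pi}"
  obtains L where "\<And>x. (L has_real_derivative g x) (at x)" "\<And>x. L (x + 2 * pi) = L x + I"
proof -
  obtain L where L: "\<And>x. (L has_real_derivative g x) (at x)"
    using einterval_antiderivative[of "-\<infinity>" "\<infinity>" g] cont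
    by (auto simp: continuous_on_eq_continuous_at has_real_derivative_iff_has_vector_derivative)
  have "((\<lambda>x. L (x + 2 * pi) - L x) has_real_derivative 0) (at x)" for x
  proof -
    have "((\<lambda>x. L (x + 2 * pi)) has_real_derivative g (x + 2 * pi) * 1) (at x)"
      by (rule DERIV_chain2[OF L]) (auto intro!: derivative_eq_intros)
    from DERIV_diff[OF this L[of x]] show ?thesis by (simp add: per)
  qed
  then have const: "L (x + 2 * pi) - L x = L (- pi + 2 * pi) - L (- pi)" for x
    using DERIV_isconst_all[of "\<lambda>x. L (x + 2 * pi) - L x"] by blast
  have "(g has_integral L pi - L (- pi)) {-pi..pi}"
    by (rule fundamental_theorem_of_calculus)
       (use L in \<open>auto simp: has_real_derivative_iff_has_vector_derivative[symmetric]
          intro: has_field_derivative_at_within\<close>)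
  then have "L pi - L (- pi) = I" using I has_integral_unique by blast
  then show ?thesis using that[of L] L const by (simp add: algebra_simps)
qed

context turning_points
begin

lemma u_eq_iff: "u a = u b \<longleftrightarrow> a = b"
  using smooth_inverse_function[OF open_UNIV connected_UNIV u_smooth u_deriv u'_pos] by (metis UNIV_I)

text \<open>Every piecewise \<open>C\<^sup>1\<close> traversal gives the same area, whatever its speed and orientation. Lift the
  traversal to an angle \<open>\<theta>\<close>; then the integrand is the derivative of \<open>K \<circ> \<theta>\<close> for an explicit \<open>K\<close> that
  grows by \<open>2\<pi>\<close> times the action with every turn, and \<open>\<theta>\<close> makes one turn.\<close>

lemma level_curve_line_integral:
  fixes \<gamma> :: "real \<Rightarrow> real \<times> real"
  assumes pos: "\<rho> > 0" "l > 0" "\<mu> > 0"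
    and \<gamma>: "traverses_once \<gamma> (range (\<lambda>\<theta>. (l * u (\<rho> * sin \<theta>), \<mu> * (\<rho> * cos \<theta>))))"
  shows "\<bar>integral {0..1} (\<lambda>t. snd (\<gamma> t) * fst (vector_derivative \<gamma> (at t within {0..1})))\<bar> =
     2 * pi * (l * \<mu> * reduced_action (\<rho>\<^sup>2))"
proof -
  define c where "c \<theta> = (l * u (\<rho> * sin \<theta>), \<mu> * (\<rho> * cos \<theta>))" for \<theta>
  have c_eq: "sin a = sin b \<and> cos a = cos b" if "c a = c b" for a b
    using that pos by (auto simp: c_def u_eq_iff)
  obtain v where v: "continuous_on {0<..} v" "\<And>x. x > 0 \<Longrightarrow> u (v x) = x"
    using u_inverse by metis
  have u_pos: "u \<xi> > 0" for \<xi> using turning_pos by (simp add: u_def)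
  have vu: "v (u \<xi>) = \<xi>" for \<xi> using v(2)[OF u_pos] u_eq_iff by blast
  have \<gamma>': "\<gamma> piecewise_C1_differentiable_on {0..1}" "\<gamma> 1 = \<gamma> 0" "\<gamma> ` {0..1} = range c"
      "simple_path \<gamma> \<or> range c = {\<gamma> 0}"
    using \<gamma> by (auto simp: traverses_once_def c_def[abs_def] pathfinish_def pathstart_def path_image_def)
  have "range c \<noteq> {\<gamma> 0}"
  proof
    assume "range c = {\<gamma> 0}"
    then have "c 0 = c pi" by (metis rangeI singletonD)
    then show False using pos by (simp add: c_def)
  qed
  then have simple: "simple_path \<gamma>" using \<gamma>' by blast
  have cont: "continuous_on {0..1} \<gamma>" using \<gamma>'(1) by (simp add: piecewise_C1_differentiable_on_def)
  have on: "\<exists>a. \<gamma> t = c a" if "t \<in> {0..1}" for t using \<gamma>'(3) that by auto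
  \<comment> \<open>the traversal transported to the unit circle; its logarithm yields the angle\<close>
  define Z where "Z t = Complex (snd (\<gamma> t) / (\<mu> * \<rho>)) (v (fst (\<gamma> t) / l) / \<rho>)" for t
  have Z: "Z t = cis a" if "\<gamma> t = c a" for t a
    using that pos by (simp add: Z_def c_def vu cis.code)
  have "continuous_on {0..1} Z"
  proof -
    have "continuous_on {0..1} (\<lambda>t. v (fst (\<gamma> t) / l))"
    proof (rule continuous_on_compose2[OF v(1)])
      show "(\<lambda>t. fst (\<gamma> t) / l) ` {0..1} \<subseteq> {0<..}"
        using on u_pos pos by (auto simp: c_def dest!: on)
    qed (use pos in \<open>auto intro!: continuous_intros cont\<close>)
    then show ?thesis
      unfolding Z_def[abs_def] Complex_eq using pos by (intro continuous_intros cont) auto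
  qed
  then obtain q where q: "continuous_on {0..1} q" "\<And>t. t \<in> {0..1} \<Longrightarrow> Z t = exp (q t)"
    using continuous_logarithm_on_contractible[of "{0..1}" Z] on Z
    by (metis cis_neq_zero convex_imp_contractible convex_real_interval(5))
  define \<theta> where "\<theta> t = Im (q t)" for t
  have \<theta>: "\<gamma> t = c (\<theta> t)" if t: "t \<in> {0..1}" for t
  proof -
    obtain a where a: "\<gamma> t = c a" using on t by blast
    then have ez: "exp (q t) = cis a" using q(2)[OF t] Z by simp
    then have "exp (Re (q t)) = 1" by (metis norm_cis norm_exp_eq_Re)
    then have "cis (\<theta> t) = cis a" using ez by (simp add: exp_eq_polar \<theta>_def)
    then have "cos (\<theta> t) = cos a \<and> sin (\<theta> t) = sin a" by (metis cis.sel)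
    then show ?thesis using a by (simp add: c_def)
  qed
  have \<theta>cont: "continuous_on {0..1} \<theta>" unfolding \<theta>_def[abs_def] by (intro continuous_intros q)
  have cper: "c a = c b \<longleftrightarrow> (\<exists>k::int. a - b = 2 * pi * k)" for a b
    using c_eq[of a b] sin_cos_eq_iff[of a b] by (auto simp: c_def algebra_simps)
  obtain n :: int where n: "\<theta> 1 - \<theta> 0 = 2 * pi * n"
    using cper[of "\<theta> 1" "\<theta> 0"] \<theta>[of 0] \<theta>[of 1] \<gamma>'(2) by auto
  have turn: "\<bar>\<theta> 1 - \<theta> 0\<bar> = 2 * pi"
  proof (rule simple_loop_turns_once[OF \<theta>cont n])
    fix x y :: real and k :: int
    assume xy: "x \<in> {0..1}" "y \<in> {0..1}" "\<theta> x - \<theta> y = 2 * pi * k"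
    then have "\<gamma> x = \<gamma> y" using cper \<theta> by metis
    then show "x = y \<or> x = 0 \<and> y = 1 \<or> x = 1 \<and> y = 0"
      using simple xy by (auto simp: simple_path_def loop_free_def)
  qed
  obtain L where L: "\<And>x. (L has_real_derivative (\<rho> * sin x) * u (\<rho> * sin x)) (at x)"
      "\<And>x. L (x + 2 * pi) = L x + 2 * pi * reduced_action (\<rho>\<^sup>2)"
  proof (rule periodic_antiderivative[OF _ _ reduced_action_eq_integral])
    show "continuous_on UNIV (\<lambda>t. (\<rho> * sin t) * u (\<rho> * sin t))"
      by (intro continuous_intros continuous_on_compose2[OF u_continuous[of UNIV]]) auto
  qed (use pos in auto)
  \<comment> \<open>the first summand comes from integrating by parts in \<open>\<integral> y du = u y - \<integral> u dy\<close>\<close>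
  define K where "K x = (l * \<mu>) * (\<rho> * cos x * u (\<rho> * sin x) + L x)" for x
  have u_comp: "((\<lambda>x. u (\<rho> * sin x)) has_real_derivative u' (\<rho> * sin x) * (\<rho> * cos x)) (at x)" for x
    by (rule DERIV_chain2[OF u_deriv]) (auto intro!: derivative_eq_intros)
  have K: "(K has_real_derivative (\<mu> * (\<rho> * cos x)) * (l * (u' (\<rho> * sin x) * (\<rho> * cos x)))) (at x)" for x
    unfolding K_def[abs_def]
    by (auto intro!: derivative_eq_intros u_comp L simp: algebra_simps)
  have Kper: "K (x + 2 * pi) = K x + 2 * pi * (l * \<mu> * reduced_action (\<rho>\<^sup>2))" for x
    unfolding K_def L(2) sin_periodic cos_periodic by (simp add: algebra_simps)
  obtain S D where S: "finite S" "\<And>t. t \<in> {0..1} - S \<Longrightarrow> (\<gamma> has_vector_derivative D t) (at t)"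
    using \<gamma>'(1) unfolding piecewise_C1_differentiable_on_def C1_differentiable_on_def by metis
  have "((\<lambda>t. snd (\<gamma> t) * fst (vector_derivative \<gamma> (at t within {0..1}))) has_integral
      K (\<theta> 1) - K (\<theta> 0)) {0..1}"
  proof (rule fundamental_theorem_of_calculus_interior_strong[OF S(1)])
    show "continuous_on {0..1} (\<lambda>t. K (\<theta> t))"
      by (rule continuous_on_compose2[OF _ \<theta>cont, of UNIV])
         (use K in \<open>auto intro!: continuous_at_imp_continuous_on DERIV_isCont\<close>)
    fix t :: real assume t: "t \<in> {0<..<1} - S"
    then have D: "(\<gamma> has_vector_derivative D t) (at t)" using S by auto
    have vd: "vector_derivative \<gamma> (at t within {0..1}) = D t"
      using t by (intro vector_derivative_at_within_ivl[OF D]) auto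
    have "((\<lambda>t. fst (\<gamma> t)) has_vector_derivative fst (D t)) (at t)"
      "((\<lambda>t. snd (\<gamma> t)) has_vector_derivative snd (D t)) (at t)"
      using D by (auto intro: bounded_linear.has_vector_derivative bounded_linear_fst bounded_linear_snd)
    then have D1: "((\<lambda>t. fst (\<gamma> t)) has_real_derivative fst (D t)) (at t)"
      and D2: "((\<lambda>t. snd (\<gamma> t)) has_real_derivative snd (D t)) (at t)"
      by (auto simp: has_real_derivative_iff_has_vector_derivative)
    have op: "open {0<..<1::real}" "t \<in> {0<..<1}" using t by auto
    have D1': "((\<lambda>t. l * u (\<rho> * sin (\<theta> t))) has_real_derivative fst (D t)) (at t)"
      by (rule has_field_derivative_transform_within_open[OF D1 op]) (use \<theta> in \<open>auto simp: c_def\<close>)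
    have D2': "((\<lambda>t. \<mu> * (\<rho> * cos (\<theta> t))) has_real_derivative snd (D t)) (at t)"
      by (rule has_field_derivative_transform_within_open[OF D2 op]) (use \<theta> in \<open>auto simp: c_def\<close>)
    have \<theta>t: "isCont \<theta> t"
      using continuous_on_interior[OF \<theta>cont, of t] t by simp
    have c1: "((\<lambda>x. l * u (\<rho> * sin x)) has_real_derivative l * (u' (\<rho> * sin x) * (\<rho> * cos x))) (at x)" for x
      by (rule DERIV_cmult[OF u_comp])
    have c2: "((\<lambda>x. \<mu> * (\<rho> * cos x)) has_real_derivative - (\<mu> * (\<rho> * sin x))) (at x)" for x
      by (auto intro!: derivative_eq_intros)
    \<comment> \<open>one of the two components of the curve has nonzero derivative and determines the angle\<close>
    obtain d where d: "(\<theta> has_real_derivative d) (at t)"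
    proof (cases "cos (\<theta> t) = 0")
      case True
      then have "sin (\<theta> t) \<noteq> 0" using sin_cos_squared_add[of "\<theta> t"] by auto
      then show ?thesis
        using that differentiable_through_chart[OF c2 _ \<theta>t D2'] pos by auto
    next
      case False
      then show ?thesis
        using that differentiable_through_chart[OF c1 _ \<theta>t D1'] pos u'_pos
        by (metis less_numeral_extra(3) mult_eq_0_iff)
    qed
    have "fst (D t) = l * (u' (\<rho> * sin (\<theta> t)) * (\<rho> * cos (\<theta> t))) * d"
      using DERIV_chain2[OF c1 d] D1' DERIV_unique by blast
    moreover have "snd (\<gamma> t) = \<mu> * (\<rho> * cos (\<theta> t))" using \<theta> t by (simp add: c_def)
    ultimately show "((\<lambda>t. K (\<theta> t)) has_vector_derivative
        snd (\<gamma> t) * fst (vector_derivative \<gamma> (at t within {0..1}))) (at t)"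
      using DERIV_chain2[OF K d] vd
      by (simp add: has_real_derivative_iff_has_vector_derivative[symmetric] mult_ac)
  qed simp
  then have "integral {0..1} (\<lambda>t. snd (\<gamma> t) * fst (vector_derivative \<gamma> (at t within {0..1}))) =
      K (\<theta> 1) - K (\<theta> 0)" by (rule integral_unique)
  moreover have "\<bar>K (\<theta> 1) - K (\<theta> 0)\<bar> = 2 * pi * (l * \<mu> * reduced_action (\<rho>\<^sup>2))"
  proof -
    have "reduced_action (\<rho>\<^sup>2) \<ge> 0" using energy_of_action by (metis zero_le_power2)
    then have nn: "2 * pi * (l * \<mu> * reduced_action (\<rho>\<^sup>2)) \<ge> 0" using pos by simp
    have "\<theta> 1 = \<theta> 0 + 2 * pi \<or> \<theta> 0 = \<theta> 1 + 2 * pi" using turn by linarith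
    then show ?thesis using Kper[of "\<theta> 0"] Kper[of "\<theta> 1"] nn by auto
  qed
  ultimately show ?thesis by simp
qed

lemma level_curve_traversal_exists:
  assumes pos: "\<rho> > 0" "l > 0" "\<mu> > 0"
  obtains \<gamma> where "traverses_once \<gamma> (range (\<lambda>\<theta>. (l * u (\<rho> * sin \<theta>), \<mu> * (\<rho> * cos \<theta>))))"
proof -
  define c where "c \<theta> = (l * u (\<rho> * sin \<theta>), \<mu> * (\<rho> * cos \<theta>))" for \<theta>
  define \<gamma> where "\<gamma> t = c (2 * pi * t)" for t
  define D where "D t = (l * (u' (\<rho> * sin (2 * pi * t)) * (\<rho> * (cos (2 * pi * t) * (2 * pi)))),
      \<mu> * (\<rho> * (- sin (2 * pi * t) * (2 * pi))))" for t
  have "(\<gamma> has_vector_derivative D t) (at t)" for t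
    unfolding \<gamma>_def[abs_def] c_def D_def
  proof (rule has_vector_derivative_Pair)
    show "((\<lambda>t. l * u (\<rho> * sin (2 * pi * t))) has_vector_derivative
        l * (u' (\<rho> * sin (2 * pi * t)) * (\<rho> * (cos (2 * pi * t) * (2 * pi))))) (at t)"
      unfolding has_real_derivative_iff_has_vector_derivative[symmetric]
      by (intro DERIV_cmult DERIV_chain2[OF u_deriv]) (auto intro!: derivative_eq_intros)
    show "((\<lambda>t. \<mu> * (\<rho> * cos (2 * pi * t))) has_vector_derivative
        \<mu> * (\<rho> * (- sin (2 * pi * t) * (2 * pi)))) (at t)"
      unfolding has_real_derivative_iff_has_vector_derivative[symmetric]
      by (auto intro!: derivative_eq_intros)
  qed
  moreover have "continuous_on {0..1} D"
    unfolding D_def[abs_def]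
    by (intro continuous_intros continuous_on_compose2[OF u'_continuous[of UNIV]]) auto
  ultimately have "\<gamma> C1_differentiable_on {0..1}"
    unfolding C1_differentiable_on_def by blast
  then have C1: "\<gamma> piecewise_C1_differentiable_on {0..1}" by (rule C1_differentiable_imp_piecewise)
  have "path \<gamma>" using C1 by (simp add: piecewise_C1_differentiable_on_def path_def)
  moreover have "loop_free \<gamma>"
    unfolding loop_free_def
  proof (intro ballI impI)
    fix x y :: real assume xy: "x \<in> {0..1}" "y \<in> {0..1}" "\<gamma> x = \<gamma> y"
    have "sin (2 * pi * x) = sin (2 * pi * y) \<and> cos (2 * pi * x) = cos (2 * pi * y)"
      using xy(3) pos by (auto simp: c_def \<gamma>_def u_eq_iff)
    then obtain n :: int where "2 * pi * x = 2 * pi * y + 2 * pi * n" using sin_cos_eq_iff by blast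
    then have "2 * pi * x = 2 * pi * (y + n)" by (simp add: algebra_simps)
    then have n: "x = y + n" by simp
    then have "n = 0 \<or> n = 1 \<or> n = -1" using xy by simp linarith
    then show "x = y \<or> x = 0 \<and> y = 1 \<or> x = 1 \<and> y = 0" using n xy by auto
  qed
  moreover have "range c \<subseteq> \<gamma> ` {0..1}"
  proof
    fix z assume "z \<in> range c"
    then obtain a where a: "z = c a" by blast
    obtain t where t: "0 \<le> t" "t < 2 * pi" "cos a = cos t" "sin a = sin t"
      using sincos_total_2pi[of "cos a" "sin a"] by auto
    have "z = \<gamma> (t / (2 * pi))" using t by (simp add: a \<gamma>_def c_def)
    then show "z \<in> \<gamma> ` {0..1}" using t by (auto intro!: imageI)
  qed
  then have "path_image \<gamma> = range c" by (auto simp: path_image_def \<gamma>_def)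
  moreover have "pathfinish \<gamma> = pathstart \<gamma>"
    by (simp add: pathfinish_def pathstart_def \<gamma>_def c_def)
  ultimately have "traverses_once \<gamma> (range c)"
    using C1 by (simp add: traverses_once_def simple_path_def)
  then show ?thesis using that by (simp add: c_def[abs_def])
qed

end

section \<open>The action of the thermostat\<close>

definition nose_oscillator :: "real \<Rightarrow> real \<Rightarrow> real \<Rightarrow> real \<times> real \<Rightarrow> real" where
  "nose_oscillator R c M = (\<lambda>(s, ps). R / (2 * s\<^sup>2) + ps\<^sup>2 / (2 * M) + c * ln s)"

text \<open>The energy above the minimum of \<open>nose_oscillator R c M\<close>, divided by \<open>c\<close>.\<close>

definition excess_energy :: "real \<Rightarrow> real \<Rightarrow> real \<Rightarrow> real \<times> real \<Rightarrow> real" where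
  "excess_energy R c M w = (nose_oscillator R c M w - c / 2 * (ln R - ln c)) / c - 1/2"

text \<open>In the units \<open>sqrt (R/c)\<close> for \<open>s\<close> and \<open>sqrt (2 M c)\<close> for its momentum, the oscillator becomes the
  normalised one, up to the factor \<open>c\<close> and an additive constant that depends on \<open>R\<close>.\<close>

lemma nose_oscillator_scaling:
  assumes "R > 0" "c > 0" "M > 0" "v > 0"
  shows "nose_oscillator R c M (sqrt (R / c) * v, sqrt (2 * M * c) * y) =
    c * (shape v + y\<^sup>2) + c / 2 * (ln R - ln c)"
proof -
  have "ln (sqrt (R / c) * v) = (ln R - ln c) / 2 + ln v"
    using assms by (simp add: ln_mult ln_sqrt ln_div)
  moreover have "R / (2 * (sqrt (R / c) * v)\<^sup>2) = c * (1 / (2 * v\<^sup>2))"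
    using assms by (simp add: power_mult_distrib field_simps)
  moreover have "(sqrt (2 * M * c) * y)\<^sup>2 / (2 * M) = c * y\<^sup>2"
    using assms by (simp add: power_mult_distrib field_simps)
  ultimately show ?thesis
    unfolding nose_oscillator_def shape_def split by (simp only:) (simp add: algebra_simps)
qed

context turning_points
begin

lemma level_curve_parametrization:
  assumes "R > 0" "c > 0" "M > 0" "fst w > 0"
  shows "excess_energy R c M w \<ge> 0"
    and "{z. fst z > 0 \<and> nose_oscillator R c M z = nose_oscillator R c M w} =
      range (\<lambda>\<theta>. (sqrt (R / c) * u (sqrt (excess_energy R c M w) * sin \<theta>),
        sqrt (2 * M * c) * (sqrt (excess_energy R c M w) * cos \<theta>)))"
proof -
  define l where "l = sqrt (R / c)"
  define \<mu> where "\<mu> = sqrt (2 * M * c)"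
  define x where "x = excess_energy R c M w"
  have pos: "l > 0" "\<mu> > 0" using assms by (auto simp: l_def \<mu>_def)
  have u_pos: "u \<xi> > 0" for \<xi> using turning_pos by (simp add: u_def)
  have shape_u: "shape (u \<xi>) = 1/2 + \<xi>\<^sup>2" for \<xi> using turning_shape by (simp add: u_def)
  have F: "nose_oscillator R c M (l * u \<xi>, \<mu> * y) = c * (1/2 + \<xi>\<^sup>2 + y\<^sup>2) + c / 2 * (ln R - ln c)" for \<xi> y
    using nose_oscillator_scaling[OF assms(1-3) u_pos, of \<xi> y] shape_u by (simp add: l_def \<mu>_def)
  have coords: "\<exists>\<xi> y. z = (l * u \<xi>, \<mu> * y)" if "fst z > 0" for z
  proof -
    have "fst z / l > 0" using that pos by simp
    then obtain \<xi> where "u \<xi> = fst z / l" using u_surj by blast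
    then show ?thesis
      using pos by (intro exI[of _ \<xi>] exI[of _ "snd z / \<mu>"]) (auto simp: prod_eq_iff)
  qed
  obtain \<xi>0 y0 where "w = (l * u \<xi>0, \<mu> * y0)" using coords assms(4) by blast
  then have "x = \<xi>0\<^sup>2 + y0\<^sup>2"
    unfolding x_def excess_energy_def using F[of \<xi>0 y0] assms(2) by (simp add: field_simps)
  then show x: "excess_energy R c M w \<ge> 0" by (simp add: x_def)
  have w: "nose_oscillator R c M w = c * (1/2 + x) + c / 2 * (ln R - ln c)"
    unfolding x_def excess_energy_def using assms(2) by (simp add: field_simps)
  have iff: "nose_oscillator R c M (l * u \<xi>, \<mu> * y) = nose_oscillator R c M w \<longleftrightarrow> \<xi>\<^sup>2 + y\<^sup>2 = x" for \<xi> y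
    unfolding F w using assms(2) by (auto simp: add.assoc)
  have x0: "x \<ge> 0" using x by (simp add: x_def)
  have circle: "\<exists>\<theta>. \<xi> = sqrt x * sin \<theta> \<and> y = sqrt x * cos \<theta>" if "\<xi>\<^sup>2 + y\<^sup>2 = x" for \<xi> y
  proof (cases "x = 0")
    case True
    then show ?thesis using that by (auto simp: sum_power2_eq_zero_iff)
  next
    case False
    then have "sqrt x > 0" using x0 by simp
    have "(y / sqrt x)\<^sup>2 + (\<xi> / sqrt x)\<^sup>2 = 1"
      using that x0 False by (simp add: power_divide add_divide_distrib[symmetric] add.commute)
    then obtain \<theta> where "y / sqrt x = cos \<theta>" "\<xi> / sqrt x = sin \<theta>"
      using sincos_total_2pi by metis
    then have "\<xi> = sqrt x * sin \<theta> \<and> y = sqrt x * cos \<theta>"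
      using \<open>sqrt x > 0\<close> by (simp add: field_simps)
    then show ?thesis ..
  qed
  have on_circle: "(sqrt x * sin \<theta>)\<^sup>2 + (sqrt x * cos \<theta>)\<^sup>2 = x" for \<theta>
    using x0 by (simp add: power_mult_distrib distrib_left[symmetric])
  have "{z. fst z > 0 \<and> nose_oscillator R c M z = nose_oscillator R c M w} =
      range (\<lambda>\<theta>. (l * u (sqrt x * sin \<theta>), \<mu> * (sqrt x * cos \<theta>)))" (is "?L = ?R")
  proof (intro equalityI subsetI)
    fix z assume z: "z \<in> ?L"
    then obtain \<xi> y where \<xi>y: "z = (l * u \<xi>, \<mu> * y)" using coords by blast
    then have "\<xi>\<^sup>2 + y\<^sup>2 = x" using z iff by blast
    then obtain \<theta> where "\<xi> = sqrt x * sin \<theta>" "y = sqrt x * cos \<theta>" using circle by blast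
    then show "z \<in> ?R" using \<xi>y by blast
  next
    fix z assume "z \<in> ?R"
    then obtain \<theta> where \<theta>: "z = (l * u (sqrt x * sin \<theta>), \<mu> * (sqrt x * cos \<theta>))" by blast
    then have "nose_oscillator R c M z = nose_oscillator R c M w" using iff on_circle by blast
    moreover have "fst z > 0" using \<theta> pos u_pos by simp
    ultimately show "z \<in> ?L" by blast
  qed
  then show "{z. fst z > 0 \<and> nose_oscillator R c M z = nose_oscillator R c M w} =
      range (\<lambda>\<theta>. (sqrt (R / c) * u (sqrt (excess_energy R c M w) * sin \<theta>),
        sqrt (2 * M * c) * (sqrt (excess_energy R c M w) * cos \<theta>)))"
    by (simp add: l_def \<mu>_def x_def)
qed

text \<open>The unit of action is the product \<open>sqrt (R/c) sqrt (2 M c) = sqrt (2 M R)\<close> of the two scaling factors.\<close>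

lemma level_curve_action_nose_oscillator:
  assumes "R > 0" "c > 0" "M > 0" "fst w > 0"
  shows "level_curve_action (nose_oscillator R c M) w = sqrt (2 * M * R) * reduced_action (excess_energy R c M w)"
proof -
  define l where "l = sqrt (R / c)"
  define \<mu> where "\<mu> = sqrt (2 * M * c)"
  define x where "x = excess_energy R c M w"
  have pos: "l > 0" "\<mu> > 0" using assms by (auto simp: l_def \<mu>_def)
  have l\<mu>: "l * \<mu> = sqrt (2 * M * R)"
    using assms by (simp add: l_def \<mu>_def real_sqrt_mult real_sqrt_divide)
  define L where "L = {z. fst z > 0 \<and> nose_oscillator R c M z = nose_oscillator R c M w}"
  note par = level_curve_parametrization[OF assms, folded x_def l_def \<mu>_def L_def]
  define I where "I \<gamma> = \<bar>integral {0..1} (\<lambda>t. snd (\<gamma> t) * fst (vector_derivative \<gamma> (at t within {0..1})))\<bar> / (2 * pi)"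
    for \<gamma> :: "real \<Rightarrow> real \<times> real"
  have "(\<exists>\<gamma>. traverses_once \<gamma> L) \<and> (\<forall>\<gamma>. traverses_once \<gamma> L \<longrightarrow> I \<gamma> = l * \<mu> * reduced_action x)"
  proof (cases "x = 0")
    case True
    have L: "L = {(l * u 0, 0)}" unfolding par(2) True by auto
    \<comment> \<open>at the minimum the level curve is a point of zero momentum, so the integrand vanishes\<close>
    have B0: "reduced_action 0 = 0" by (simp add: reduced_action_def)
    have "traverses_once (\<lambda>t. (l * u 0, 0)) L"
    proof -
      have "(\<lambda>t. (l * u 0, 0 :: real)) piecewise_C1_differentiable_on {0..1}"
        by (intro C1_differentiable_imp_piecewise) simp
      then show ?thesis
        by (simp add: traverses_once_def L pathfinish_def pathstart_def path_image_def)
    qed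
    moreover have "I \<gamma> = l * \<mu> * reduced_action x" if "traverses_once \<gamma> L" for \<gamma>
    proof -
      have *: "snd (\<gamma> t) = 0" if "t \<in> {0..1}" for t
      proof -
        have "\<gamma> ` {0..1} = L"
          using \<open>traverses_once \<gamma> L\<close> by (simp add: traverses_once_def path_image_def)
        then have "\<gamma> t \<in> L" using that by blast
        then show ?thesis using L by simp
      qed
      have "integral {0..1} (\<lambda>t. snd (\<gamma> t) * fst (vector_derivative \<gamma> (at t within {0..1}))) =
          integral {0..1} (\<lambda>t::real. 0)"
        by (intro Henstock_Kurzweil_Integration.integral_cong) (simp add: *)
      then show ?thesis by (simp add: I_def True B0)
    qed
    ultimately show ?thesis by blast
  next
    case False
    then have \<rho>: "sqrt x > 0" "(sqrt x)\<^sup>2 = x" using par(1) by auto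
    have "I \<gamma> = l * \<mu> * reduced_action x" if "traverses_once \<gamma> L" for \<gamma>
      using level_curve_line_integral[OF \<rho>(1) pos that[unfolded par(2)]] \<rho>(2) by (simp add: I_def)
    moreover have "\<exists>\<gamma>. traverses_once \<gamma> L"
      using level_curve_traversal_exists[OF \<rho>(1) pos] par(2) by metis
    ultimately show ?thesis by blast
  qed
  then have "(THE A. \<exists>\<gamma>. traverses_once \<gamma> L \<and> A = I \<gamma>) = l * \<mu> * reduced_action x"
    by (intro the_equality) auto
  then show ?thesis
    unfolding level_curve_action_def L_def I_def l\<mu> x_def .
qed

end

lemma nose_oscillator_eq:
  assumes "c > 0"
  shows "nose_oscillator R c M w = c * (1/2 + excess_energy R c M w) + c / 2 * (ln R - ln c)"
  unfolding excess_energy_def using assms by (simp add: field_simps)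

section \<open>Non-degeneracy of a function in terms of its second derivative\<close>

lemma det_nonzero_if_injective:
  fixes A :: "real^'m::finite^'m"
  assumes "\<And>x. A *v x = 0 \<Longrightarrow> x = 0"
  shows "det A \<noteq> 0"
  using assms matrix_left_invertible_ker[of A] invertible_left_inverse[of A] invertible_det_nz[of A]
  by blast

text \<open>A kernel vector of the bordered matrix is a solution \<open>(x, t)\<close> of the Lagrange multiplier system
  \<open>D x + t w = 0\<close>, \<open>w \<bullet> x = 0\<close>.\<close>

lemma bordered_matrix_nonsingular:
  fixes D :: "real^'m::finite^'m"
  assumes "\<And>x t. D *v x + t *\<^sub>R w = 0 \<Longrightarrow> w \<bullet> x = 0 \<Longrightarrow> x = 0 \<and> t = 0"
  shows "det (bordered_matrix D w) \<noteq> 0"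
proof (rule det_nonzero_if_injective)
  fix z :: "real^'m option" assume z: "bordered_matrix D w *v z = 0"
  define x where "x = (\<chi> i. z $ Some i)"
  have sum: "(\<Sum>j\<in>UNIV. f j) = f None + (\<Sum>j\<in>UNIV. f (Some j))" for f :: "'m option \<Rightarrow> real"
    unfolding UNIV_option_conv by (subst sum.insert) (auto simp: sum.reindex)
  have "(D *v x + (z $ None) *\<^sub>R w) $ i = (bordered_matrix D w *v z) $ Some i" for i
    by (simp add: matrix_vector_mult_def sum bordered_matrix_def x_def)
  then have "D *v x + (z $ None) *\<^sub>R w = 0" using z by (simp add: vec_eq_iff)
  moreover have "w \<bullet> x = (bordered_matrix D w *v z) $ None"
    by (simp add: matrix_vector_mult_def sum bordered_matrix_def x_def inner_vec_def)
  ultimately have "x = 0 \<and> z $ None = 0" using assms z by simp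
  then show "z = 0" by (simp add: vec_eq_iff x_def split_option_all)
qed

lemma jacobian_frequency:
  fixes h :: "real^'m::finite \<Rightarrow> real"
  assumes "smooth_on W h" "x \<in> W"
  shows "(frequency h has_derivative
      (\<lambda>v. \<chi> i. frechet_derivative (partial_deriv i h) (at x) v)) (at x)"
    and "jacobian (frequency h) (at x) $ i $ j = frechet_derivative (partial_deriv i h) (at x) (axis j 1)"
proof -
  have "smooth_on W (partial_deriv i h)" for i
    using smooth_on_frechet_derivative[OF assms(1)] by (simp add: partial_deriv_def[abs_def])
  then have d: "(partial_deriv i h has_derivative frechet_derivative (partial_deriv i h) (at x)) (at x)" for i
    using smooth_on_imp_differentiable assms(2) frechet_derivative_works by blast
  show D: "(frequency h has_derivative
      (\<lambda>v. \<chi> i. frechet_derivative (partial_deriv i h) (at x) v)) (at x)"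
    unfolding has_derivative_componentwise_within[of "frequency h"]
    using d by (auto simp: Basis_vec_def frequency_def inner_axis)
  show "jacobian (frequency h) (at x) $ i $ j = frechet_derivative (partial_deriv i h) (at x) (axis j 1)"
    unfolding jacobian_def frechet_derivative_at[OF D, symmetric] by (simp add: matrix_def)
qed

lemma continuous_on_det_entries:
  fixes A :: "'a::topological_space \<Rightarrow> real^'m::finite^'m"
  assumes "\<And>i j. continuous_on S (\<lambda>x. A x $ i $ j)"
  shows "continuous_on S (\<lambda>x. det (A x))"
  unfolding det_def by (intro continuous_intros assms)

text \<open>Both determinants are continuous in the actions. Hence non-degeneracy at zero action extends to a
  neighbourhood, and it suffices to compute Hessians at zero action.\<close>

lemma open_nondegenerate:
  fixes h :: "real^'m::finite \<Rightarrow> real"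
  assumes "open W" "smooth_on W h"
  shows "open {x \<in> W. kolmogorov_nondegenerate h x \<and> isoenergetically_nondegenerate h x}"
proof -
  have pd: "smooth_on W (partial_deriv i h)" for i
    using smooth_on_frechet_derivative[OF assms(2)] by (simp add: partial_deriv_def[abs_def])
  have J: "continuous_on W (\<lambda>x. jacobian (frequency h) (at x) $ i $ j)" for i j
  proof -
    have "continuous_on W (\<lambda>x. frechet_derivative (partial_deriv i h) (at x) (axis j 1))"
      using smooth_on_frechet_derivative[OF pd] by (rule smooth_on_imp_continuous_on)
    then show ?thesis
      by (rule continuous_on_eq) (simp add: jacobian_frequency(2)[OF assms(2)])
  qed
  have F: "continuous_on W (\<lambda>x. frequency h x $ i)" for i
    using smooth_on_imp_continuous_on[OF pd] by (simp add: frequency_def)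
  have 1: "continuous_on W (\<lambda>x. det (jacobian (frequency h) (at x)))"
    by (intro continuous_on_det_entries J)
  have 2: "continuous_on W (\<lambda>x. det (bordered_matrix (jacobian (frequency h) (at x)) (frequency h x)))"
  proof (rule continuous_on_det_entries)
    fix i j :: "'m option"
    show "continuous_on W (\<lambda>x. bordered_matrix (jacobian (frequency h) (at x)) (frequency h x) $ i $ j)"
      by (cases i; cases j) (simp_all add: bordered_matrix_def J F)
  qed
  have "open (W \<inter> (\<lambda>x. det (jacobian (frequency h) (at x))) -` (- {0}))"
    by (rule continuous_open_preimage[OF 1 assms(1)]) (rule open_Compl, simp)
  moreover have "open (W \<inter> (\<lambda>x. det (bordered_matrix (jacobian (frequency h) (at x))
      (frequency h x))) -` (- {0}))"
    by (rule continuous_open_preimage[OF 2 assms(1)]) (rule open_Compl, simp)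
  ultimately have "open ((W \<inter> (\<lambda>x. det (jacobian (frequency h) (at x))) -` (- {0})) \<inter>
      (W \<inter> (\<lambda>x. det (bordered_matrix (jacobian (frequency h) (at x)) (frequency h x))) -` (- {0})))"
    by (rule open_Int)
  then show ?thesis
    by (rule back_subst[where P = "open"])
       (auto simp: kolmogorov_nondegenerate_def isoenergetically_nondegenerate_def)
qed

section \<open>The Hamiltonian in action variables\<close>

text \<open>Here \<open>a\<close> is the action \<open>A\<close> as a coordinate, \<open>b\<close> is the inner product of momenta extended by zero to
  the \<open>A\<close>-axis spanned by \<open>v0\<close>, and \<open>E\<close> is the energy of the normalised
  oscillator above its minimum, as a function of its action. The Hamiltonian is
  \<open>c (1/2 + E(A / sqrt (2 M R)) + (ln R - ln c)/2)\<close> with \<open>R = b(p, p)\<close>.\<close>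

locale action_hamiltonian =
  fixes a :: "real^'m::finite \<Rightarrow> real" and b :: "real^'m \<Rightarrow> real^'m \<Rightarrow> real"
    and v0 :: "real^'m" and E E1 :: "real \<Rightarrow> real" and K :: "real set" and c M :: real
  assumes a_linear: "bounded_linear a" and b_bilinear: "bounded_bilinear b"
    and b_sym: "b x y = b y x"
    and a_v0: "a v0 = 1" and b_v0: "b v0 y = 0"
    and definite: "a y = 0 \<Longrightarrow> b y y = 0 \<Longrightarrow> y = 0"
    and open_K: "open K" and zero_K: "0 \<in> K" and E_smooth: "smooth_on K E"
    and E_deriv: "\<And>\<beta>. \<beta> \<in> K \<Longrightarrow> (E has_real_derivative E1 \<beta>) (at \<beta>)"
    and E1_0: "E1 0 = 2" and E1_deriv: "(E1 has_real_derivative -11/3) (at 0)"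
    and c_pos: "c > 0" and M_pos: "M > 0"
begin

definition scale :: "real^'m \<Rightarrow> real" where "scale x = inverse (sqrt (2 * M * b x x))"

definition W :: "(real^'m) set" where "W = {x. b x x > 0 \<and> a x * scale x \<in> K}"

definition h :: "real^'m \<Rightarrow> real" where
  "h x = c * (1/2 + E (a x * scale x)) + c / 2 * (ln (b x x) - ln c)"

text \<open>The derivative of \<open>h\<close> at \<open>x\<close> in the direction \<open>v\<close>. The factor \<open>a x\<close> is kept apart, so that in the
  second derivative at \<open>a x = 0\<close> only the derivative of that factor survives.\<close>

definition Dh :: "real^'m \<Rightarrow> real^'m \<Rightarrow> real" where
  "Dh x v = c * (E1 (a x * scale x) * (a v * scale x - a x * (scale x * (b x v * inverse (b x x))))
     + b x v * inverse (b x x))"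

lemma square_deriv: "((\<lambda>x. b x x) has_derivative (\<lambda>v. 2 * b x v)) (at x)"
  using bounded_bilinear.FDERIV[OF b_bilinear has_derivative_ident has_derivative_ident, of x UNIV]
  by (simp add: b_sym[of _ x])

lemma a_deriv: "(a has_derivative a) (at x)"
  by (rule bounded_linear_imp_has_derivative[OF a_linear])

lemma b_deriv: "((\<lambda>x. b x v) has_derivative (\<lambda>w. b w v)) (at x)"
  by (rule bounded_linear_imp_has_derivative[OF bounded_bilinear.bounded_linear_left[OF b_bilinear]])

lemma scale_deriv:
  assumes "b x x > 0"
  shows "(scale has_derivative (\<lambda>v. - (scale x * (b x v * inverse (b x x))))) (at x)"
proof -
  have "((\<lambda>r. inverse (sqrt (2 * M * r))) has_real_derivative
      - (inverse (sqrt (2 * M * r)) * inverse (2 * r))) (at r)" if "r > 0" for r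
    using that M_pos by (auto intro!: derivative_eq_intros simp: field_simps mult_less_0_iff)
  from DERIV_compose_FDERIV[OF this[OF assms] square_deriv]
  show ?thesis
    unfolding scale_def[abs_def]
    by (rule has_derivative_eq_rhs) (auto simp: fun_eq_iff field_simps)
qed

lemma open_W: "open W"
proof -
  have "continuous_on A (\<lambda>x. b x x)" for A
    using square_deriv by (meson continuous_at_imp_continuous_on has_derivative_continuous)
  then have op: "open {x. b x x > 0}" by (intro open_Collect_less continuous_intros)
  have "continuous_on {x. b x x > 0} (\<lambda>x. a x * scale x)"
    using scale_deriv a_deriv
    by (intro continuous_intros) (auto intro!: continuous_at_imp_continuous_on has_derivative_continuous)
  from continuous_open_preimage[OF this op open_K] show ?thesis
    by (rule back_subst[where P = "open"]) (auto simp: W_def)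
qed

lemma smooth_h: "smooth_on W h"
proof -
  have sq: "smooth_on W (\<lambda>x. b x x)"
    unfolding smooth_on_def
  proof
    fix k
    have "Ck_on (Suc k) W (\<lambda>x. b x x)"
      by (rule Ck_on_SucI[OF open_W square_deriv])
         (intro Ck_on_cmult Ck_on_bounded_linear open_W
            bounded_bilinear.bounded_linear_left[OF b_bilinear])
    then show "Ck_on k W (\<lambda>x. b x x)" by (rule Ck_on_SucD)
  qed
  have "smooth_on W (\<lambda>x. 2 * M * b x x)"
    by (intro smooth_on_intros(4)[OF open_W smooth_on_intros(1)[OF open_W]] sq)
  then have "smooth_on W (\<lambda>x. sqrt (2 * M * b x x))"
    by (rule smooth_on_compose_real[OF open_W smooth_on_sqrt]) (use M_pos in \<open>auto simp: W_def\<close>)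
  then have "smooth_on W scale"
    unfolding scale_def[abs_def]
    by (intro smooth_on_compose_real[OF open_W smooth_on_inverse])
       (use M_pos in \<open>auto simp: W_def\<close>)
  then have "smooth_on W (\<lambda>x. a x * scale x)"
    by (rule smooth_on_intros(4)[OF open_W smooth_on_intros(5)[OF open_W a_linear]])
  then have "smooth_on W (\<lambda>x. E (a x * scale x))"
    by (intro smooth_on_compose_real[OF open_W E_smooth]) (auto simp: W_def)
  moreover have "smooth_on W (\<lambda>x. ln (b x x))"
    by (rule smooth_on_compose_real[OF open_W smooth_on_ln sq]) (auto simp: W_def)
  ultimately show ?thesis
    unfolding h_def[abs_def] by (intro smooth_on_intros(1-4) open_W)
qed

lemma h_deriv:
  assumes "x \<in> W"
  shows "(h has_derivative Dh x) (at x)"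
proof -
  have pos: "b x x > 0" and K: "a x * scale x \<in> K" using assms by (auto simp: W_def)
  note d\<beta> = has_derivative_mult[OF a_deriv scale_deriv[OF pos]]
  note dE = DERIV_compose_FDERIV[OF E_deriv[OF K] d\<beta>]
  note dln = DERIV_compose_FDERIV[OF DERIV_ln[OF pos] square_deriv]
  have "((\<lambda>x. c * (1/2 + E (a x * scale x)) + c / 2 * (ln (b x x) - ln c)) has_derivative Dh x) (at x)"
    by (rule has_derivative_eq_rhs, rule has_derivative_add)
       (rule has_derivative_mult_right has_derivative_add has_derivative_const dE
          has_derivative_diff dln | auto simp: Dh_def fun_eq_iff field_simps)+
  then show ?thesis by (simp add: h_def[abs_def])
qed

lemma Dh_deriv_at_zero_action:
  assumes "b x x > 0" "a x = 0"
  shows "((\<lambda>x. Dh x v) has_derivative (\<lambda>w. c * (-11/3 * (scale x)\<^sup>2 * a v * a w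
     - 2 * scale x * (a v * b x w + a w * b x v) / b x x
     + b v w / b x x - 2 * b x v * b x w / (b x x)\<^sup>2))) (at x)"
proof -
  define R where "R = b x x"
  have R: "R > 0" using assms by (simp add: R_def)
  have Einner: "(E1 has_real_derivative -11/3) (at (a x * scale x))" using E1_deriv assms by simp
  note dscale = scale_deriv[OF assms(1), folded R_def]
  note dE1 = DERIV_compose_FDERIV[OF Einner has_derivative_mult[OF a_deriv dscale]]
  have "b x x \<noteq> 0" using assms by simp
  note dinv = DERIV_compose_FDERIV[OF DERIV_inverse[OF this] square_deriv, folded R_def]
  note dq = has_derivative_mult[OF b_deriv[of v] dinv]
  note dg = has_derivative_diff[OF has_derivative_mult[OF has_derivative_const[of "a v"] dscale]
      has_derivative_mult[OF a_deriv has_derivative_mult[OF dscale dq]]]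
  note dall = has_derivative_mult_right[OF has_derivative_add[OF has_derivative_mult[OF dE1 dg] dq], of c]
  show ?thesis
    unfolding Dh_def
    by (rule has_derivative_eq_rhs[OF dall])
       (use R in \<open>auto simp: fun_eq_iff assms(2) E1_0 R_def[symmetric] b_sym[of _ v] field_simps power2_eq_square\<close>)
qed

lemma
  assumes "x \<in> W" "a x = 0"
  shows hessian_at_zero_action: "frechet_derivative (partial_deriv i h) (at x) w =
      c * (-11/3 * (scale x)\<^sup>2 * a (axis i 1) * a w
     - 2 * scale x * (a (axis i 1) * b x w + a w * b x (axis i 1)) / b x x
     + b (axis i 1) w / b x x - 2 * b x (axis i 1) * b x w / (b x x)\<^sup>2)"
    and frequency_at_zero_action: "frequency h x $ i =
      c * (2 * scale x * a (axis i 1) + b x (axis i 1) / b x x)"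
proof -
  have pd: "partial_deriv i h y = Dh y (axis i 1)" if "y \<in> W" for y
    using frechet_derivative_at[OF h_deriv[OF that]] by (simp add: partial_deriv_def)
  have pos: "b x x > 0" using assms by (simp add: W_def)
  have D: "(partial_deriv i h has_derivative (\<lambda>w. c * (-11/3 * (scale x)\<^sup>2 * a (axis i 1) * a w
     - 2 * scale x * (a (axis i 1) * b x w + a w * b x (axis i 1)) / b x x
     + b (axis i 1) w / b x x - 2 * b x (axis i 1) * b x w / (b x x)\<^sup>2))) (at x)"
    by (rule has_derivative_transform_within_open[OF
          Dh_deriv_at_zero_action[OF pos assms(2), of "axis i 1"] open_W assms(1)])
       (simp add: pd)
  show "frechet_derivative (partial_deriv i h) (at x) w =
      c * (-11/3 * (scale x)\<^sup>2 * a (axis i 1) * a w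
     - 2 * scale x * (a (axis i 1) * b x w + a w * b x (axis i 1)) / b x x
     + b (axis i 1) w / b x x - 2 * b x (axis i 1) * b x w / (b x x)\<^sup>2)"
    unfolding frechet_derivative_at[OF D, symmetric] ..
  show "frequency h x $ i = c * (2 * scale x * a (axis i 1) + b x (axis i 1) / b x x)"
    using pd[OF assms(1)] assms(2) by (simp add: frequency_def Dh_def E1_0 field_simps)
qed

lemma linear_eq_0_on_axes:
  fixes f :: "real^'m \<Rightarrow> real"
  assumes "linear f" "\<And>i. f (axis i 1) = 0"
  shows "f v = 0"
proof -
  have "f = (\<lambda>_. 0)"
    by (rule linear_eq_stdbasis[OF assms(1)]) (auto simp: Basis_vec_def assms(2) linear_zero)
  then show ?thesis by simp
qed

text \<open>The case \<open>t = 0\<close> says that the Hessian has no kernel, the other case that the bordered Hessian has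
  none. Let \<open>\<kappa> = 1/sqrt (2 M R)\<close>, \<open>\<alpha> = \<kappa> a(w)\<close> and \<open>\<lambda> = b(x, w)/R\<close>. Testing the equation against the
  \<open>A\<close>-axis and against \<open>x\<close> itself gives \<open>E'' \<alpha> - E' \<lambda> + E' t = 0\<close> and \<open>- E' \<alpha> - \<lambda> + t = 0\<close>. In the second
  case \<open>E' \<alpha> + \<lambda> = 0\<close>, which forces \<open>t = 0\<close>. So in both cases \<open>\<lambda> = - E' \<alpha>\<close> and
  \<open>(E'' + E'\<^sup>2) \<alpha> = 0\<close>. As \<open>E'' + E'\<^sup>2 = - 11/3 + 4\<close> is not zero, \<open>\<alpha>\<close> and \<open>\<lambda>\<close> vanish, and testing
  against \<open>w\<close> leaves \<open>b(w, w) = 0\<close>.\<close>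

lemma kernel_trivial:
  assumes pos: "b x x > 0" and ax: "a x = 0"
    and eq: "\<And>i. (-11/3 * (scale x)\<^sup>2 * a (axis i 1) * a w
     - 2 * scale x * (a (axis i 1) * b x w + a w * b x (axis i 1)) / b x x
     + b (axis i 1) w / b x x - 2 * b x (axis i 1) * b x w / (b x x)\<^sup>2)
     + t * (2 * scale x * a (axis i 1) + b x (axis i 1) / b x x) = 0"
    and t: "t = 0 \<or> 2 * scale x * a w + b x w / b x x = 0"
  shows "w = 0 \<and> t = 0"
proof -
  define R where "R = b x x"
  define \<kappa> where "\<kappa> = scale x"
  define lw where "lw = b x w / R"
  have R: "R > 0" using pos by (simp add: R_def)
  have \<kappa>: "\<kappa> > 0" using pos M_pos by (simp add: \<kappa>_def scale_def)
  define f where "f v = (-11/3 * \<kappa>\<^sup>2 * a w - 2 * \<kappa> * lw + 2 * t * \<kappa>) * a v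
      + (- 2 * \<kappa> * a w - 2 * lw + t) * inverse R * b x v + inverse R * b w v" for v
  have bl: "linear (b y)" for y
    using bounded_bilinear.bounded_linear_right[OF b_bilinear] bounded_linear.linear by blast
  have "linear f"
    unfolding f_def[abs_def]
    by (rule linearI) (simp_all add: linear_add[OF bl] linear_cmul[OF bl]
        linear_add[OF bounded_linear.linear[OF a_linear]]
        linear_cmul[OF bounded_linear.linear[OF a_linear]] algebra_simps)
  moreover have "f (axis i 1) = 0" for i
  proof -
    have "f (axis i 1) = (-11/3 * \<kappa>\<^sup>2 * a (axis i 1) * a w
      - 2 * \<kappa> * (a (axis i 1) * b x w + a w * b x (axis i 1)) / R
      + b (axis i 1) w / R - 2 * b x (axis i 1) * b x w / R\<^sup>2)
      + t * (2 * \<kappa> * a (axis i 1) + b x (axis i 1) / R)"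
      unfolding f_def lw_def using R by (simp add: b_sym[of w] field_simps power2_eq_square)
    then show ?thesis using eq[of i] by (simp only: R_def \<kappa>_def)
  qed
  ultimately have f0: "f v = 0" for v by (rule linear_eq_0_on_axes)
  have "f v0 = -11/3 * \<kappa>\<^sup>2 * a w - 2 * \<kappa> * lw + 2 * t * \<kappa>"
    by (simp add: f_def a_v0 b_v0 b_sym[of _ v0])
  then have "\<kappa> * (-11/3 * (\<kappa> * a w) - 2 * lw + 2 * t) = 0"
    using f0[of v0] by (simp add: power2_eq_square algebra_simps)
  then have 1: "-11/3 * (\<kappa> * a w) - 2 * lw + 2 * t = 0" using \<kappa> by simp
  have "f x = - 2 * \<kappa> * a w - lw + t"
    using R by (simp add: f_def ax R_def[symmetric] b_sym[of w x] lw_def field_simps)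
  then have 2: "- 2 * (\<kappa> * a w) - lw + t = 0" using f0[of x] by simp
  have 3: "t = 0"
    using t
  proof
    assume "2 * scale x * a w + b x w / b x x = 0"
    then have "2 * (\<kappa> * a w) + lw = 0" by (simp add: \<kappa>_def lw_def R_def)
    then show ?thesis using 2 by linarith
  qed
  then have "\<kappa> * a w = 0" "lw = 0" using 1 2 by linarith+
  then have aw: "a w = 0" using \<kappa> by simp
  have "f w = inverse R * b w w" using aw \<open>lw = 0\<close> 3 by (simp add: f_def)
  then have "b w w = 0" using f0[of w] R by simp
  then show ?thesis using definite aw 3 by blast
qed

lemma nondegenerate_at_zero_action:
  assumes "x \<in> W" "a x = 0"
  shows "kolmogorov_nondegenerate h x" "isoenergetically_nondegenerate h x"
proof -
  have pos: "b x x > 0" using assms by (simp add: W_def)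
  define H where "H i w = -11/3 * (scale x)\<^sup>2 * a (axis i 1) * a w
     - 2 * scale x * (a (axis i 1) * b x w + a w * b x (axis i 1)) / b x x
     + b (axis i 1) w / b x x - 2 * b x (axis i 1) * b x w / (b x x)\<^sup>2" for i w
  define G where "G i = 2 * scale x * a (axis i 1) + b x (axis i 1) / b x x" for i
  have J: "(jacobian (frequency h) (at x) *v w) $ i = c * H i w" for w i
  proof -
    note D = jacobian_frequency(1)[OF smooth_h assms(1)]
    have "(frequency h has_derivative (\<lambda>w. jacobian (frequency h) (at x) *v w)) (at x)"
      using D jacobian_works differentiable_def by blast
    then have "(\<lambda>w. jacobian (frequency h) (at x) *v w) =
        (\<lambda>v. \<chi> i. frechet_derivative (partial_deriv i h) (at x) v)"
      using D has_derivative_unique by blast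
    then have "jacobian (frequency h) (at x) *v w =
        (\<chi> i. frechet_derivative (partial_deriv i h) (at x) w)" by metis
    then show ?thesis by (simp add: hessian_at_zero_action[OF assms] H_def)
  qed
  have F: "frequency h x $ i = c * G i" for i
    by (simp add: frequency_at_zero_action[OF assms] G_def)
  have ker: "w = 0 \<and> t = 0" if "\<And>i. H i w + t * G i = 0" "t = 0 \<or> 2 * scale x * a w + b x w / b x x = 0" for w t
    by (rule kernel_trivial[OF pos assms(2) _ that(2)]) (use that(1) in \<open>simp add: H_def G_def\<close>)
  show "kolmogorov_nondegenerate h x"
    unfolding kolmogorov_nondegenerate_def
  proof (rule det_nonzero_if_injective)
    fix w assume "jacobian (frequency h) (at x) *v w = 0"
    then have "c * H i w = 0" for i using J[of w i] by simp
    then show "w = 0" using ker[of w 0] c_pos by simp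
  qed
  show "isoenergetically_nondegenerate h x"
    unfolding isoenergetically_nondegenerate_def
  proof (rule bordered_matrix_nonsingular)
    fix w t
    assume 1: "jacobian (frequency h) (at x) *v w + t *\<^sub>R frequency h x = 0"
      and 2: "frequency h x \<bullet> w = 0"
    have "c * (H i w + t * G i) = 0" for i
      using J[of w i] F[of i] arg_cong[OF 1, of "\<lambda>v. v $ i"] by (simp add: algebra_simps)
    then have H: "H i w + t * G i = 0" for i using c_pos by simp
    have Dh: "Dh x v = c * (2 * scale x * a v + b x v / b x x)" for v
      using assms(2) by (simp add: Dh_def E1_0 field_simps)
    have "linear (\<lambda>v. frequency h x \<bullet> v - Dh x v)"
      by (intro linear_compose_sub bounded_linear.linear bounded_linear_inner_right
          has_derivative_bounded_linear[OF h_deriv[OF assms(1)]])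
    moreover have "frequency h x \<bullet> axis i 1 - Dh x (axis i 1) = 0" for i
      by (simp add: inner_axis F G_def Dh)
    ultimately have "frequency h x \<bullet> w - Dh x w = 0" by (rule linear_eq_0_on_axes)
    then have "2 * scale x * a w + b x w / b x x = 0" using 2 c_pos by (simp add: Dh)
    then show "w = 0 \<and> t = 0" using ker H by blast
  qed
qed

end

section \<open>Flat coordinates and their conjugate momenta\<close>

lemma matrix_inv_eqI:
  fixes A B :: "real^'n::finite^'n"
  assumes "A ** B = mat 1"
  shows "matrix_inv A = B"
proof -
  have "A ** B = mat 1 \<and> B ** A = mat 1" using assms matrix_left_right_inverse by blast
  then have "A ** matrix_inv A = mat 1 \<and> matrix_inv A ** A = mat 1"
    unfolding matrix_inv_def by (rule someI)
  then have "matrix_inv A ** A = mat 1" ..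
  then have "matrix_inv A = matrix_inv A ** (A ** B)" using assms by (simp add: matrix_mul_rid)
  also have "\<dots> = B" using \<open>matrix_inv A ** A = mat 1\<close> by (simp add: matrix_mul_assoc matrix_mul_lid)
  finally show ?thesis .
qed

lemma dot_matrix_vector_adjoint:
  fixes A :: "real^'n::finite^'m::finite"
  shows "x \<bullet> (A *v y) = (transpose A *v x) \<bullet> y"
  by (simp add: dot_lmul_matrix)

lemma continuous_integer_valued_constant:
  fixes f :: "'a::real_normed_vector \<Rightarrow> real"
  assumes "continuous_on UNIV f" "\<And>x. f x \<in> \<int>"
  shows "f x = f y"
proof -
  have "f constant_on UNIV"
  proof (rule continuous_discrete_range_constant[OF connected_UNIV assms(1)])
    fix x
    have "1 \<le> norm (f y - f x)" if "f y \<noteq> f x" for y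
      using Ints_nonzero_abs_ge1[of "f y - f x"] Ints_diff assms(2) that by simp
    then show "\<exists>e>0. \<forall>y. y \<in> UNIV \<and> f y \<noteq> f x \<longrightarrow> e \<le> norm (f y - f x)"
      by (intro exI[of _ 1]) auto
  qed
  then show ?thesis by (metis constant_on_def UNIV_I)
qed

locale flat_torus =
  fixes g :: "real^'n::finite \<Rightarrow> real^'n^'n" and \<phi> :: "real^'n \<Rightarrow> real^'n"
  assumes metric: "torus_metric g" and coords: "flat_coordinates g \<phi>"
begin

definition J :: "real^'n \<Rightarrow> real^'n^'n" where "J q = jacobian \<phi> (at q)"

definition J_inv :: "real^'n \<Rightarrow> real^'n^'n" where "J_inv q = jacobian (inv \<phi>) (at (\<phi> q))"

lemma phi_deriv: "(\<phi> has_derivative (\<lambda>v. J q *v v)) (at q)"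
  and phi_inv_deriv: "(inv \<phi> has_derivative (\<lambda>v. J_inv q *v v)) (at (\<phi> q))"
  using coords smooth_on_imp_differentiable[of UNIV]
  by (auto simp: flat_coordinates_def J_def J_inv_def jacobian_works[symmetric])

lemma J_inverse: "J_inv q ** J q = mat 1" "J q ** J_inv q = mat 1"
proof -
  have "inj \<phi>" using coords by (simp add: flat_coordinates_def bij_is_inj)
  then have "((\<lambda>x. x) has_derivative (\<lambda>v. J_inv q *v (J q *v v))) (at q)"
    using has_derivative_compose[OF phi_deriv phi_inv_deriv, of q] by simp
  then have "(\<lambda>v. J_inv q *v (J q *v v)) = (\<lambda>v. v)"
    using has_derivative_unique has_derivative_ident by blast
  then have "(J_inv q ** J q) *v v = mat 1 *v v" for v
    by (metis matrix_vector_mul_assoc matrix_vector_mul_lid)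
  then show "J_inv q ** J q = mat 1" by (simp add: matrix_eq)
  then show "J q ** J_inv q = mat 1" by (simp add: matrix_left_right_inverse)
qed

lemma conjugate_momentum_eq: "conjugate_momentum \<phi> q p = transpose (J_inv q) *v p"
proof -
  have "transpose (J q) ** transpose (J_inv q) = mat 1"
    using J_inverse(1)[of q] by (simp add: matrix_transpose_mul[symmetric])
  then show ?thesis
    unfolding conjugate_momentum_def J_def[symmetric] by (simp add: matrix_inv_eqI)
qed

lemma momentum_eq: "p = transpose (J q) *v conjugate_momentum \<phi> q p"
proof -
  have "transpose (J q) ** transpose (J_inv q) = mat 1"
    using J_inverse(1)[of q] by (simp add: matrix_transpose_mul[symmetric])
  then show ?thesis
    unfolding conjugate_momentum_eq by (simp only: matrix_vector_mul_assoc matrix_vector_mul_lid)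
qed

lemma conjugate_momentum_eq_0_iff: "conjugate_momentum \<phi> q p = 0 \<longleftrightarrow> p = 0"
  using momentum_eq[of p q] conjugate_momentum_eq[of q p] by force

text \<open>The inverse Jacobian is the Jacobian of the inverse map, which is visibly continuous.\<close>

lemma continuous_conjugate_momentum:
  "continuous_on UNIV (\<lambda>(q, p). conjugate_momentum \<phi> q p)"
proof -
  have sm: "smooth_on UNIV \<phi>" "smooth_on UNIV (inv \<phi>)"
    using coords by (auto simp: flat_coordinates_def)
  have entry: "continuous_on UNIV (\<lambda>q. J_inv q $ j $ i)" for i j
  proof -
    have "continuous_on UNIV (\<lambda>x. frechet_derivative (inv \<phi>) (at x) (axis i 1))"
      using smooth_on_frechet_derivative[OF sm(2)] by (rule smooth_on_imp_continuous_on)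
    from continuous_on_compose2[OF this smooth_on_imp_continuous_on[OF sm(1)]]
    have "continuous_on UNIV (\<lambda>q. frechet_derivative (inv \<phi>) (at (\<phi> q)) (axis i 1))" by simp
    then show ?thesis
      unfolding J_inv_def jacobian_def matrix_def by (simp add: continuous_intros)
  qed
  have "continuous_on UNIV (\<lambda>z. \<chi> i. \<Sum>j\<in>UNIV. J_inv (fst z) $ j $ i * snd z $ j)"
    by (intro continuous_on_vec_lambda continuous_intros continuous_on_compose2[OF entry]) auto
  moreover have "(\<lambda>(q, p). conjugate_momentum \<phi> q p) =
      (\<lambda>z. \<chi> i. \<Sum>j\<in>UNIV. J_inv (fst z) $ j $ i * snd z $ j)"
    by (auto simp: fun_eq_iff conjugate_momentum_eq matrix_vector_mult_def transpose_def vec_eq_iff)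
  ultimately show ?thesis by simp
qed

text \<open>A lattice translation changes \<open>\<phi>\<close> by a continuous, hence constant, lattice vector.\<close>

lemma conjugate_momentum_periodic:
  assumes "l \<in> int_lattice"
  shows "conjugate_momentum \<phi> (q + l) p = conjugate_momentum \<phi> q p"
proof -
  have cont: "continuous_on UNIV \<phi>"
    using coords smooth_on_imp_continuous_on by (auto simp: flat_coordinates_def)
  define C where "C = \<phi> (q + l) - \<phi> q"
  have "\<phi> (x + l) - \<phi> x = C" for x
  proof -
    have "(\<phi> (x + l) - \<phi> x) $ i = C $ i" for i
      unfolding C_def
    proof (rule continuous_integer_valued_constant[where f = "\<lambda>x. (\<phi> (x + l) - \<phi> x) $ i"])
      show "continuous_on UNIV (\<lambda>x. (\<phi> (x + l) - \<phi> x) $ i)"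
        by (intro continuous_intros continuous_on_compose2[OF cont]) auto
      fix x
      have "(x + l) - x \<in> int_lattice" using assms by simp
      then have "\<phi> (x + l) - \<phi> x \<in> int_lattice"
        using coords unfolding flat_coordinates_def by blast
      then show "(\<phi> (x + l) - \<phi> x) $ i \<in> \<int>" by (simp add: int_lattice_def)
    qed
    then show ?thesis by (simp add: vec_eq_iff)
  qed
  then have shift: "\<phi> (x + l) = \<phi> x + C" for x by (metis diff_add_cancel add.commute)
  have "((\<lambda>x. x + l) has_derivative (\<lambda>v. v)) (at q)" by (auto intro!: derivative_eq_intros)
  from has_derivative_compose[OF this phi_deriv]
  have "((\<lambda>x. \<phi> (x + l)) has_derivative (\<lambda>v. J (q + l) *v v)) (at q)" .
  moreover have "((\<lambda>x. \<phi> (x + l)) has_derivative (\<lambda>v. J q *v v)) (at q)"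
    unfolding shift using has_derivative_add[OF phi_deriv has_derivative_const[of C]] by simp
  ultimately have "(\<lambda>v. J (q + l) *v v) = (\<lambda>v. J q *v v)" by (rule has_derivative_unique)
  then have "J (q + l) = J q" by (metis matrix_eq)
  then show ?thesis by (simp add: conjugate_momentum_def J_def)
qed

text \<open>The coefficient matrix of the metric in flat coordinates inherits symmetry and positivity from the
  metric at one point, and its inverse is the matrix of the cometric at every point.\<close>

lemma constant_cometric:
  obtains Gi :: "real^'n^'n" where
    "\<And>q p. conorm_sq g q p = conjugate_momentum \<phi> q p \<bullet> (Gi *v conjugate_momentum \<phi> q p)"
    "\<And>x y. x \<bullet> (Gi *v y) = y \<bullet> (Gi *v x)" "\<And>x. x \<noteq> 0 \<Longrightarrow> x \<bullet> (Gi *v x) > 0"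
proof -
  obtain G where G: "\<And>q. g q = transpose (J q) ** G ** J q"
    using coords by (auto simp: flat_coordinates_def J_def)
  have g_pos: "v \<bullet> (g q *v v) > 0" if "v \<noteq> 0" for q v
    using metric that by (simp add: torus_metric_def)
  have gv: "v \<bullet> (g q *v w) = (J q *v v) \<bullet> (G *v (J q *v w))" for q v w
    unfolding G by (simp add: matrix_vector_mul_assoc[symmetric] dot_matrix_vector_adjoint transpose_transpose del: transpose_matrix_vector)
  have JJ: "J q *v (J_inv q *v x) = x" for q x
    using J_inverse(2)[of q] by (simp add: matrix_vector_mul_assoc matrix_vector_mul_lid)
  have G_pos: "x \<bullet> (G *v x) > 0" if "x \<noteq> 0" for x
  proof -
    have "J_inv 0 *v x \<noteq> 0" using JJ[of 0 x] that by (metis matrix_vector_mult_0_right)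
    then show ?thesis using g_pos[of "J_inv 0 *v x" 0] by (simp add: gv JJ)
  qed
  have G_sym: "x \<bullet> (G *v y) = y \<bullet> (G *v x)" for x y
  proof -
    have "transpose (g 0) = g 0" using metric by (simp add: torus_metric_def)
    then have "v \<bullet> (g 0 *v w) = w \<bullet> (g 0 *v v)" for v w
      using dot_matrix_vector_adjoint[of v "g 0" w] by (simp add: inner_commute)
    from this[of "J_inv 0 *v x" "J_inv 0 *v y"] show ?thesis by (simp add: gv JJ)
  qed
  have "det G \<noteq> 0"
    by (rule det_nonzero_if_injective) (use G_pos in force)
  then have inv: "invertible G" by (simp add: invertible_det_nz)
  then obtain Gi where GGi: "G ** Gi = mat 1" by (auto simp: invertible_def)
  then have GGiv: "G *v (Gi *v x) = x" for x by (simp add: matrix_vector_mul_assoc matrix_vector_mul_lid)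
  have "matrix_inv (g q) = J_inv q ** Gi ** transpose (J_inv q)" for q
  proof (rule matrix_inv_eqI)
    have "transpose (J q) ** transpose (J_inv q) = mat 1"
      using J_inverse(1)[of q] by (simp add: matrix_transpose_mul[symmetric])
    have "g q ** (J_inv q ** Gi ** transpose (J_inv q)) =
        transpose (J q) ** (G ** ((J q ** J_inv q) ** Gi)) ** transpose (J_inv q)"
      unfolding G by (simp only: matrix_mul_assoc)
    also have "\<dots> = mat 1"
      using \<open>transpose (J q) ** transpose (J_inv q) = mat 1\<close>
      by (simp add: J_inverse GGi matrix_mul_lid matrix_mul_rid)
    finally show "g q ** (J_inv q ** Gi ** transpose (J_inv q)) = mat 1" .
  qed
  then have "conorm_sq g q p = conjugate_momentum \<phi> q p \<bullet> (Gi *v conjugate_momentum \<phi> q p)" for q p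
    unfolding conorm_sq_def conjugate_momentum_eq
    by (simp only: matrix_vector_mul_assoc[symmetric] dot_matrix_vector_adjoint[of p])
  moreover have "x \<bullet> (Gi *v y) = y \<bullet> (Gi *v x)" for x y
    using G_sym[of "Gi *v x" "Gi *v y"] by (simp add: GGiv inner_commute)
  moreover have "x \<bullet> (Gi *v x) > 0" if "x \<noteq> 0" for x
  proof -
    have "Gi *v x \<noteq> 0" using GGiv[of x] that by (metis matrix_vector_mult_0_right)
    then show ?thesis using G_pos[of "Gi *v x"] by (simp add: GGiv inner_commute)
  qed
  ultimately show ?thesis using that by blast
qed

end

section \<open>The thermostated Hamiltonian\<close>

lemma nose_thermostat_free:
  "nose_thermostat M k T (mechanical_hamiltonian g V 0) (s, q, ps, p) =
     nose_oscillator (conorm_sq g q p) (real CARD('n) * k * T) M (s, ps)"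
  for g :: "real^'n::finite \<Rightarrow> real^'n^'n"
proof -
  have "conorm_sq g q (p /\<^sub>R s) = inverse s * (inverse s * conorm_sq g q p)"
    unfolding conorm_sq_def by (simp add: matrix_vector_mult_scaleR)
  then have "conorm_sq g q (p /\<^sub>R s) / 2 = conorm_sq g q p / (2 * s\<^sup>2)"
    by (cases "s = 0") (simp_all add: field_simps power2_eq_square)
  then show ?thesis
    by (simp add: nose_thermostat_def mechanical_hamiltonian_def nose_oscillator_def)
qed

text \<open>At an equilibrium \<open>\<partial>F/\<partial>p\<^sub>s = p\<^sub>s/M = 0\<close> and \<open>\<partial>F/\<partial>s = - R/s\<^sup>3 + c/s = 0\<close>.\<close>

lemma thermostatic_equilibria_nose:
  assumes F: "\<And>s q ps p. F (s, q, ps, p) = nose_oscillator (R q p) c M (s, ps)"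
    and "M > 0" and z: "(s, q, ps, p) \<in> thermostatic_equilibria F"
  shows "s > 0" "ps = 0" "R q p = c * s\<^sup>2"
proof -
  have d: "deriv (\<lambda>x. F (s, q, x, p)) ps = 0" "deriv (\<lambda>x. F (x, q, ps, p)) s = 0" and s: "s > 0"
    using z by (auto simp: thermostatic_equilibria_def hamiltonian_vector_field_def)
  have "((\<lambda>x. F (s, q, x, p)) has_real_derivative ps / M) (at ps)"
    unfolding F nose_oscillator_def split using \<open>M > 0\<close>
    by (auto intro!: derivative_eq_intros simp: field_simps)
  then show "ps = 0" using d(1) \<open>M > 0\<close> DERIV_imp_deriv by fastforce
  have "((\<lambda>x. F (x, q, ps, p)) has_real_derivative - (R q p) / s ^ 3 + c / s) (at s)"
    unfolding F nose_oscillator_def split using s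
    by (auto intro!: derivative_eq_intros simp: field_simps power2_eq_square power3_eq_cube)
  then have "- (R q p) / s ^ 3 + c / s = 0" using d(2) DERIV_imp_deriv by fastforce
  then show "R q p = c * s\<^sup>2" using s by (simp add: field_simps power2_eq_square power3_eq_cube)
  show "s > 0" by (rule s)
qed

lemma excess_energy_equilibrium:
  assumes "c > 0" "s > 0" "R = c * s\<^sup>2"
  shows "excess_energy R c M (s, 0) = 0"
  using assms by (simp add: excess_energy_def nose_oscillator_def ln_mult ln_realpow field_simps)

theorem theorem1p1:
  fixes g :: "real^'n::finite \<Rightarrow> real^'n^'n"
    and V :: "real^'n \<Rightarrow> real"
    and \<phi> :: "real^'n \<Rightarrow> real^'n"
    and H :: "real \<Rightarrow> (real^'n) \<times> (real^'n) \<Rightarrow> real"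
    and F :: "real \<Rightarrow> 'n phase \<Rightarrow> real"
    and r k M T :: real
  assumes "r > 2 * real CARD('n) + 2" and "torus_periodic V" and "class_C r V"
    and "torus_metric g" and "flat_metric g"
    and "flat_coordinates g \<phi>"
    and "k > 0" and "M > 0" and "T > 0"
    and "\<And>\<epsilon>. H \<epsilon> = mechanical_hamiltonian g V \<epsilon>"
    and "\<And>\<epsilon>. F \<epsilon> = nose_thermostat M k T (H \<epsilon>)"
  shows "\<exists>h U. function_of_actions (F 0) \<phi> h \<and>
           open U \<and> (\<forall>s q ps p. \<forall>m\<in>int_lattice. (s, q, ps, p) \<in> U \<longrightarrow> (s, q + m, ps, p) \<in> U) \<and>
           thermostatic_equilibria (F 0) \<subseteq> U \<and> U \<subseteq> action_domain \<and>
           (\<forall>z\<in>U. kolmogorov_nondegenerate h (actions (F 0) \<phi> z) \<and>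
                   isoenergetically_nondegenerate h (actions (F 0) \<phi> z))"
proof -
  define c where "c = real CARD('n) * k * T"
  have c: "c > 0" using assms by (simp add: c_def)
  define R where "R = conorm_sq g"
  have F: "F 0 (s, q, ps, p) = nose_oscillator (R q p) c M (s, ps)" for s q ps p
    unfolding assms(10,11) c_def R_def by (rule nose_thermostat_free)
  interpret flat: flat_torus g \<phi> using assms by unfold_locales
  obtain Gi :: "real^'n^'n" where Gi:
    "\<And>q p. conorm_sq g q p = conjugate_momentum \<phi> q p \<bullet> (Gi *v conjugate_momentum \<phi> q p)"
    "\<And>x y. x \<bullet> (Gi *v y) = y \<bullet> (Gi *v x)" "\<And>x. x \<noteq> 0 \<Longrightarrow> x \<bullet> (Gi *v x) > 0"
    using flat.constant_cometric by blast
  have R_pos: "R q p > 0" if "p \<noteq> 0" for q p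
    using Gi(3)[of "conjugate_momentum \<phi> q p"] flat.conjugate_momentum_eq_0_iff that
    by (simp add: R_def Gi(1))
  obtain J p m where "turning_points J p m"
    using turning_point_functions unfolding turning_points_def by metis
  then interpret tp: turning_points J p m .
  obtain K E E1 where K: "open K" "smooth_on K E"
    "\<And>x. x \<ge> 0 \<Longrightarrow> tp.reduced_action x \<in> K" "\<And>x. x \<ge> 0 \<Longrightarrow> E (tp.reduced_action x) = x"
    "tp.reduced_action 0 = 0" "continuous_on {0..} tp.reduced_action"
    "\<And>b. b \<in> K \<Longrightarrow> (E has_real_derivative E1 b) (at b)"
    "E1 0 = 2" "(E1 has_real_derivative -11/3) (at 0)"
    using tp.energy_of_action by metis
  define a :: "real^('n option) \<Rightarrow> real" where "a I = I $ None" for I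
  define P :: "real^('n option) \<Rightarrow> real^'n" where "P I = (\<chi> i. I $ Some i)" for I
  define b where "b I I' = P I \<bullet> (Gi *v P I')" for I I'
  have P_linear: "linear P"
    by (rule linearI) (simp_all add: P_def vec_eq_iff)
  have Gi_linear: "linear ((*v) Gi)" by simp
  \<comment> \<open>the index \<open>None\<close> carries the action \<open>A\<close>, the indices \<open>Some i\<close> the momenta\<close>
  interpret ah: action_hamiltonian a b "axis None 1" E E1 K c M
  proof (rule action_hamiltonian.intro)
    show "bounded_linear a" unfolding a_def[abs_def] by (rule bounded_linear_vec_nth)
    have "bilinear b"
      unfolding bilinear_def b_def[abs_def]
      by (intro allI conjI linearI)
         (simp_all add: linear_add[OF P_linear] linear_cmul[OF P_linear] inner_add_left inner_add_right
            linear_add[OF Gi_linear] linear_cmul[OF Gi_linear])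
    then show "bounded_bilinear b" by (simp add: bilinear_conv_bounded_bilinear)
    show "b x y = b y x" for x y unfolding b_def by (rule Gi(2))
    show "a (axis None 1) = 1" by (simp add: a_def axis_def)
    have "P (axis None 1) = 0" by (simp add: P_def axis_def vec_eq_iff)
    then show "b (axis None 1) y = 0" for y by (simp add: b_def)
    show "y = 0" if "a y = 0" "b y y = 0" for y
    proof -
      have "P y = 0" using Gi(3)[of "P y"] that(2) by (force simp: b_def)
      then show ?thesis using that(1) by (simp add: P_def a_def vec_eq_iff split_option_all)
    qed
    show "0 \<in> K" using K(3)[of 0] K(5) by simp
  qed (use K c assms in auto)
  define A where "A = actions (F 0) \<phi>"
  have slice: "(\<lambda>(s', ps'). F 0 (s', q, ps', p)) = nose_oscillator (R q p) c M" for q p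
    by (auto simp: F)
  have A_None: "A (s, q, ps, p) $ None = sqrt (2 * M * R q p) * tp.reduced_action (excess_energy (R q p) c M (s, ps))"
    and excess_nonneg: "excess_energy (R q p) c M (s, ps) \<ge> 0"
    if "s > 0" "p \<noteq> 0" for s q ps p
    using tp.level_curve_action_nose_oscillator[OF R_pos[OF that(2)] c \<open>M > 0\<close>, of "(s, ps)"]
      tp.level_curve_parametrization(1)[OF R_pos[OF that(2)] c \<open>M > 0\<close>, of "(s, ps)"] that
    by (auto simp: A_def actions_def slice)
  have A_Some: "A (s, q, ps, p) $ Some i = conjugate_momentum \<phi> q p $ i" for s q ps p i
    by (simp add: A_def actions_def)
  have bA: "b (A (s, q, ps, p)) (A (s, q, ps, p)) = R q p" for s q ps p
    by (simp add: b_def P_def A_Some R_def Gi(1))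
  have scaled: "a (A (s, q, ps, p)) * ah.scale (A (s, q, ps, p)) = tp.reduced_action (excess_energy (R q p) c M (s, ps))"
    if "s > 0" "p \<noteq> 0" for s q ps p
    using R_pos[OF that(2), of q] \<open>M > 0\<close> unfolding ah.scale_def bA a_def A_None[OF that] by simp
  have A_W: "A z \<in> ah.W" and F_h: "F 0 z = ah.h (A z)" if "z \<in> action_domain" for z
  proof -
    obtain s q ps p where z: "z = (s, q, ps, p)" "s > 0" "p \<noteq> 0"
      using \<open>z \<in> action_domain\<close> by (auto simp: action_domain_def)
    show "A z \<in> ah.W"
      using z scaled[OF z(2,3)] K(3)[OF excess_nonneg[OF z(2,3)]] R_pos by (simp add: ah.W_def bA)
    show "F 0 z = ah.h (A z)"
      unfolding z(1) ah.h_def scaled[OF z(2,3)] bA K(4)[OF excess_nonneg[OF z(2,3)]] F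
      by (rule nose_oscillator_eq[OF c])
  qed
  have fa: "function_of_actions (F 0) \<phi> ah.h"
    unfolding function_of_actions_def A_def[symmetric]
    using ah.open_W ah.smooth_h A_W F_h by blast
  have open_AD: "open (action_domain :: 'n phase set)"
  proof -
    have "(action_domain :: 'n phase set) = {z. fst z > 0} \<inter> {z. snd (snd (snd z)) \<noteq> 0}"
      by (auto simp: action_domain_def)
    also have "open \<dots>"
      by (intro open_Int open_Collect_less open_Collect_neq continuous_intros)
    finally show ?thesis .
  qed
  have cont_P: "continuous_on S (\<lambda>z. conjugate_momentum \<phi> (fst (snd z)) (snd (snd (snd z))))"
    for S :: "'n phase set"
    using continuous_on_compose2[OF flat.continuous_conjugate_momentum,
        of S "\<lambda>z. (fst (snd z), snd (snd (snd z)))"]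
    by (simp add: continuous_intros)
  have cont_R: "continuous_on S (\<lambda>z. R (fst (snd z)) (snd (snd (snd z))))" for S :: "'n phase set"
    unfolding R_def Gi(1)
    by (intro continuous_intros cont_P linear_continuous_on_compose[OF cont_P Gi_linear])
  have cont_A: "continuous_on action_domain A"
  proof -
    have "continuous_on action_domain (\<lambda>z. A z $ i)" for i
    proof (cases i)
      case None
      have x: "continuous_on (action_domain :: 'n phase set) (\<lambda>z. excess_energy (R (fst (snd z)) (snd (snd (snd z)))) c M
          (fst z, fst (snd (snd z))))"
        unfolding excess_energy_def nose_oscillator_def split
        using c \<open>M > 0\<close> R_pos[THEN less_imp_neq, THEN not_sym]
        by (intro continuous_intros cont_R) (auto simp: action_domain_def)
      have "continuous_on (action_domain :: 'n phase set) (\<lambda>z. sqrt (2 * M * R (fst (snd z)) (snd (snd (snd z)))) *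
          tp.reduced_action (excess_energy (R (fst (snd z)) (snd (snd (snd z)))) c M (fst z, fst (snd (snd z)))))"
        by (intro continuous_intros cont_R continuous_on_compose2[OF K(6) x])
           (auto simp: action_domain_def intro: excess_nonneg)
      then show ?thesis
        unfolding None by (rule continuous_on_eq) (auto simp: action_domain_def A_None)
    next
      case (Some j)
      have "continuous_on (action_domain :: 'n phase set) (\<lambda>z. conjugate_momentum \<phi> (fst (snd z)) (snd (snd (snd z))) $ j)"
        by (intro continuous_intros cont_P)
      then show ?thesis
        unfolding Some by (rule continuous_on_eq) (auto simp: A_Some)
    qed
    then have "continuous_on action_domain (\<lambda>z. \<chi> i. A z $ i)" by (rule continuous_on_vec_lambda)
    then show ?thesis by simp
  qed
  \<comment> \<open>equilibria have zero action, where the Hamiltonian is non-degenerate\<close>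
  define good where "good = {x \<in> ah.W. kolmogorov_nondegenerate ah.h x \<and> isoenergetically_nondegenerate ah.h x}"
  define U where "U = action_domain \<inter> A -` good"
  have "open good" unfolding good_def by (rule open_nondegenerate[OF ah.open_W ah.smooth_h])
  then have "open U"
    unfolding U_def by (rule continuous_open_preimage[OF cont_A open_AD])
  moreover have "(s, q + l, ps, p) \<in> U" if "l \<in> int_lattice" "(s, q, ps, p) \<in> U" for s q ps p l
  proof -
    have cm: "conjugate_momentum \<phi> (q + l) p = conjugate_momentum \<phi> q p"
      by (rule flat.conjugate_momentum_periodic[OF that(1)])
    have "R (q + l) p = R q p" by (simp add: R_def Gi(1) cm)
    then have "A (s, q + l, ps, p) = A (s, q, ps, p)"
      unfolding A_def actions_def split slice cm by simp
    then show ?thesis using that(2) by (simp add: U_def action_domain_def)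
  qed
  moreover have "thermostatic_equilibria (F 0) \<subseteq> U"
  proof
    fix z assume z: "z \<in> thermostatic_equilibria (F 0)"
    obtain s q ps p where zeq: "z = (s, q, ps, p)" by (metis prod_cases4)
    note eq = thermostatic_equilibria_nose[OF F \<open>M > 0\<close> z[unfolded zeq]]
    have "R q p > 0" using eq c by simp
    then have "p \<noteq> 0" by (auto simp: R_def conorm_sq_def)
    then have AD: "z \<in> action_domain" using eq zeq by (simp add: action_domain_def)
    have "a (A z) = 0"
      using A_None[OF eq(1) \<open>p \<noteq> 0\<close>, of q ps] excess_energy_equilibrium[OF c eq(1,3), of M] eq(2) K(5)
      by (simp add: a_def zeq)
    then show "z \<in> U"
      using ah.nondegenerate_at_zero_action[OF A_W[OF AD]] A_W[OF AD] AD by (simp add: U_def good_def)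
  qed
  moreover have "U \<subseteq> action_domain" by (auto simp: U_def)
  moreover have "\<forall>z\<in>U. kolmogorov_nondegenerate ah.h (A z) \<and> isoenergetically_nondegenerate ah.h (A z)"
    by (simp add: U_def good_def)
  ultimately show ?thesis
    unfolding A_def using fa by (intro exI[of _ ah.h] exI[of _ U]) blast
qed

end
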